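(* Let $b>-\frac12$, let $f\in |y|^{b}\mathcal{S}(\mathbb{R})$, let $t\in\mathbb{R}$ and let $x\in\mathbb{R}\setminus\{0\}$. Then \[e^{tD_{b}}f(x)= |x|^{b}\lim_{\varepsilon\rightarrow +0}\int_{-\infty}^{\infty}\frac{-1}{2\pi i}\left(\frac{\Phi_{b}(x,y;t+i\varepsilon)}{x+(t+i\varepsilon)-y} -\frac{\Phi_{b}(x,y;t-i\varepsilon)}{x+(t-i\varepsilon)-y} \right)f(y)\,|y|^{b}\,dy. \]
   Context: Let $b>-\frac12$. $\mathcal S(\mathbb R)$ is the Schwartz space and $|x|^b\mathcal S(\mathbb R)=\{|x|^b g(x): g\in\mathcal S(\mathbb R)\}\subset L^2(\mathbb R)$. The operator $D_b$ with domain $|x|^{b}\mathcal{S}(\mathbb{R})$ is $D_{b}f(x)=\frac{df}{dx}(x)-\frac{b}{x}f(-x)$. It is essentially skew-adjoint on $L^2(\mathbb R)$, and $e^{tD_b}$ ($t\in\mathbb R$) denotes the one-parameter unitary group on $L^2(\mathbb R)$ generated by its closure. This group maps $|x|^b\mathcal S(\mathbb R)$ into itself; for $f\in|x|^b\mathcal S(\mathbb R)$, $e^{tD_b}f(x)$ at $x\ne0$ means the value of the representative lying in $|x|^b\mathcal S(\mathbb R)$ (continuous on $\mathbb R\setminus\{0\}$). Legendre function of the second kind: \[Q_{\nu}(w)=\frac12\sum_{m=0}^{\infty}\frac{\Gamma\left(\frac{\nu+1}{2}+m\right)\Gamma\left(\frac{\nu+2}{2}+m\right)}{\Gamma\left(\nu+\frac32+m\right)m!}\,w^{-2m-\nu-1}\qquad(w>1),\]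 continued analytically to $\mathbb C\setminus(-\infty,1]$. Put $\Psi_b(w)=b\,w^b\bigl(Q_{b-1}(w)-Q_b(w)\bigr)$, i.e. for $|w|>1$ \[\Psi_b(w)=\frac b2\left(\sum_{m\ge0}\frac{\Gamma(\frac b2+m)\Gamma(\frac{b+1}2+m)}{\Gamma(b+\frac12+m)\,m!}w^{-2m}-\sum_{m\ge0}\frac{\Gamma(\frac{b+1}2+m)\Gamma(\frac{b+2}2+m)}{\Gamma(b+\frac32+m)\,m!}w^{-2m-1}\right),\] continued analytically to $\mathbb C\setminus[-1,1]$. For $b=0$ the product $b\,\Gamma(\frac b2)$ (equivalently $b\,Q_{b-1}$) is understood by its limit $b\to0$, so that $\Psi_0=1$. For nonzero real $x,y$ and $z\in\mathbb C\setminus\mathbb R$, \[\Phi_{b}(x,y;z)= \left(\frac{x^2+y^2-z^2}{2}\right)^{-b}\Psi_{b}\left(\frac{x^2+y^2-z^2}{2xy}\right)\] with the principal branch of the power; equivalently \[|x|^b|y|^b\Phi_b(x,y;z)=b\left\{Q_{b-1}\left(\frac{x^2+y^2-z^2}{2|x||y|}\right)-\mathrm{sgn}(xy)\,Q_b\left(\frac{x^2+y^2-z^2}{2|x||y|}\right)\right\}.\] *)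

theory Defs
  imports "HOL-Analysis.Analysis"
begin

section \<open>Schwartz functions and the weighted Schwartz space\<close>

(* The witness G is the (unique) sequence of iterated derivatives of g. *)
definition schwartz :: "(real \<Rightarrow> complex) set" where
  "schwartz = {g. \<exists>G :: nat \<Rightarrow> real \<Rightarrow> complex. G 0 = g \<and>
     (\<forall>n x. (G n has_vector_derivative G (Suc n) x) (at x)) \<and>
     (\<forall>k n. bounded (range (\<lambda>x. x ^ k *\<^sub>R G n x)))}"

(* |x|^b S(R).  For b < 0 the function |x|^b has no value at 0, so the value at 0 (a null set)
   is left unconstrained; the functions are determined, and continuous, off 0. *)
definition weighted_schwartz :: "real \<Rightarrow> (real \<Rightarrow> complex) set" where
  "weighted_schwartz b =
     {f. \<exists>g\<in>schwartz. \<forall>x. x \<noteq> 0 \<longrightarrow> f x = of_real (\<bar>x\<bar> powr b) * g x}"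

section \<open>Operators and unitary groups on L2 of the real line\<close>

(* Elements of L2(R) are represented by Borel functions; two of them are the same element
   iff they agree almost everywhere.  All notions below respect this identification. *)
definition L2 :: "(real \<Rightarrow> complex) set" where
  "L2 = {f \<in> borel_measurable lborel. integrable lborel (\<lambda>x. (cmod (f x))\<^sup>2)}"

definition L2_norm :: "(real \<Rightarrow> complex) \<Rightarrow> real" where
  "L2_norm f = sqrt (\<integral>x. (cmod (f x))\<^sup>2 \<partial>lborel)"

definition L2_eq :: "(real \<Rightarrow> complex) \<Rightarrow> (real \<Rightarrow> complex) \<Rightarrow> bool" where
  "L2_eq f g \<longleftrightarrow> (AE x in lborel. f x = g x)"

definition unitary_L2 :: "((real \<Rightarrow> complex) \<Rightarrow> (real \<Rightarrow> complex)) \<Rightarrow> bool" where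
  "unitary_L2 T \<longleftrightarrow>
     (\<forall>f\<in>L2. T f \<in> L2) \<and>
     (\<forall>f\<in>L2. \<forall>g\<in>L2. L2_eq f g \<longrightarrow> L2_eq (T f) (T g)) \<and>
     (\<forall>f\<in>L2. \<forall>g\<in>L2. \<forall>a c. L2_eq (T (\<lambda>x. a * f x + c * g x)) (\<lambda>x. a * T f x + c * T g x)) \<and>
     (\<forall>f\<in>L2. L2_norm (T f) = L2_norm f) \<and>
     (\<forall>g\<in>L2. \<exists>f\<in>L2. L2_eq (T f) g)"

definition unitary_group :: "(real \<Rightarrow> (real \<Rightarrow> complex) \<Rightarrow> (real \<Rightarrow> complex)) \<Rightarrow> bool" where
  "unitary_group U \<longleftrightarrow>
     (\<forall>t. unitary_L2 (U t)) \<and>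
     (\<forall>f\<in>L2. L2_eq (U 0 f) f) \<and>
     (\<forall>s t. \<forall>f\<in>L2. L2_eq (U (s + t) f) (U s (U t f))) \<and>
     (\<forall>f\<in>L2. ((\<lambda>t. L2_norm (\<lambda>x. U t f x - f x)) \<longlongrightarrow> 0) (at 0))"

(* Unbounded operators are given by their graphs. *)
definition generator ::
    "(real \<Rightarrow> (real \<Rightarrow> complex) \<Rightarrow> (real \<Rightarrow> complex)) \<Rightarrow> ((real \<Rightarrow> complex) \<times> (real \<Rightarrow> complex)) set" where
  "generator U = {(f, h). f \<in> L2 \<and> h \<in> L2 \<and>
     ((\<lambda>t. L2_norm (\<lambda>x. (U t f x - f x) / of_real t - h x)) \<longlongrightarrow> 0) (at 0)}"

definition L2_closure ::
    "((real \<Rightarrow> complex) \<times> (real \<Rightarrow> complex)) set \<Rightarrow> ((real \<Rightarrow> complex) \<times> (real \<Rightarrow> complex)) set" where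
  "L2_closure A = {(f, h). f \<in> L2 \<and> h \<in> L2 \<and>
     (\<exists>u v. (\<forall>n::nat. (u n, v n) \<in> A) \<and>
        (\<lambda>n. L2_norm (\<lambda>x. u n x - f x)) \<longlonglongrightarrow> 0 \<and>
        (\<lambda>n. L2_norm (\<lambda>x. v n x - h x)) \<longlonglongrightarrow> 0)}"

section \<open>The operator D\<close>

definition D_op :: "real \<Rightarrow> (real \<Rightarrow> complex) \<Rightarrow> (real \<Rightarrow> complex)" where
  "D_op b f x = vector_derivative f (at x) - of_real (b / x) * f (- x)"

definition D_graph :: "real \<Rightarrow> ((real \<Rightarrow> complex) \<times> (real \<Rightarrow> complex)) set" where
  "D_graph b = {(f, D_op b f) | f. f \<in> weighted_schwartz b}"

(* U is the family of operators U t = exp(t D), D being the closure of D_op b on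
   weighted_schwartz b; it is unique up to almost-everywhere equality. *)
definition is_exp_D :: "real \<Rightarrow> (real \<Rightarrow> (real \<Rightarrow> complex) \<Rightarrow> (real \<Rightarrow> complex)) \<Rightarrow> bool" where
  "is_exp_D b U \<longleftrightarrow> unitary_group U \<and> generator U = L2_closure (D_graph b)"

section \<open>Legendre functions of the second kind and the kernel\<close>

(* The Legendre function of the second kind, as given by its expansion at infinity.
   It is used only for |w| > 1, where the series converges. *)
definition legendre_Q :: "real \<Rightarrow> complex \<Rightarrow> complex" where
  "legendre_Q \<nu> w = 1/2 * (\<Sum>m. of_real (Gamma ((\<nu> + 1) / 2 + real m) * Gamma ((\<nu> + 2) / 2 + real m)
                                  / (Gamma (\<nu> + 3/2 + real m) * fact m))
                           * w powr of_real (- 2 * real m - \<nu> - 1))"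

(* The analytic function on the plane slit along [-1,1] that equals
   b w^b (Q_{b-1}(w) - Q_b(w)) for |w| > 1.  The principal branches cancel:
   w^b w^{-2m-b} = w^{-2m} and w^b w^{-2m-b-1} = w^{-2m-1}, also for w < -1.
   For b = 0 the factor b Q_{b-1} stands for its limit as b tends to 0, which is 1. *)
definition Psi :: "real \<Rightarrow> complex \<Rightarrow> complex" where
  "Psi b = (SOME F. F holomorphic_on (- closed_segment (-1) 1) \<and>
     (\<forall>w. cmod w > 1 \<longrightarrow>
        F w = (if b = 0 then 1
               else of_real b * w powr of_real b * (legendre_Q (b - 1) w - legendre_Q b w))))"

definition Phi :: "real \<Rightarrow> real \<Rightarrow> real \<Rightarrow> complex \<Rightarrow> complex" where
  "Phi b x y z = ((of_real (x\<^sup>2 + y\<^sup>2) - z\<^sup>2) / 2) powr of_real (- b)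
                 * Psi b ((of_real (x\<^sup>2 + y\<^sup>2) - z\<^sup>2) / of_real (2 * x * y))"

definition jump_kernel :: "real \<Rightarrow> real \<Rightarrow> real \<Rightarrow> real \<Rightarrow> real \<Rightarrow> complex" where
  "jump_kernel b t \<epsilon> x y =
     - 1 / (2 * of_real pi * \<i>) *
       (Phi b x y (of_real t + \<i> * of_real \<epsilon>) / (of_real x + (of_real t + \<i> * of_real \<epsilon>) - of_real y)
      - Phi b x y (of_real t - \<i> * of_real \<epsilon>) / (of_real x + (of_real t - \<i> * of_real \<epsilon>) - of_real y))"

end

theory Submission
  imports Defs "HOL-Complex_Analysis.Complex_Analysis" "HOL-Real_Asymp.Real_Asymp"
begin

text \<open>
  Conjugation by \<open>\<bar>x\<bar>\<^bsup>b\<^esup>\<close> turns \<open>D\<^sub>b\<close> into the Dunkl operator \<open>T g(x) = g'(x) + b (g(x) - g(-x)) / x\<close> on Schwartz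
  functions.  Its eigenfunctions are \<open>E(isx)\<close>, where \<open>E\<close> is the Dunkl kernel, a deformation of the exponential
  series (\<open>dk_ode\<close>), and the corresponding transform with weight \<open>\<bar>s\<bar>\<^bsup>2b\<^esup>\<close> diagonalizes \<open>T\<close>.  On the imaginary axis
  the kernel grows at most linearly, by an energy estimate that uses \<open>b > - 1/2\<close>; as the transform exchanges \<open>T\<close>
  and multiplication by \<open>x\<close>, it preserves the Schwartz space (\<open>dtr_schwartz\<close>).  Its square, followed by
  a reflection, commutes with multiplication by \<open>x\<close>, hence acts pointwise, and the Gaussian shows that it is a constant
  (\<open>dtr_inversion\<close>).  The Plancherel formula follows.  Therefore
  \<open>g\<^sub>t(x) = const \<integral> e\<^bsup>its\<^esup> E(isx) (\<integral> E(-isy) g(y) \<bar>y\<bar>\<^bsup>2b\<^esup> dy) \<bar>s\<bar>\<^bsup>2b\<^esup> ds\<close> is a Schwartz function, and \<open>\<bar>x\<bar>\<^bsup>b\<^esup> g\<^sub>t\<close> is a strongly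
  differentiable curve that solves the evolution equation.  A unitary group with the closure of \<open>D\<^sub>b\<close> as its
  generator must move \<open>\<bar>x\<bar>\<^bsup>b\<^esup> g\<^sub>0\<close> along this curve (\<open>exp_D_eq_evol\<close>).

  With a damping factor \<open>e\<^bsup>-\<epsilon>\<bar>s\<bar>\<^esup>\<close> the two integrals may be interchanged, and the inner one becomes the sum of two
  values, at \<open>z = t + i \<epsilon>\<close> and at a reflected argument, of \<open>L(x, y, z) = \<integral>\<^sub>0\<^sup>\<infinity> e\<^bsup>izs\<^esup> E(isx) E(-isy) s\<^bsup>2b\<^esup> ds\<close>.  It remains
  to prove that \<open>L\<close> is a constant multiple of \<open>\<Phi>\<^sub>b(x, y; z) / (x + z - y)\<close> for \<open>Im z > 0\<close> (\<open>lap_eq_Phi\<close>); then the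
  jump kernel is the damped spectral kernel (\<open>jump_kernel_eq\<close>), and the damping disappears in the limit because the spectral
  function decreases rapidly (\<open>damped_limit\<close>).

  For this, put \<open>M = (x - y + z) L\<close>.  Homogeneity and the eigenvalue equation of \<open>E\<close> give a linear system of first
  order in \<open>z\<close> for \<open>M\<close> at the points \<open>(\<plusminus> x, \<plusminus> y)\<close>, and a comparison at infinity shows \<open>M(-x, -y) = M(x, y)\<close>, which
  leaves the two functions \<open>M(x, y)\<close> and \<open>M(-x, y)\<close>.  The Legendre functions, expanded at infinity, satisfy the same
  system.  Its matrix has trace zero, so the Wronskian of the two solutions is constant; it tends to zero at
  infinity, and the solutions are proportional there (\<open>mlap_eq_phis\<close>).  The Laplace transform also provides the
  continuation of \<open>\<Psi>\<^sub>b\<close> into the disc (\<open>Psi_exists\<close>), and the identity extends to the whole half-plane by analytic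
  continuation.  The constants agree by the duplication formula of the Gamma function (\<open>clap_azero\<close>).
\<close>

section \<open>The Dunkl kernel\<close>

lemma powser_euler:
  fixes c :: "nat \<Rightarrow> complex"
  assumes "\<And>w. cmod w < R \<Longrightarrow> summable (\<lambda>n. c n * w ^ n)" "cmod z < R"
  shows "((\<lambda>z. \<Sum>n. c n * z ^ n) has_field_derivative (\<Sum>n. diffs c n * z ^ n)) (at z)"
    and "(\<lambda>n. of_nat n * c n * z ^ n) sums (z * (\<Sum>n. diffs c n * z ^ n))"
proof -
  show "((\<lambda>z. \<Sum>n. c n * z ^ n) has_field_derivative (\<Sum>n. diffs c n * z ^ n)) (at z)"
    by (rule termdiffs_strong'[OF assms])
  have "summable (\<lambda>n. diffs c n * z ^ n)"
    using assms by (intro termdiff_converges[of z R]) auto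
  from sums_mult[OF diffs_equiv[OF this], of z]
  have "(\<lambda>n. z * (of_nat n * c n * z ^ (n - Suc 0))) sums (z * (\<Sum>n. diffs c n * z ^ n))" .
  moreover have "z * (of_nat n * c n * z ^ (n - Suc 0)) = of_nat n * c n * z ^ n" for n
    by (cases n) auto
  ultimately show "(\<lambda>n. of_nat n * c n * z ^ n) sums (z * (\<Sum>n. diffs c n * z ^ n))" by simp
qed

locale dunkl =
  fixes b :: real
  assumes b_gt: "b > - 1/2"
begin

text \<open>The generalized integers and factorials for which \<open>\<Sum> z\<^sup>n / dfact n\<close> plays the role of the exponential
  series.  All \<open>dnum n\<close> with \<open>n > 0\<close> are positive exactly because \<open>2 b + 1 > 0\<close>.\<close>

definition dnum :: "nat \<Rightarrow> real" where
  "dnum n = real n + b * (1 - (-1) ^ n)"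

definition dfact :: "nat \<Rightarrow> real" where
  "dfact n = (\<Prod>k<n. dnum (Suc k))"

lemma dnum_0 [simp]: "dnum 0 = 0" by (simp add: dnum_def)

lemma dfact_0 [simp]: "dfact 0 = 1" by (simp add: dfact_def)

lemma dfact_Suc: "dfact (Suc n) = dfact n * dnum (Suc n)" by (simp add: dfact_def)

definition dlow :: real where "dlow = min 1 (1 + 2 * b)"

lemma dlow: "dlow > 0" "dlow \<le> 1" "dlow \<le> 1 + 2 * b"
  using b_gt by (auto simp: dlow_def)

lemma dnum_lower: "dlow * real n \<le> dnum n"
proof -
  have 1: "dlow * real n \<le> 1 * real n" using dlow by (intro mult_right_mono) auto
  consider "even n" | "odd n" "b \<ge> 0" | "odd n" "b < 0" by linarith
  then show ?thesis
  proof cases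
    case 3
    then have "real n \<ge> 1" by (cases n) auto
    then have bn: "b * real n \<le> b * 1" using 3 by (intro mult_left_mono_neg) auto
    moreover have "dlow * real n \<le> (1 + 2 * b) * real n"
      using dlow by (intro mult_right_mono) auto
    moreover have "(1 + 2 * b) * real n = real n + 2 * (b * real n)" by (simp add: algebra_simps)
    moreover have "dnum n = real n + 2 * b" using 3 by (simp add: dnum_def)
    ultimately show ?thesis using bn by linarith
  qed (use 1 in \<open>simp_all add: dnum_def\<close>)
qed

lemma dnum_pos:
  assumes "n > 0" shows "dnum n > 0"
proof -
  have "0 < dlow * real n" using assms dlow by simp
  also have "\<dots> \<le> dnum n" by (rule dnum_lower)
  finally show ?thesis .
qed

lemma dfact_pos: "dfact n > 0"
  unfolding dfact_def by (intro prod_pos) (auto simp: dnum_pos)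

lemma dfact_lower: "dlow ^ n * fact n \<le> dfact n"
proof (induction n)
  case (Suc n)
  have "dlow ^ Suc n * fact (Suc n)
        = (dlow ^ n * fact n) * (dlow * real (Suc n))"
    by (simp add: algebra_simps)
  also have "\<dots> \<le> dfact n * dnum (Suc n)"
    using Suc dnum_lower[of "Suc n"] dlow dfact_pos[of n] by (intro mult_mono) auto
  finally show ?case by (simp add: dfact_Suc)
qed auto

definition dk :: "complex \<Rightarrow> complex" where
  "dk z = (\<Sum>n. 1 / of_real (dfact n) * z ^ n)"

lemma dk_summable: "summable (\<lambda>n. 1 / of_real (dfact n) * z ^ n :: complex)"
proof (rule summable_comparison_test')
  show "summable (\<lambda>n. inverse (fact n) * (cmod z / dlow) ^ n)" by (rule summable_exp)
  fix n
  have "inverse (dfact n) \<le> inverse (dlow ^ n * fact n)"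
    using dfact_lower[of n] dlow by (intro le_imp_inverse_le) auto
  then have "inverse (dfact n) * cmod z ^ n \<le> inverse (dlow ^ n * fact n) * cmod z ^ n"
    by (intro mult_right_mono) auto
  then show "norm (1 / of_real (dfact n) * z ^ n) \<le> inverse (fact n) * (cmod z / dlow) ^ n"
    using dfact_pos[of n] by (simp add: norm_mult norm_divide norm_power inverse_eq_divide
      power_divide mult.commute)
qed

lemma dk_0 [simp]: "dk 0 = 1"
  unfolding dk_def by (subst powser_zero) simp

lemma dk_holomorphic: "dk holomorphic_on UNIV"
  unfolding holomorphic_on_def
proof
  fix z
  have "(dk has_field_derivative (\<Sum>n. diffs (\<lambda>n. 1 / of_real (dfact n)) n * z ^ n)) (at z)"
    unfolding dk_def by (rule powser_euler(1)[OF dk_summable, of _ "cmod z + 1"]) simp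
  then show "dk field_differentiable at z within UNIV" by (auto simp: field_differentiable_def)
qed

lemma dk_cnj: "dk (cnj z) = cnj (dk z)"
proof -
  have "(\<lambda>n. cnj (1 / of_real (dfact n) * z ^ n)) sums cnj (dk z)"
    unfolding dk_def sums_cnj by (rule summable_sums[OF dk_summable])
  then show ?thesis by (simp add: dk_def sums_iff)
qed

text \<open>The operator \<open>h'(z) + b (h(z) - h(-z)) / z\<close> takes \<open>z\<^sup>n\<close> to \<open>dnum n\<close> times \<open>z\<^bsup>n-1\<^esup>\<close>, hence it only shifts
  the series \<open>\<Sum> z\<^sup>n / dfact n\<close>.  The equation is written without the division by \<open>z\<close>.\<close>

lemma dk_ode: "z * deriv dk z = z * dk z - of_real b * (dk z - dk (- z))"
proof -
  let ?c = "\<lambda>n. 1 / of_real (dfact n) :: complex"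
  let ?D = "\<Sum>n. diffs ?c n * z ^ n"
  have D: "deriv dk z = ?D"
    unfolding dk_def by (rule DERIV_imp_deriv, rule powser_euler(1)[OF dk_summable, of _ "cmod z + 1"]) simp
  have 1: "(\<lambda>n. of_nat n * ?c n * z ^ n) sums (z * ?D)"
    by (rule powser_euler(2)[OF dk_summable, of _ "cmod z + 1"]) simp
  have dk: "(\<lambda>n. ?c n * w ^ n) sums dk w" for w
    unfolding dk_def by (rule summable_sums[OF dk_summable])
  have "(\<lambda>n. of_nat n * ?c n * z ^ n + of_real b * (?c n * z ^ n - ?c n * (- z) ^ n))
        sums (z * ?D + of_real b * (dk z - dk (- z)))"
    by (intro sums_add 1 sums_mult sums_diff dk)
  moreover have "of_nat n * ?c n * z ^ n + of_real b * (?c n * z ^ n - ?c n * (- z) ^ n)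
        = of_real (dnum n) * ?c n * z ^ n" for n
    by (cases "even n") (auto simp: dnum_def algebra_simps)
  ultimately have 2: "(\<lambda>n. of_real (dnum n) * ?c n * z ^ n)
        sums (z * ?D + of_real b * (dk z - dk (- z)))" by simp
  have "(\<lambda>n. z * (?c n * z ^ n)) sums (z * dk z)" by (intro sums_mult dk)
  moreover have "z * (?c n * z ^ n) = of_real (dnum (Suc n)) * ?c (Suc n) * z ^ Suc n" for n
    using dnum_pos[of "Suc n"] by (simp add: dfact_Suc)
  ultimately have "(\<lambda>n. of_real (dnum (Suc n)) * ?c (Suc n) * z ^ Suc n) sums (z * dk z)" by simp
  then have "(\<lambda>n. of_real (dnum n) * ?c n * z ^ n) sums (z * dk z)"
    by (subst (asm) sums_Suc_iff) simp
  with 2 have "z * ?D + of_real b * (dk z - dk (- z)) = z * dk z" by (rule sums_unique2)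
  then show ?thesis by (simp add: D algebra_simps)
qed

text \<open>Derivatives of all orders are needed to show that the transform below produces smooth functions.\<close>

definition dkd :: "nat \<Rightarrow> complex \<Rightarrow> complex" where
  "dkd n = (deriv ^^ n) dk"

lemma dkd_0 [simp]: "dkd 0 = dk" by (simp add: dkd_def)

lemma dkd_DERIV: "(dkd n has_field_derivative dkd (Suc n) z) (at z)"
  unfolding dkd_def using holomorphic_higher_deriv[OF dk_holomorphic open_UNIV, of n]
  by (simp add: holomorphic_derivI)

lemma dkd_holomorphic: "dkd n holomorphic_on A"
  unfolding dkd_def using holomorphic_higher_deriv[OF dk_holomorphic open_UNIV, of n] 
  by (rule holomorphic_on_subset) simp

lemma dkd_continuous [continuous_intros]:
  "continuous_on A f \<Longrightarrow> continuous_on A (\<lambda>x. dkd n (f x))"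
  using continuous_on_compose2[OF holomorphic_on_imp_continuous_on[OF dkd_holomorphic[of n UNIV]]] by auto

lemma dk_continuous [continuous_intros]:
  "continuous_on A f \<Longrightarrow> continuous_on A (\<lambda>x. dk (f x))"
  using dkd_continuous[of A f 0] by simp

text \<open>The eigenvalue equation, differentiated \<open>n\<close> times.  It expresses the next derivative by lower ones
  without loss of growth at infinity; in the case \<open>n = 0\<close> the term with \<open>n - 1\<close> has the factor \<open>0\<close>.\<close>

lemma dkd_ode:
  "z * dkd (Suc n) z + of_nat n * dkd n z
   = z * dkd n z + of_nat n * dkd (n - 1) z - of_real b * (dkd n z - (-1) ^ n * dkd n (- z))"
proof (induction n arbitrary: z)
  case 0
  show ?case using dk_ode[of z] by (simp add: dkd_def)
next
  case (Suc n)
  have [derivative_intros]: "(f has_field_derivative f') (at z) \<Longrightarrow>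
     ((\<lambda>x. dkd m (f x)) has_field_derivative dkd (Suc m) (f z) * f') (at z)" for f f' m z
    using DERIV_chain2[OF dkd_DERIV] .
  have L: "((\<lambda>z. z * dkd (Suc n) z + of_nat n * dkd n z) has_field_derivative
          (z * dkd (Suc (Suc n)) z + of_nat (Suc n) * dkd (Suc n) z)) (at z)"
    by (auto intro!: derivative_eq_intros simp: algebra_simps)
  have "((\<lambda>z. z * dkd n z + of_nat n * dkd (n - 1) z - of_real b * (dkd n z - (-1) ^ n * dkd n (- z)))
       has_field_derivative
         (z * dkd (Suc n) z + dkd n z + of_nat n * dkd (Suc (n - 1)) z
          - of_real b * (dkd (Suc n) z - (-1) ^ Suc n * dkd (Suc n) (- z)))) (at z)"
    by (auto intro!: derivative_eq_intros simp: algebra_simps)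
  then have R: "((\<lambda>z. z * dkd (Suc n) z + of_nat n * dkd n z) has_field_derivative
         (z * dkd (Suc n) z + dkd n z + of_nat n * dkd (Suc (n - 1)) z
          - of_real b * (dkd (Suc n) z - (-1) ^ Suc n * dkd (Suc n) (- z)))) (at z)"
    by (simp only: Suc)
  have n: "of_nat n * dkd (Suc (n - 1)) z = of_nat n * dkd n z" by (cases n) auto
  from DERIV_unique[OF L R] n show ?case by (simp add: algebra_simps)
qed

end

lemma linear_growthI:
  fixes f :: "real \<Rightarrow> complex"
  assumes "continuous_on UNIV f" "\<And>s. \<bar>s\<bar> \<ge> 1 \<Longrightarrow> cmod (f s) \<le> C * (1 + \<bar>s\<bar>)"
  shows "\<exists>C\<ge>0. \<forall>s. cmod (f s) \<le> C * (1 + \<bar>s\<bar>)"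
proof -
  have "compact (f ` {-1..1})"
    using assms(1) by (intro compact_continuous_image continuous_on_subset[OF assms(1)]) auto
  then obtain B where B: "\<And>s. s \<in> {-1..1} \<Longrightarrow> cmod (f s) \<le> B"
    by (meson bounded_iff compact_imp_bounded image_eqI)
  have "cmod (f s) \<le> (\<bar>B\<bar> + \<bar>C\<bar>) * (1 + \<bar>s\<bar>)" for s
  proof (cases "\<bar>s\<bar> \<ge> 1")
    case True
    have "cmod (f s) \<le> C * (1 + \<bar>s\<bar>)" using assms(2)[OF True] .
    also have "\<dots> \<le> (\<bar>B\<bar> + \<bar>C\<bar>) * (1 + \<bar>s\<bar>)" by (intro mult_right_mono) auto
    finally show ?thesis .
  next
    case False
    then have "cmod (f s) \<le> B" by (intro B) auto
    also have "\<dots> \<le> (\<bar>B\<bar> + \<bar>C\<bar>) * 1" by simp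
    also have "\<dots> \<le> (\<bar>B\<bar> + \<bar>C\<bar>) * (1 + \<bar>s\<bar>)" by (intro mult_left_mono) auto
    finally show ?thesis .
  qed
  then show ?thesis by (intro exI[of _ "\<bar>B\<bar> + \<bar>C\<bar>"]) auto
qed

context dunkl
begin

text \<open>With \<open>E(is) = p + i q\<close> the eigenvalue equation reads \<open>p' = - q\<close>, \<open>q' = p - 2 b q / s\<close>, so that
  \<open>((p\<^sup>2 + q\<^sup>2) / s\<^sup>2)' = - (2 p\<^sup>2 + (2 + 4 b) q\<^sup>2) / s\<^sup>3\<close>, which is not positive because \<open>b > - 1/2\<close>.\<close>

lemma dk_imag_energy:
  assumes "s \<ge> 1"
  shows "cmod (dk (\<i> * of_real s)) \<le> s * cmod (dk \<i>)"
proof -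
  define e where "e s = dk (\<i> * of_real s)" for s :: real
  define D where "D s = \<i> * deriv dk (\<i> * of_real s)" for s :: real
  define p q where "p s = Re (e s)" and "q s = Im (e s)" for s
  define g where "g s = ((p s)\<^sup>2 + (q s)\<^sup>2) / s\<^sup>2" for s
  have De: "(e has_vector_derivative D s) (at s)" for s
  proof -
    have "((dk \<circ> (\<lambda>s. \<i> * of_real s)) has_vector_derivative (\<i> * 1) * deriv dk (\<i> * of_real s)) (at s)"
      by (rule field_vector_diff_chain_at)
         (auto intro!: derivative_eq_intros simp: dkd_DERIV[of 0, simplified dkd_def, simplified])
    then show ?thesis by (simp add: e_def[abs_def] D_def o_def)
  qed
  have R: "(p has_real_derivative Re (D s)) (at s)" for s
    unfolding p_def[abs_def] has_real_derivative_iff_has_vector_derivative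
    by (rule bounded_linear.has_vector_derivative[OF bounded_linear_Re De])
  have I: "(q has_real_derivative Im (D s)) (at s)" for s
    unfolding q_def[abs_def] has_real_derivative_iff_has_vector_derivative
    by (rule bounded_linear.has_vector_derivative[OF bounded_linear_Im De])
  have ode: "Re (D s) = - q s" "Im (D s) = p s - 2 * b * q s / s" if "s > 0" for s
  proof -
    have "dk (- (\<i> * of_real s)) = cnj (e s)" unfolding e_def by (subst dk_cnj[symmetric]) simp
    then have "of_real s * D s = \<i> * of_real s * e s - of_real b * (e s - cnj (e s))"
      using dk_ode[of "\<i> * of_real s"] by (simp add: D_def e_def mult_ac)
    then have 1: "Re (of_real s * D s) = Re (\<i> * of_real s * e s - of_real b * (e s - cnj (e s)))"
      and 2: "Im (of_real s * D s) = Im (\<i> * of_real s * e s - of_real b * (e s - cnj (e s)))"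
      by simp_all
    have "s * Re (D s) = s * (- q s)" using 1 by (simp add: q_def)
    then show "Re (D s) = - q s" using that by (subst (asm) mult_cancel_left) auto
    have "s * Im (D s) = s * p s - 2 * b * q s" using 2 by (simp add: p_def q_def algebra_simps)
    then show "Im (D s) = p s - 2 * b * q s / s" using that by (simp add: field_simps)
  qed
  have "g s \<le> g 1"
  proof (rule DERIV_nonpos_imp_nonincreasing[OF assms])
    fix r :: real assume r: "1 \<le> r" "r \<le> s"
    let ?d = "((2 * p r * Re (D r) + 2 * q r * Im (D r)) * r\<^sup>2
              - ((p r)\<^sup>2 + (q r)\<^sup>2) * (2 * r)) / (r\<^sup>2 * r\<^sup>2)"
    have "(g has_real_derivative ?d) (at r)"
      unfolding g_def[abs_def] using r
      by (auto intro!: derivative_eq_intros R I)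
    moreover have "(2 * p r * Re (D r) + 2 * q r * Im (D r)) * r\<^sup>2
              - ((p r)\<^sup>2 + (q r)\<^sup>2) * (2 * r)
            = - (2 * r * (p r)\<^sup>2 + (2 + 4 * b) * r * (q r)\<^sup>2)"
      using r by (simp add: ode field_simps power2_eq_square)
    moreover have "2 * r * (p r)\<^sup>2 + (2 + 4 * b) * r * (q r)\<^sup>2 \<ge> 0"
    proof -
      have "2 + 4 * b \<ge> 0" using b_gt by simp
      then have "(2 + 4 * b) * r * (q r)\<^sup>2 \<ge> 0" using r by (intro mult_nonneg_nonneg) auto
      moreover have "2 * r * (p r)\<^sup>2 \<ge> 0" using r by simp
      ultimately show ?thesis by linarith
    qed
    ultimately show "\<exists>y. (g has_real_derivative y) (at r) \<and> y \<le> 0"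
      by (intro exI[of _ ?d]) (auto intro!: divide_nonpos_nonneg)
  qed
  then have "(cmod (e s))\<^sup>2 / s\<^sup>2 \<le> (cmod (e 1))\<^sup>2" by (simp add: g_def p_def q_def cmod_power2)
  then have "(cmod (e s))\<^sup>2 \<le> (s * cmod (e 1))\<^sup>2" using assms
    by (simp add: divide_le_eq power_mult_distrib mult.commute)
  then have "cmod (e s) \<le> s * cmod (e 1)"
    by (rule power2_le_imp_le) (use assms in auto)
  then show ?thesis by (simp add: e_def)
qed

text \<open>The kernel grows at most linearly on the imaginary axis by the energy estimate, and \<open>dkd_ode\<close>
  passes this on to all its derivatives.\<close>

lemma dkd_bound: "\<exists>C\<ge>0. \<forall>s. cmod (dkd n (\<i> * of_real s)) \<le> C * (1 + \<bar>s\<bar>)"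
proof (induction n rule: less_induct)
  case (less m)
  show ?case
  proof (cases m)
    case 0
    have "cmod (dk (\<i> * of_real s)) \<le> cmod (dk \<i>) * (1 + \<bar>s\<bar>)" if "\<bar>s\<bar> \<ge> 1" for s
    proof -
      have "cmod (dk (\<i> * of_real s)) = cmod (dk (\<i> * of_real \<bar>s\<bar>))"
      proof (cases "s \<ge> 0")
        case False
        have "dk (\<i> * of_real s) = dk (cnj (\<i> * of_real \<bar>s\<bar>))" using False by simp
        then show ?thesis by (simp only: dk_cnj complex_mod_cnj)
      qed simp
      also have "\<dots> \<le> \<bar>s\<bar> * cmod (dk \<i>)" by (rule dk_imag_energy[OF that])
      also have "\<dots> \<le> cmod (dk \<i>) * (1 + \<bar>s\<bar>)" by (simp add: algebra_simps)
      finally show ?thesis .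
    qed
    then show ?thesis unfolding 0 dkd_0
      by (intro linear_growthI continuous_intros) auto
  next
    case (Suc n)
    obtain C1 where C1: "C1 \<ge> 0" "\<And>s. cmod (dkd n (\<i> * of_real s)) \<le> C1 * (1 + \<bar>s\<bar>)"
      using less[of n] Suc by auto
    obtain C2 where C2: "C2 \<ge> 0" "\<And>s. cmod (dkd (n - 1) (\<i> * of_real s)) \<le> C2 * (1 + \<bar>s\<bar>)"
      using less[of "n - 1"] Suc by (metis diff_le_self le_imp_less_Suc)
    let ?K = "C1 + real n * C2 + real n * C1 + \<bar>b\<bar> * (C1 + C1)"
    have "cmod (dkd m (\<i> * of_real s)) \<le> ?K * (1 + \<bar>s\<bar>)" if s: "\<bar>s\<bar> \<ge> 1" for s
    proof -
      let ?z = "\<i> * of_real s"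
      have "\<bar>s\<bar> * cmod (dkd m ?z) = cmod (?z * dkd (Suc n) ?z)"
        by (simp add: norm_mult Suc)
      also have "?z * dkd (Suc n) ?z = ?z * dkd n ?z + of_nat n * dkd (n - 1) ?z - of_nat n * dkd n ?z
           - of_real b * (dkd n ?z - (-1) ^ n * dkd n (- ?z))"
        using dkd_ode[of ?z n] by (simp add: algebra_simps)
      also have "cmod \<dots> \<le> cmod (?z * dkd n ?z) + cmod (of_nat n * dkd (n - 1) ?z) + cmod (of_nat n * dkd n ?z)
           + cmod (of_real b * (dkd n ?z - (-1) ^ n * dkd n (- ?z)))"
        by (meson add_mono norm_triangle_ineq norm_triangle_ineq4 order_refl order_trans)
      also have "\<dots> \<le> \<bar>s\<bar> * (C1 * (1 + \<bar>s\<bar>)) + real n * (C2 * (1 + \<bar>s\<bar>)) + real n * (C1 * (1 + \<bar>s\<bar>))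
           + \<bar>b\<bar> * (C1 * (1 + \<bar>s\<bar>) + C1 * (1 + \<bar>s\<bar>))"
      proof -
        have "cmod (dkd n ?z - (-1) ^ n * dkd n (- ?z)) \<le> cmod (dkd n ?z) + cmod ((-1) ^ n * dkd n (- ?z))"
          by (rule norm_triangle_ineq4)
        also have "\<dots> \<le> C1 * (1 + \<bar>s\<bar>) + C1 * (1 + \<bar>s\<bar>)"
          using C1(2)[of s] C1(2)[of "-s"] by (simp add: norm_mult norm_power)
        finally have 1: "cmod (dkd n ?z - (-1) ^ n * dkd n (- ?z)) \<le> \<dots>" .
        show ?thesis unfolding norm_mult
          by (intro add_mono mult_mono C1 C2) (use 1 in \<open>auto intro!: mult_left_mono\<close>)
      qed
      also have "\<dots> \<le> \<bar>s\<bar> * (C1 * (1 + \<bar>s\<bar>)) + \<bar>s\<bar> * (real n * (C2 * (1 + \<bar>s\<bar>))) + \<bar>s\<bar> * (real n * (C1 * (1 + \<bar>s\<bar>)))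
           + \<bar>s\<bar> * (\<bar>b\<bar> * (C1 * (1 + \<bar>s\<bar>) + C1 * (1 + \<bar>s\<bar>)))"
      proof -
        have *: "x \<le> \<bar>s\<bar> * x" if "x \<ge> 0" for x using mult_right_mono[OF s that] by simp
        show ?thesis using C1(1) C2(1) by (intro add_mono order_refl *) auto
      qed
      also have "\<dots> = \<bar>s\<bar> * (?K * (1 + \<bar>s\<bar>))" by (simp add: algebra_simps)
      finally show ?thesis using s by (subst (asm) mult_le_cancel_left_pos) auto
    qed
    then show ?thesis
      by (intro linear_growthI continuous_intros) auto
  qed
qed

end

section \<open>Rapidly decreasing functions and Schwartz functions\<close>

definition rapid :: "(real \<Rightarrow> complex) \<Rightarrow> bool" where
  "rapid f \<longleftrightarrow> (\<forall>k. \<exists>C. \<forall>x. \<bar>x\<bar> ^ k * cmod (f x) \<le> C)"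

lemma rapid_iff_bounded: "rapid f \<longleftrightarrow> (\<forall>k. bounded (range (\<lambda>x. x ^ k *\<^sub>R f x)))"
  unfolding rapid_def bounded_iff by (simp add: power_abs)

lemma power_mult_exp_le:
  fixes r :: real
  assumes "r \<ge> 0" shows "r ^ k * exp (- r) \<le> fact k"
proof -
  have "(\<Sum>n\<in>{k}. r ^ n /\<^sub>R fact n) \<le> (\<Sum>n. r ^ n /\<^sub>R fact n)"
    using assms by (intro sum_le_suminf[OF summable_exp_generic]) auto
  also have "\<dots> = exp r" by (simp only: exp_def)
  finally have "r ^ k \<le> fact k * exp r" by (simp add: field_simps)
  then have "r ^ k * exp (- r) \<le> fact k * exp r * exp (- r)" by (intro mult_right_mono) auto
  then show ?thesis by (simp add: mult.assoc flip: exp_add)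
qed

lemma rapid_growth:
  assumes f: "rapid f" and g: "\<And>x. cmod (g x) \<le> K * (1 + \<bar>x\<bar>) ^ N * cmod (f x)"
  shows "rapid g"
  unfolding rapid_def
proof
  fix k
  obtain C1 where C1: "\<And>x. \<bar>x\<bar> ^ k * cmod (f x) \<le> C1" using f unfolding rapid_def by meson
  obtain C2 where C2: "\<And>x. \<bar>x\<bar> ^ (k + N) * cmod (f x) \<le> C2" using f unfolding rapid_def by meson
  have "\<bar>x\<bar> ^ k * cmod (g x) \<le> \<bar>K\<bar> * 2 ^ N * (C1 + C2)" for x
  proof -
    have "(1 + \<bar>x\<bar>) ^ N \<le> (2 * max 1 \<bar>x\<bar>) ^ N" by (intro power_mono) auto
    also have "\<dots> = 2 ^ N * (max 1 \<bar>x\<bar>) ^ N" by (simp add: power_mult_distrib)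
    also have "\<dots> \<le> 2 ^ N * (1 + \<bar>x\<bar> ^ N)" by (intro mult_left_mono) (auto simp: max_def)
    finally have *: "(1 + \<bar>x\<bar>) ^ N \<le> 2 ^ N * (1 + \<bar>x\<bar> ^ N)" .
    have "cmod (g x) \<le> K * (1 + \<bar>x\<bar>) ^ N * cmod (f x)" by (rule g)
    also have "\<dots> \<le> \<bar>K\<bar> * (2 ^ N * (1 + \<bar>x\<bar> ^ N)) * cmod (f x)"
      by (intro mult_right_mono mult_mono *) auto
    finally have "\<bar>x\<bar> ^ k * cmod (g x) \<le> \<bar>x\<bar> ^ k * (\<bar>K\<bar> * (2 ^ N * (1 + \<bar>x\<bar> ^ N)) * cmod (f x))"
      by (intro mult_left_mono) auto
    also have "\<dots> = \<bar>K\<bar> * 2 ^ N * (\<bar>x\<bar> ^ k * cmod (f x) + \<bar>x\<bar> ^ (k + N) * cmod (f x))"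
      by (simp add: algebra_simps power_add)
    also have "\<dots> \<le> \<bar>K\<bar> * 2 ^ N * (C1 + C2)" by (intro mult_left_mono add_mono C1 C2) auto
    finally show ?thesis .
  qed
  then show "\<exists>C. \<forall>x. \<bar>x\<bar> ^ k * cmod (g x) \<le> C" by blast
qed

lemma rapid_add: "rapid f \<Longrightarrow> rapid g \<Longrightarrow> rapid (\<lambda>x. f x + g x)"
  unfolding rapid_def
proof
  fix k
  assume "\<forall>k. \<exists>C. \<forall>x. \<bar>x\<bar> ^ k * cmod (f x) \<le> C" "\<forall>k. \<exists>C. \<forall>x. \<bar>x\<bar> ^ k * cmod (g x) \<le> C"
  then obtain C1 C2 where "\<And>x. \<bar>x\<bar> ^ k * cmod (f x) \<le> C1" "\<And>x. \<bar>x\<bar> ^ k * cmod (g x) \<le> C2" by meson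
  moreover have "\<bar>x\<bar> ^ k * cmod (f x + g x) \<le> \<bar>x\<bar> ^ k * cmod (f x) + \<bar>x\<bar> ^ k * cmod (g x)" for x
    using mult_left_mono[OF norm_triangle_ineq[of "f x" "g x"], of "\<bar>x\<bar> ^ k"] by (simp add: distrib_left)
  ultimately have "\<forall>x. \<bar>x\<bar> ^ k * cmod (f x + g x) \<le> C1 + C2" by (meson add_mono order_trans)
  then show "\<exists>C. \<forall>x. \<bar>x\<bar> ^ k * cmod (f x + g x) \<le> C" by blast
qed

lemma rapid_cmult: "rapid f \<Longrightarrow> rapid (\<lambda>x. c * f x)"
  by (rule rapid_growth[of f _ "cmod c" 0]) (auto simp: norm_mult)

lemma rapid_diff: "rapid f \<Longrightarrow> rapid g \<Longrightarrow> rapid (\<lambda>x. f x - g x)"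
  using rapid_add[of f "\<lambda>x. (-1) * g x"] rapid_cmult[of g "-1"] by simp

lemma rapid_times_x: "rapid f \<Longrightarrow> rapid (\<lambda>x. of_real x * f x)"
  by (rule rapid_growth[of f _ 1 1]) (auto simp: norm_mult intro!: mult_right_mono)

lemma rapid_reflect: "rapid f \<Longrightarrow> rapid (\<lambda>x. f (- x))"
  unfolding rapid_def by (metis abs_minus_cancel)

text \<open>Away from \<open>a\<close> the factor \<open>x - a\<close> only helps; near \<open>a\<close> it suffices that \<open>f\<close> is bounded.\<close>

lemma rapid_divide:
  assumes f: "rapid (\<lambda>x. of_real (x - a) * f x)" and c: "continuous_on UNIV f"
  shows "rapid f"
  unfolding rapid_def
proof
  fix k
  obtain C where C: "\<And>x. \<bar>x\<bar> ^ k * cmod (of_real (x - a) * f x) \<le> C" using f unfolding rapid_def by meson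
  let ?I = "{- (1 + \<bar>a\<bar>)..1 + \<bar>a\<bar>}"
  have "compact ((\<lambda>x. \<bar>x\<bar> ^ k * cmod (f x)) ` ?I)"
    by (intro compact_continuous_image continuous_intros continuous_on_subset[OF c]) auto
  then have "bounded ((\<lambda>x. \<bar>x\<bar> ^ k * cmod (f x)) ` ?I)" by (rule compact_imp_bounded)
  then obtain B where B: "\<forall>x\<in>?I. \<bar>\<bar>x\<bar> ^ k * cmod (f x)\<bar> \<le> B"
    unfolding bounded_iff real_norm_def by blast
  have "\<bar>x\<bar> ^ k * cmod (f x) \<le> max B C" for x
  proof (cases "x \<in> ?I")
    case True
    then show ?thesis using bspec[OF B True] by (simp add: max_def)
  next
    case False
    then have "\<bar>x - a\<bar> \<ge> 1" by (auto simp: abs_if split: if_splits)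
    then have "\<bar>x\<bar> ^ k * (1 * cmod (f x)) \<le> \<bar>x\<bar> ^ k * (\<bar>x - a\<bar> * cmod (f x))"
      by (intro mult_left_mono mult_right_mono) auto
    also have "\<dots> \<le> C" using C[of x] by (simp add: norm_mult flip: of_real_diff)
    finally show ?thesis by simp
  qed
  then show "\<exists>C. \<forall>x. \<bar>x\<bar> ^ k * cmod (f x) \<le> C" by blast
qed

text \<open>A set of rapidly decreasing functions that is closed under differentiation consists of Schwartz
  functions, as the derivatives of any order can be chosen inside the set.  This replaces Leibniz
  formulas in all closure properties.\<close>

lemma schwartz_coinduct:
  assumes g: "g \<in> P"
    and P: "\<And>h. h \<in> P \<Longrightarrow> rapid h"
    and D: "\<And>h. h \<in> P \<Longrightarrow> \<exists>h'\<in>P. \<forall>x. (h has_vector_derivative h' x) (at x)"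
  shows "g \<in> schwartz"
proof -
  obtain d where d: "\<And>h. h \<in> P \<Longrightarrow> d h \<in> P" "\<And>h x. h \<in> P \<Longrightarrow> (h has_vector_derivative d h x) (at x)"
    using D by metis
  define G where "G n = (d ^^ n) g" for n
  have G: "G n \<in> P" for n by (induction n) (auto simp: G_def g d)
  have "G (Suc n) = d (G n)" for n by (simp add: G_def)
  then have "G 0 = g \<and> (\<forall>n x. (G n has_vector_derivative G (Suc n) x) (at x)) \<and>
     (\<forall>k n. bounded (range (\<lambda>x. x ^ k *\<^sub>R G n x)))"
    using G d(2) P by (auto simp: G_def rapid_iff_bounded)
  then show ?thesis unfolding schwartz_def by blast
qed

definition vd :: "(real \<Rightarrow> complex) \<Rightarrow> real \<Rightarrow> complex" where
  "vd g x = vector_derivative g (at x)"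

lemma vdI: "(\<And>x. (g has_vector_derivative g' x) (at x)) \<Longrightarrow> vd g = g'"
  unfolding vd_def by (auto simp: vector_derivative_at)

lemma
  assumes "g \<in> schwartz"
  shows schwartz_rapid: "rapid g"
    and schwartz_deriv: "(g has_vector_derivative vd g x) (at x)"
    and schwartz_vd: "vd g \<in> schwartz"
proof -
  obtain G where G: "G 0 = g" "\<And>n x. (G n has_vector_derivative G (Suc n) x) (at x)"
     "\<And>k n. bounded (range (\<lambda>x. x ^ k *\<^sub>R G n x))"
    using assms unfolding schwartz_def by blast
  show "rapid g" using G(3)[of _ 0] by (simp add: rapid_iff_bounded G(1))
  have *: "(g has_vector_derivative G 1 x) (at x)" for x using G(2)[of 0] G(1) by simp
  then have "vd g = G 1" by (rule vdI)
  with * show "(g has_vector_derivative vd g x) (at x)" by simp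
  have "G 1 \<in> schwartz" unfolding schwartz_def
    by (rule CollectI, rule exI[of _ "\<lambda>n. G (Suc n)"]) (use G in auto)
  with \<open>vd g = G 1\<close> show "vd g \<in> schwartz" by simp
qed

lemma schwartz_continuous:
  assumes "g \<in> schwartz" shows "continuous_on A g"
  using schwartz_deriv[OF assms] by (meson continuous_at_imp_continuous_on has_vector_derivative_continuous)

lemma schwartz_measurable: "g \<in> schwartz \<Longrightarrow> g \<in> borel_measurable borel"
  by (intro borel_measurable_continuous_onI schwartz_continuous)

lemma schwartz_add:
  assumes "g \<in> schwartz" "h \<in> schwartz" shows "(\<lambda>x. g x + h x) \<in> schwartz"
proof (rule schwartz_coinduct[where P = "{\<lambda>x. g x + h x | g h. g \<in> schwartz \<and> h \<in> schwartz}"])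
  fix f assume "f \<in> {\<lambda>x. g x + h x | g h. g \<in> schwartz \<and> h \<in> schwartz}"
  then obtain g h where f: "f = (\<lambda>x. g x + h x)" "g \<in> schwartz" "h \<in> schwartz" by blast
  then show "rapid f" by (simp add: rapid_add schwartz_rapid)
  show "\<exists>h'\<in>{\<lambda>x. g x + h x | g h. g \<in> schwartz \<and> h \<in> schwartz}. \<forall>x. (f has_vector_derivative h' x) (at x)"
    using f by (intro bexI[of _ "\<lambda>x. vd g x + vd h x"])
      (auto intro!: derivative_intros schwartz_deriv schwartz_vd)
qed (use assms in blast)

text \<open>The derivative of \<open>m g\<close> is \<open>m (k g + g')\<close>, again a product of \<open>m\<close> with a Schwartz function.  The
  factors of interest are constants and \<open>e\<^bsup>itx\<^esup>\<close>.\<close>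

lemma schwartz_mult_unimodular:
  assumes g: "g \<in> schwartz" and m: "\<And>x. (m has_vector_derivative k * m x) (at x)" "\<And>x. cmod (m x) \<le> K"
  shows "(\<lambda>x. m x * g x) \<in> schwartz"
proof (rule schwartz_coinduct[where P = "{\<lambda>x. m x * g x | g. g \<in> schwartz}"])
  fix f assume "f \<in> {\<lambda>x. m x * g x | g. g \<in> schwartz}"
  then obtain g where f: "f = (\<lambda>x. m x * g x)" "g \<in> schwartz" by blast
  show "rapid f" unfolding f
    by (rule rapid_growth[OF schwartz_rapid[OF f(2)], of _ K 0])
       (auto simp: norm_mult intro!: mult_right_mono m)
  show "\<exists>h'\<in>{\<lambda>x. m x * g x | g. g \<in> schwartz}. \<forall>x. (f has_vector_derivative h' x) (at x)"
  proof (intro bexI allI)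
    fix x
    have "((\<lambda>x. m x * g x) has_vector_derivative (m x * vd g x + k * m x * g x)) (at x)"
      by (intro has_vector_derivative_mult m schwartz_deriv f)
    then show "(f has_vector_derivative m x * (k * g x + vd g x)) (at x)"
      unfolding f by (simp add: algebra_simps)
    have "(\<lambda>x. k * g x) \<in> schwartz"
    proof (rule schwartz_coinduct[where P = "{\<lambda>x. k * g x | g. g \<in> schwartz}"])
      fix f assume "f \<in> {\<lambda>x. k * g x | g. g \<in> schwartz}"
      then obtain g where f: "f = (\<lambda>x. k * g x)" "g \<in> schwartz" by blast
      then show "rapid f" by (simp add: rapid_cmult schwartz_rapid)
      show "\<exists>h'\<in>{\<lambda>x. k * g x | g. g \<in> schwartz}. \<forall>x. (f has_vector_derivative h' x) (at x)"
        using f by (intro bexI[of _ "\<lambda>x. k * vd g x"])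
          (auto intro!: has_vector_derivative_mult_right schwartz_deriv schwartz_vd)
    qed (use f in blast)
    then have "(\<lambda>x. k * g x + vd g x) \<in> schwartz" by (intro schwartz_add schwartz_vd f)
    then show "(\<lambda>x. m x * (k * g x + vd g x)) \<in> {\<lambda>x. m x * g x | g. g \<in> schwartz}"
      by (intro CollectI exI[of _ "\<lambda>x. k * g x + vd g x"]) simp
  qed
qed (use g in blast)

lemma schwartz_cmult: "g \<in> schwartz \<Longrightarrow> (\<lambda>x. c * g x) \<in> schwartz"
  using schwartz_mult_unimodular[of g "\<lambda>_. c" 0 "cmod c"] by simp

lemma schwartz_diff: "g \<in> schwartz \<Longrightarrow> h \<in> schwartz \<Longrightarrow> (\<lambda>x. g x - h x) \<in> schwartz"
  using schwartz_add[of g "\<lambda>x. (-1) * h x"] schwartz_cmult[of h "-1"] by simp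

lemma schwartz_exp:
  assumes "g \<in> schwartz" shows "(\<lambda>x. exp (\<i> * of_real (t * x)) * g x) \<in> schwartz"
proof (rule schwartz_mult_unimodular[OF assms])
  fix x
  show "((\<lambda>x. exp (\<i> * of_real (t * x))) has_vector_derivative (\<i> * of_real t) * exp (\<i> * of_real (t * x))) (at x)"
  proof -
    have "((\<lambda>x. \<i> * of_real (t * x)) has_vector_derivative \<i> * of_real t) (at x)"
      by (auto intro!: derivative_eq_intros has_vector_derivative_mult_right
          bounded_linear.has_vector_derivative[OF bounded_linear_of_real])
    from field_vector_diff_chain_at[OF this DERIV_exp] show ?thesis by (simp add: o_def)
  qed
  show "cmod (exp (\<i> * of_real (t * x))) \<le> 1" by simp
qed

lemma schwartz_times_x:
  assumes "g \<in> schwartz" shows "(\<lambda>x. of_real x * g x) \<in> schwartz"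
proof (rule schwartz_coinduct[where P = "{\<lambda>x. of_real x * g x + h x | g h. g \<in> schwartz \<and> h \<in> schwartz}"])
  fix f assume "f \<in> {\<lambda>x. of_real x * g x + h x | g h. g \<in> schwartz \<and> h \<in> schwartz}"
  then obtain g h where f: "f = (\<lambda>x. of_real x * g x + h x)" "g \<in> schwartz" "h \<in> schwartz" by blast
  then show "rapid f" by (simp add: rapid_add rapid_times_x schwartz_rapid)
  have "(f has_vector_derivative of_real x * vd g x + (g x + vd h x)) (at x)" for x
  proof -
    have "((\<lambda>x. of_real x :: complex) has_vector_derivative 1) (at x)"
      using bounded_linear.has_vector_derivative[OF bounded_linear_of_real has_vector_derivative_id] by simp
    from has_vector_derivative_add[OF has_vector_derivative_mult[OF this schwartz_deriv[OF f(2)]] schwartz_deriv[OF f(3)]]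
    show ?thesis unfolding f(1) by (simp add: add.assoc)
  qed
  moreover have "(\<lambda>x. g x + vd h x) \<in> schwartz" by (intro schwartz_add schwartz_vd f)
  ultimately show "\<exists>h'\<in>{\<lambda>x. of_real x * g x + h x | g h. g \<in> schwartz \<and> h \<in> schwartz}.
      \<forall>x. (f has_vector_derivative h' x) (at x)"
    using f schwartz_vd[OF f(2)]
    by (intro bexI[of _ "\<lambda>x. of_real x * vd g x + (g x + vd h x)"]) auto
next
  have "(\<lambda>x. 0 * g x) \<in> schwartz" by (rule schwartz_cmult[OF assms])
  then show "(\<lambda>x. of_real x * g x) \<in> {\<lambda>x. of_real x * g x + h x | g h. g \<in> schwartz \<and> h \<in> schwartz}"
    using assms by (intro CollectI exI[of _ g] exI[of _ "\<lambda>x. 0 * g x"]) auto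
qed

lemma schwartz_reflect:
  assumes "g \<in> schwartz" shows "(\<lambda>x. g (- x)) \<in> schwartz"
proof (rule schwartz_coinduct[where P = "{\<lambda>x. g (- x) | g. g \<in> schwartz}"])
  fix f assume "f \<in> {\<lambda>x. g (- x) | g. g \<in> schwartz}"
  then obtain g where f: "f = (\<lambda>x. g (- x))" "g \<in> schwartz" by blast
  then show "rapid f" by (simp add: rapid_reflect schwartz_rapid)
  have "(f has_vector_derivative (-1) *\<^sub>R vd g (- x)) (at x)" for x
    unfolding f(1) using vector_diff_chain_at[of uminus "-1" x g "vd g (- x)"] schwartz_deriv[OF f(2)]
    by (simp add: o_def has_vector_derivative_minus has_vector_derivative_id)
  moreover have "(\<lambda>x. - vd g x) \<in> schwartz" using schwartz_cmult[OF schwartz_vd[OF f(2)], of "-1"] by simp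
  ultimately show "\<exists>h'\<in>{\<lambda>x. g (- x) | g. g \<in> schwartz}. \<forall>x. (f has_vector_derivative h' x) (at x)"
    by (intro bexI[of _ "\<lambda>x. - vd g (- x)"]) auto
qed (use assms in blast)

text \<open>Hadamard's lemma: a zero of a Schwartz function can be divided out.  The quotient and all its
  derivatives are integrals \<open>\<integral>\<^sub>0\<^sup>1 u\<^sup>n g(a + u (x - a)) du\<close> with \<open>g\<close> a Schwartz function; that
  they decrease rapidly follows one derivative after the other by an integration by parts.\<close>

lemma schwartz_divide:
  assumes g: "g \<in> schwartz" and ga: "g a = 0"
  obtains h where "h \<in> schwartz" "\<And>x. g x = of_real (x - a) * h x"
proof -
  define I where "I n g x = integral {0..1} (\<lambda>u. of_real (u ^ n) * g (a + u * (x - a)))"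
    for n :: nat and g :: "real \<Rightarrow> complex" and x :: real
  have line: "((\<lambda>u. g (a + u * y)) has_vector_derivative of_real y * vd g (a + u * y)) (at u within A)"
    if "g \<in> schwartz" for g y u A
  proof -
    have "((\<lambda>u. a + u * y) has_vector_derivative y) (at u within A)"
      by (auto intro!: derivative_eq_intros)
    from vector_diff_chain_within[OF this has_vector_derivative_at_within[OF schwartz_deriv[OF that]]]
    show ?thesis by (simp add: o_def scaleR_conv_of_real)
  qed
  have cont: "continuous_on B (\<lambda>w. g (a + snd w * (fst w - a)))" if "g \<in> schwartz" for g :: "real \<Rightarrow> complex" and B
    by (rule continuous_on_compose2[OF schwartz_continuous[OF that, of UNIV]]) (auto intro!: continuous_intros)
  have cont1: "continuous_on B (\<lambda>u. g (a + u * (x - a)))" if "g \<in> schwartz" for g :: "real \<Rightarrow> complex" and B x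
    by (rule continuous_on_compose2[OF schwartz_continuous[OF that, of UNIV]]) (auto intro!: continuous_intros)
  have ID: "(I n g has_vector_derivative I (Suc n) (vd g) x) (at x)" if "g \<in> schwartz" for n g x
  proof -
    have *: "((\<lambda>x. of_real (u ^ n) * g (a + u * (x - a))) has_vector_derivative
           of_real (u ^ Suc n) * vd g (a + u * (x - a))) (at x)" for x u :: real
    proof -
      have "((\<lambda>x. a + u * (x - a)) has_vector_derivative u) (at x)"
        by (auto intro!: derivative_eq_intros)
      from vector_diff_chain_at[OF this schwartz_deriv[OF that]]
      have "((\<lambda>x. g (a + u * (x - a))) has_vector_derivative of_real u * vd g (a + u * (x - a))) (at x)"
        by (simp add: o_def scaleR_conv_of_real)
      from has_vector_derivative_mult_right[OF this, of "of_real (u ^ n)"]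
      show ?thesis by (simp add: mult_ac)
    qed
    have "((\<lambda>x. integral (cbox 0 1) (\<lambda>u. of_real (u ^ n) * g (a + u * (x - a)))) has_vector_derivative
        integral (cbox 0 1) (\<lambda>u. of_real (u ^ Suc n) * vd g (a + u * (x - a)))) (at x within UNIV)"
    proof (rule leibniz_rule_vector_derivative)
      fix x u :: real
      show "((\<lambda>x. of_real (u ^ n) * g (a + u * (x - a))) has_vector_derivative
           of_real (u ^ Suc n) * vd g (a + u * (x - a))) (at x within UNIV)" using * by simp
      show "(\<lambda>u. of_real (u ^ n) * g (a + u * (x - a))) integrable_on cbox 0 1"
        by (intro integrable_continuous continuous_intros cont1 that)
    next
      show "continuous_on (UNIV \<times> cbox 0 1) (\<lambda>(x, u). of_real (u ^ Suc n) * vd g (a + u * (x - a)))"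
        unfolding case_prod_beta by (intro continuous_intros cont schwartz_vd that)
    qed auto
    then show ?thesis by (simp add: I_def[abs_def])
  qed
  have parts: "of_real (x - a) * I (Suc n) (vd g) x + of_nat (Suc n) * I n g x = g x" if "g \<in> schwartz" for n g x
  proof -
    have "((\<lambda>u. of_real (u ^ Suc n) * (of_real (x - a) * vd g (a + u * (x - a)))
              + of_real (of_nat (Suc n) * u ^ n) * g (a + u * (x - a))) has_integral
           (of_real (1 ^ Suc n) * g (a + 1 * (x - a)) - of_real (0 ^ Suc n) * g (a + 0 * (x - a)))) {0..1}"
    proof (rule fundamental_theorem_of_calculus)
      fix u :: real
      have "((\<lambda>u. of_real (u ^ Suc n) :: complex) has_vector_derivative of_real (of_nat (Suc n) * u ^ n)) (at u within {0..1})"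
        by (rule bounded_linear.has_vector_derivative[OF bounded_linear_of_real])
           (use DERIV_pow[of "Suc n" u "{0..1}"] in \<open>simp flip: has_real_derivative_iff_has_vector_derivative\<close>)
      from has_vector_derivative_mult[OF this line[OF that]]
      show "((\<lambda>u. of_real (u ^ Suc n) * g (a + u * (x - a))) has_vector_derivative
           of_real (u ^ Suc n) * (of_real (x - a) * vd g (a + u * (x - a)))
              + of_real (of_nat (Suc n) * u ^ n) * g (a + u * (x - a))) (at u within {0..1})" .
    qed auto
    moreover have "((\<lambda>u. of_real (x - a) * (of_real (u ^ Suc n) * vd g (a + u * (x - a)))
              + of_nat (Suc n) * (of_real (u ^ n) * g (a + u * (x - a)))) has_integral
           (of_real (x - a) * I (Suc n) (vd g) x + of_nat (Suc n) * I n g x)) {0..1}"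
      unfolding I_def
      by (intro has_integral_add has_integral_mult_right integrable_integral integrable_continuous_interval
           continuous_intros cont1 that schwartz_vd)
    ultimately show ?thesis
      by (simp add: mult_ac has_integral_iff)
  qed
  define h where "h = I 0 (vd g)"
  have gh: "of_real (x - a) * h x = g x" for x
  proof -
    have "((\<lambda>u. of_real (x - a) * vd g (a + u * (x - a))) has_integral (g (a + 1 * (x - a)) - g (a + 0 * (x - a)))) {0..1}"
      by (rule fundamental_theorem_of_calculus) (simp, rule line[OF g])
    moreover have "((\<lambda>u. of_real (x - a) * vd g (a + u * (x - a))) has_integral (of_real (x - a) * h x)) {0..1}"
      unfolding h_def I_def
      by (intro has_integral_mult_right) (auto intro!: integrable_integral integrable_continuous_interval cont1 schwartz_vd g)
    ultimately show ?thesis using ga by (simp add: has_integral_iff)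
  qed
  let ?P = "{h. rapid h \<and> (\<exists>n. \<exists>g\<in>schwartz. h = I n g)}"
  have IC: "continuous_on UNIV (I n g)" if "g \<in> schwartz" for n g
    using ID[OF that] by (meson continuous_at_imp_continuous_on has_vector_derivative_continuous)
  have "h \<in> schwartz"
  proof (rule schwartz_coinduct[where P = ?P])
    have "rapid h"
      by (rule rapid_divide[of a]) (use gh schwartz_rapid[OF g] IC[OF schwartz_vd[OF g]] in \<open>simp_all add: h_def\<close>)
    then show "h \<in> ?P" using schwartz_vd[OF g] by (auto simp: h_def)
  next
    fix f assume "f \<in> ?P"
    then obtain n g where f: "rapid f" "f = I n g" "g \<in> schwartz" by blast
    show "rapid f" by fact
    have "rapid (I (Suc n) (vd g))"
    proof (rule rapid_divide[of a])
      have "of_real (x - a) * I (Suc n) (vd g) x = g x - of_nat (Suc n) * f x" for x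
        using parts[OF f(3), of x n] f(2) by (simp add: algebra_simps)
      moreover have "rapid (\<lambda>x. g x - of_nat (Suc n) * f x)"
        by (intro rapid_diff rapid_cmult schwartz_rapid f)
      ultimately show "rapid (\<lambda>x. of_real (x - a) * I (Suc n) (vd g) x)" by simp
      show "continuous_on UNIV (I (Suc n) (vd g))" by (intro IC schwartz_vd f)
    qed
    then have "I (Suc n) (vd g) \<in> ?P" using schwartz_vd[OF f(3)] by blast
    then show "\<exists>h'\<in>?P. \<forall>x. (f has_vector_derivative h' x) (at x)"
      using ID[OF f(3), of n] unfolding f(2) by blast
  qed
  then show ?thesis using gh that by metis
qed

section \<open>Integrals on the half-line and integrals with a parameter\<close>

lemma halfline_integral_zero:
  fixes F f :: "real \<Rightarrow> complex"
  assumes "\<And>y. y > 0 \<Longrightarrow> (F has_vector_derivative f y) (at y)"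
    and "\<And>y. y > 0 \<Longrightarrow> isCont f y"
    and "set_integrable lborel {0<..} f"
    and "(F \<longlongrightarrow> 0) (at_right 0)" and "(F \<longlongrightarrow> 0) at_top"
  shows "(\<integral>y. indicator {0<..} y *\<^sub>R f y \<partial>lborel) = 0"
proof -
  have "(LBINT y=ereal 0..\<infinity>. f y) = 0 - 0"
    by (rule interval_integral_FTC_integrable[where F = F])
       (use assms in \<open>simp_all add: ereal_tendsto_simps\<close>)
  then show ?thesis by (simp add: interval_lebesgue_integral_def set_lebesgue_integral_def)
qed

lemma rapid_powr_tendsto:
  assumes "rapid R" shows "((\<lambda>y. (y powr a) *\<^sub>R R y) \<longlongrightarrow> 0) at_top"
proof -
  define k where "k = nat \<lceil>a + 1\<rceil>"
  have k: "a + 1 \<le> real k" unfolding k_def by linarith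
  obtain B where B: "\<And>y. \<bar>y\<bar> ^ k * cmod (R y) \<le> B" using assms unfolding rapid_def by meson
  show ?thesis
  proof (rule Lim_null_comparison)
    show "((\<lambda>y::real. B * inverse y) \<longlongrightarrow> 0) at_top"
      using tendsto_mult_right_zero[OF tendsto_inverse_0_at_top[OF filterlim_ident]] by blast
    show "\<forall>\<^sub>F y in at_top. norm ((y powr a) *\<^sub>R R y) \<le> B * inverse y"
      using eventually_ge_at_top[of 1]
    proof eventually_elim
      fix y :: real assume y: "y \<ge> 1"
      have "norm ((y powr a) *\<^sub>R R y) = y powr a * cmod (R y)" using y by simp
      also have "\<dots> \<le> y powr (real k - 1) * cmod (R y)" using y k by (intro mult_right_mono powr_mono) auto
      also have "y powr (real k - 1) = y ^ k / y" using y by (simp add: powr_diff powr_realpow)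
      also have "y ^ k / y * cmod (R y) = (\<bar>y\<bar> ^ k * cmod (R y)) * inverse y" using y by (simp add: divide_simps)
      also have "\<dots> \<le> B * inverse y" using y by (intro mult_right_mono B) auto
      finally show "norm ((y powr a) *\<^sub>R R y) \<le> B * inverse y" .
    qed
  qed
qed

text \<open>The Dunkl operator mixes the values at \<open>y\<close> and \<open>-y\<close>, so integrals are folded before integrating by
  parts.\<close>

lemma integral_fold_halfline:
  fixes f :: "real \<Rightarrow> complex"
  assumes f: "integrable lborel f"
  shows "(\<integral>y. f y \<partial>lborel) = (\<integral>y. indicator {0<..} y *\<^sub>R (f y + f (- y)) \<partial>lborel)"
    and "set_integrable lborel {0<..} (\<lambda>y. f y + f (- y))"
proof -
  have f': "integrable lborel (\<lambda>y. f (- y))" using lborel_integrable_real_affine[OF f, of "-1" 0] by simp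
  have i1: "integrable lborel (\<lambda>y. indicator {0<..} y *\<^sub>R f y)"
    if "integrable lborel f" for f :: "real \<Rightarrow> complex" using that by (intro integrable_mult_indicator) auto
  have i2: "integrable lborel (\<lambda>y. indicator {..<0} y *\<^sub>R f y)" using f by (intro integrable_mult_indicator) auto
  show "set_integrable lborel {0<..} (\<lambda>y. f y + f (- y))"
    unfolding set_integrable_def by (intro i1 Bochner_Integration.integrable_add f f')
  have "(\<integral>y. f y \<partial>lborel) = (\<integral>y. indicator {0<..} y *\<^sub>R f y + indicator {..<0} y *\<^sub>R f y \<partial>lborel)"
  proof (rule integral_cong_AE)
    have "AE y in lborel. y \<noteq> (0::real)" by (rule AE_lborel_singleton)
    then show "AE y in lborel. f y = indicator {0<..} y *\<^sub>R f y + indicator {..<0} y *\<^sub>R f y"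
      by eventually_elim (auto simp: indicator_def)
  qed (use i1[OF f] i2 f in \<open>auto intro: borel_measurable_integrable\<close>)
  also have "\<dots> = (\<integral>y. indicator {0<..} y *\<^sub>R f y \<partial>lborel) + (\<integral>y. indicator {..<0} y *\<^sub>R f y \<partial>lborel)"
    by (intro Bochner_Integration.integral_add i1 i2 f)
  also have "(\<integral>y. indicator {..<0} y *\<^sub>R f y \<partial>lborel) = (\<integral>y. indicator {0<..} y *\<^sub>R f (- y) \<partial>lborel)"
    using lborel_integral_real_affine[of "-1" "\<lambda>y. indicator {..<0} y *\<^sub>R f y" 0]
    by (simp add: indicator_def)
  also have "(\<integral>y. indicator {0<..} y *\<^sub>R f y \<partial>lborel) + (\<integral>y. indicator {0<..} y *\<^sub>R f (- y) \<partial>lborel)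
      = (\<integral>y. indicator {0<..} y *\<^sub>R f y + indicator {0<..} y *\<^sub>R f (- y) \<partial>lborel)"
    by (intro Bochner_Integration.integral_add[symmetric] i1 f f')
  finally show "(\<integral>y. f y \<partial>lborel) = (\<integral>y. indicator {0<..} y *\<^sub>R (f y + f (- y)) \<partial>lborel)"
    by (simp add: scaleR_add_right)
qed

text \<open>Relative to a convex set, so that it serves for derivatives along the real line, where the kernel
  is bounded, as well as for holomorphic dependence in a half-plane.\<close>

lemma has_field_derivative_integral:
  fixes f :: "complex \<Rightarrow> 'a \<Rightarrow> complex"
  assumes S: "convex S" "z \<in> S"
    and der: "\<And>w s. w \<in> S \<Longrightarrow> ((\<lambda>w. f w s) has_field_derivative f' w s) (at w within S)"
    and bound: "\<And>w s. w \<in> S \<Longrightarrow> cmod (f' w s) \<le> g s" and g: "integrable M g"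
    and int: "\<And>w. w \<in> S \<Longrightarrow> integrable M (f w)"
    and meas: "f' z \<in> borel_measurable M"
  shows "((\<lambda>w. \<integral>s. f w s \<partial>M) has_field_derivative (\<integral>s. f' z s \<partial>M)) (at z within S)"
  unfolding has_field_derivative_iff tendsto_at_iff_sequentially
proof (intro allI impI)
  fix X :: "nat \<Rightarrow> complex"
  assume X: "\<forall>i. X i \<in> S - {z}" and lim: "X \<longlonglongrightarrow> z"
  have "(\<lambda>i. \<integral>s. (f (X i) s - f z s) / (X i - z) \<partial>M) \<longlonglongrightarrow> (\<integral>s. f' z s \<partial>M)"
  proof (rule integral_dominated_convergence[where w = g])
    show "(\<lambda>s. (f (X i) s - f z s) / (X i - z)) \<in> borel_measurable M" for i
      using int X S by (intro borel_measurable_divide borel_measurable_diff borel_measurable_integrable) auto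
    show "AE s in M. (\<lambda>i. (f (X i) s - f z s) / (X i - z)) \<longlonglongrightarrow> f' z s"
    proof (intro AE_I2)
      fix s
      show "(\<lambda>i. (f (X i) s - f z s) / (X i - z)) \<longlonglongrightarrow> f' z s"
        using der[OF S(2), of s] X lim
        unfolding has_field_derivative_iff tendsto_at_iff_sequentially by (auto simp: o_def)
    qed
    show "AE s in M. cmod ((f (X i) s - f z s) / (X i - z)) \<le> g s" for i
    proof (intro AE_I2)
      fix s
      have "cmod (f (X i) s - f z s) \<le> g s * cmod (X i - z)"
        using X S by (intro field_differentiable_bound[OF S(1), where f' = "\<lambda>w. f' w s"] der bound) auto
      then show "cmod ((f (X i) s - f z s) / (X i - z)) \<le> g s"
        using X by (auto simp: norm_divide divide_le_eq)
    qed
  qed (use meas g in auto)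
  moreover have "(\<integral>s. (f (X i) s - f z s) / (X i - z) \<partial>M)
      = ((\<integral>s. f (X i) s \<partial>M) - (\<integral>s. f z s \<partial>M)) / (X i - z)" for i
    unfolding integral_divide_zero using int X S by (subst Bochner_Integration.integral_diff) auto
  ultimately show "((\<lambda>w. ((\<integral>s. f w s \<partial>M) - (\<integral>s. f z s \<partial>M)) / (w - z)) \<circ> X) \<longlonglongrightarrow> (\<integral>s. f' z s \<partial>M)"
    unfolding o_def by (simp only:)
qed

section \<open>The weighted measure and the Dunkl transform\<close>

context dunkl
begin

definition wmeas :: "real measure" where
  "wmeas = density lborel (\<lambda>y. ennreal (\<bar>y\<bar> powr (2 * b)))"

lemma sets_wmeas [simp, measurable_cong]: "sets wmeas = sets borel"
  by (simp add: wmeas_def)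

lemma space_wmeas [simp]: "space wmeas = UNIV"
  by (simp add: wmeas_def)

lemma integrable_wmeas:
  fixes f :: "real \<Rightarrow> 'a :: {banach, second_countable_topology}"
  assumes "f \<in> borel_measurable borel"
  shows "integrable wmeas f \<longleftrightarrow> integrable lborel (\<lambda>y. (\<bar>y\<bar> powr (2 * b)) *\<^sub>R f y)"
  unfolding wmeas_def using assms by (intro integrable_density) auto

lemma integral_wmeas:
  fixes f :: "real \<Rightarrow> 'a :: {banach, second_countable_topology}"
  assumes "f \<in> borel_measurable borel"
  shows "(\<integral>y. f y \<partial>wmeas) = (\<integral>y. (\<bar>y\<bar> powr (2 * b)) *\<^sub>R f y \<partial>lborel)"
  unfolding wmeas_def using assms by (intro integral_density) auto

lemma sigma_finite_wmeas: "sigma_finite_measure wmeas"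
  unfolding wmeas_def
  by (subst sigma_finite_measure.sigma_finite_iff_density_finite[OF lborel.sigma_finite_measure_axioms]) auto

lemma AE_wmeas: "(AE y in lborel. P y) \<Longrightarrow> (AE y in wmeas. P y)"
  unfolding wmeas_def by (subst AE_density) auto

lemma wmeas_reflect: "distr wmeas borel uminus = wmeas"
proof -
  have "wmeas = density (distr lborel borel uminus) (\<lambda>y. ennreal (\<bar>y\<bar> powr (2 * b)))"
    unfolding lborel_distr_uminus by (simp add: wmeas_def)
  also have "\<dots> = distr (density lborel (\<lambda>y. ennreal (\<bar>- y\<bar> powr (2 * b)))) borel uminus"
    by (intro density_distr) auto
  also have "\<dots> = distr wmeas borel uminus" by (simp add: wmeas_def)
  finally show ?thesis by simp
qed

lemma integral_wmeas_reflect: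
  fixes f :: "real \<Rightarrow> complex"
  assumes [measurable]: "f \<in> borel_measurable borel"
  shows "(\<integral>y. f (- y) \<partial>wmeas) = (\<integral>y. f y \<partial>wmeas)"
proof -
  have "(\<integral>y. f y \<partial>wmeas) = (\<integral>y. f y \<partial>distr wmeas borel uminus)" by (simp add: wmeas_reflect)
  also have "\<dots> = (\<integral>y. f (- y) \<partial>wmeas)" by (intro integral_distr) auto
  finally show ?thesis by simp
qed

lemma integrable_wmeas_bound:
  fixes f :: "real \<Rightarrow> complex"
  assumes [measurable]: "f \<in> borel_measurable borel"
    and C: "\<And>y. cmod (f y) \<le> C" "\<And>y. \<bar>y\<bar> ^ k * cmod (f y) \<le> C" and k: "real k \<ge> 2 * b + 2"
  shows "integrable wmeas f"
proof -
  define V :: "real \<Rightarrow> real" where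
    "V y = indicator {0..1} y *\<^sub>R (y powr (2 * b)) + indicator {1..} y *\<^sub>R (y powr (-2))" for y
  have i: "integrable lborel (\<lambda>y. indicator A y *\<^sub>R (y powr e :: real))"
    if "(\<lambda>y. y powr e) integrable_on A" "A \<in> sets borel" for A :: "real set" and e
  proof -
    have "set_integrable lebesgue A (\<lambda>y. y powr e)"
      using that by (intro nonnegative_absolutely_integrable_1) auto
    then show ?thesis using that(2) unfolding set_integrable_def by (subst (asm) integrable_completion) auto
  qed
  have V: "integrable lborel V" unfolding V_def
  proof (intro Bochner_Integration.integrable_add i)
    show "(\<lambda>y::real. y powr (2 * b)) integrable_on {0..1}"
      using has_integral_powr_from_0[of "2 * b" 1] b_gt by (auto simp: integrable_on_def)
    show "(\<lambda>y::real. y powr (- 2)) integrable_on {1..}"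
      using has_integral_powr_to_inf[of "-2" 1] by (auto simp: integrable_on_def)
  qed auto
  have V': "integrable lborel (\<lambda>y. V (- y))" using lborel_integrable_real_affine[OF V, of "-1" 0] by simp
  have V_nonneg: "V y \<ge> 0" for y by (simp add: V_def indicator_def)
  have C0: "C \<ge> 0" using C(1)[of 0] norm_ge_zero order_trans by blast
  have pos: "\<bar>y\<bar> powr (2 * b) * cmod (f (\<sigma> y)) \<le> C * V \<bar>y\<bar>" if "\<bar>\<sigma> y\<bar> = \<bar>y\<bar>" for y and \<sigma> :: "real \<Rightarrow> real"
  proof (cases "\<bar>y\<bar> \<le> 1")
    case True
    have "\<bar>y\<bar> powr (2 * b) * cmod (f (\<sigma> y)) \<le> \<bar>y\<bar> powr (2 * b) * C" by (intro mult_left_mono C) auto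
    also have "\<dots> \<le> C * V \<bar>y\<bar>" using True C0
      by (auto simp: V_def indicator_def mult.commute intro!: mult_left_mono)
    finally show ?thesis .
  next
    case False
    have "\<bar>y\<bar> powr (2 * b) * cmod (f (\<sigma> y)) \<le> \<bar>y\<bar> powr (real k - 2) * cmod (f (\<sigma> y))"
      using False k by (intro mult_right_mono powr_mono) auto
    also have "\<bar>y\<bar> powr (real k - 2) = \<bar>y\<bar> powr (-2) * \<bar>y\<bar> ^ k"
      using False by (simp add: powr_diff powr_minus divide_simps powr_realpow)
    also have "\<bar>y\<bar> powr (-2) * \<bar>y\<bar> ^ k * cmod (f (\<sigma> y)) \<le> \<bar>y\<bar> powr (-2) * C"
      using C(2)[of "\<sigma> y"] that by (simp add: mult.assoc mult_left_mono)
    also have "\<dots> = C * V \<bar>y\<bar>" using False by (simp add: V_def indicator_def)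
    finally show ?thesis .
  qed
  have "integrable lborel (\<lambda>y. (\<bar>y\<bar> powr (2 * b)) *\<^sub>R f y)"
  proof (rule Bochner_Integration.integrable_bound)
    show "integrable lborel (\<lambda>y. C * (V y + V (- y)))"
      by (intro integrable_mult_right Bochner_Integration.integrable_add V V')
    show "AE y in lborel. norm ((\<bar>y\<bar> powr (2 * b)) *\<^sub>R f y) \<le> norm (C * (V y + V (- y)))"
    proof (intro AE_I2)
      fix y
      have "norm ((\<bar>y\<bar> powr (2 * b)) *\<^sub>R f y) \<le> C * V \<bar>y\<bar>" using pos[of id y] by simp
      also have "\<dots> \<le> C * (V y + V (- y))"
        using V_nonneg[of y] V_nonneg[of "-y"] C0 by (intro mult_left_mono) (auto simp: abs_if)
      finally show "norm ((\<bar>y\<bar> powr (2 * b)) *\<^sub>R f y) \<le> norm (C * (V y + V (- y)))" by simp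
    qed
  qed auto
  then show ?thesis by (subst integrable_wmeas) auto
qed

lemma rapid_integrable:
  assumes f: "f \<in> borel_measurable borel" "rapid f"
  shows "integrable wmeas f"
proof -
  define k where "k = nat \<lceil>2 * b + 2\<rceil>"
  obtain C1 where C1: "\<And>y. \<bar>y\<bar> ^ 0 * cmod (f y) \<le> C1" using f(2) unfolding rapid_def by meson
  obtain C2 where C2: "\<And>y. \<bar>y\<bar> ^ k * cmod (f y) \<le> C2" using f(2) unfolding rapid_def by meson
  show ?thesis
  proof (rule integrable_wmeas_bound[OF f(1)])
    show "cmod (f y) \<le> max C1 C2" for y using C1[of y] by simp
    show "\<bar>y\<bar> ^ k * cmod (f y) \<le> max C1 C2" for y using C2[of y] by simp
    show "real k \<ge> 2 * b + 2" unfolding k_def by linarith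
  qed
qed

text \<open>\<open>w\<close> is the image \<open>u'(y) + b (u(y) - u(-y)) / y\<close> of \<open>u\<close> under the Dunkl operator, which is the operator \<open>D\<close>
  conjugated by \<open>\<bar>x\<bar>\<^bsup>b\<^esup>\<close>.  A relation without quotient avoids a case distinction at \<open>y = 0\<close>.\<close>

definition dunkl_rel :: "(real \<Rightarrow> complex) \<Rightarrow> (real \<Rightarrow> complex) \<Rightarrow> bool" where
  "dunkl_rel u w \<longleftrightarrow> (\<forall>y. of_real y * w y = of_real y * vd u y + of_real b * (u y - u (- y)))"

lemma dunkl_relD: "dunkl_rel u w \<Longrightarrow> of_real y * w y = of_real y * vd u y + of_real b * (u y - u (- y))"
  by (simp add: dunkl_rel_def)

text \<open>The odd function \<open>u(y) - u(-y)\<close> vanishes at \<open>0\<close>, so Hadamard's lemma divides it by \<open>y\<close>.\<close>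

lemma dunkl_rel_exists:
  assumes u: "u \<in> schwartz"
  obtains w where "w \<in> schwartz" "dunkl_rel u w"
proof -
  obtain q where q: "q \<in> schwartz" "\<And>y. u y - u (- y) = of_real (y - 0) * q y"
    using schwartz_divide[of "\<lambda>y. u y - u (- y)" 0] schwartz_diff[OF u schwartz_reflect[OF u]] by auto
  show ?thesis
  proof (rule that)
    show "(\<lambda>y. vd u y + of_real b * q y) \<in> schwartz"
      by (intro schwartz_add schwartz_vd schwartz_cmult u q)
    show "dunkl_rel u (\<lambda>y. vd u y + of_real b * q y)"
      unfolding dunkl_rel_def q(2) by (simp add: distrib_left mult_ac)
  qed
qed

definition dline :: "nat \<Rightarrow> real \<Rightarrow> real \<Rightarrow> complex" where
  "dline n x y = dkd n (\<i> * of_real (x * y))"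

lemma dline_continuous [continuous_intros]:
  "continuous_on A f \<Longrightarrow> continuous_on A g \<Longrightarrow> continuous_on A (\<lambda>y. dline n (f y) (g y))"
  unfolding dline_def by (intro continuous_intros)

lemma dline_measurable [measurable]: "dline n x \<in> borel_measurable borel"
  by (intro borel_measurable_continuous_onI continuous_intros)

lemma dline_bound: "\<exists>C\<ge>0. \<forall>x y. cmod (dline n x y) \<le> C * (1 + \<bar>x\<bar>) * (1 + \<bar>y\<bar>)"
proof -
  obtain C where C: "C \<ge> 0" "\<And>s. cmod (dkd n (\<i> * of_real s)) \<le> C * (1 + \<bar>s\<bar>)" using dkd_bound by blast
  have "cmod (dline n x y) \<le> C * (1 + \<bar>x\<bar>) * (1 + \<bar>y\<bar>)" for x y
  proof -
    have "cmod (dline n x y) \<le> C * (1 + \<bar>x * y\<bar>)" unfolding dline_def by (rule C)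
    also have "\<dots> \<le> C * ((1 + \<bar>x\<bar>) * (1 + \<bar>y\<bar>))" using C(1)
      by (intro mult_left_mono) (auto simp: abs_mult algebra_simps)
    finally show ?thesis by (simp add: mult.assoc)
  qed
  then show ?thesis using C(1) by blast
qed

lemma dline_deriv: "(dline n x has_vector_derivative \<i> * of_real x * dline (Suc n) x y) (at y)"
proof -
  have "((\<lambda>y. \<i> * of_real (x * y)) has_vector_derivative \<i> * of_real x) (at y)"
    by (auto intro!: derivative_eq_intros has_vector_derivative_mult_right
        bounded_linear.has_vector_derivative[OF bounded_linear_of_real])
  from field_vector_diff_chain_at[OF this dkd_DERIV]
  show ?thesis by (simp add: o_def dline_def[abs_def])
qed

lemma dline_ode:
  "of_real y * (\<i> * of_real x * dline (Suc 0) x y)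
    = of_real y * (\<i> * of_real x) * dline 0 x y - of_real b * (dline 0 x y - dline 0 x (- y))"
  using dkd_ode[of "\<i> * of_real (x * y)" 0] by (simp add: dline_def algebra_simps)

text \<open>The weight \<open>2 b\<close> and the operator belong together: for Schwartz functions \<open>u\<close> and
  \<open>w\<close> with \<open>w = u' + b (u(y) - u(-y)) / y\<close>, and for \<open>v\<close> with \<open>T v = m v\<close>, the integrand
  \<open>w v + m u v\<close>, folded onto the half-line, is the derivative of
  \<open>y\<^bsup>2b\<^esup> (u(y) v(y) - u(-y) v(-y))\<close>, which vanishes at both ends because \<open>2 b + 1 > 0\<close>.\<close>

lemma dunkl_parts:
  assumes u: "u \<in> schwartz" and w: "w \<in> schwartz" and rel: "dunkl_rel u w"
  shows "(\<integral>y. dline 0 x y * w y \<partial>wmeas) = - \<i> * of_real x * (\<integral>y. dline 0 x y * u y \<partial>wmeas)"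
proof -
  define m where "m = \<i> * of_real x"
  define v where "v = dline 0 x"
  define v' where "v' y = m * dline (Suc 0) x y" for y
  have v: "(v has_vector_derivative v' y) (at y)" for y
    unfolding v_def v'_def m_def by (rule dline_deriv)
  have v_ode: "of_real y * v' y = of_real y * m * v y - of_real b * (v y - v (- y))" for y
    unfolding v_def v'_def m_def by (rule dline_ode)
  define p where "p y = u y * v y" for y
  define p' where "p' y = u y * v' y + vd u y * v y" for y
  have p: "(p has_vector_derivative p' y) (at y)" for y
    unfolding p_def[abs_def] p'_def by (rule has_vector_derivative_mult[OF schwartz_deriv[OF u] v])
  define P where "P y = p y - p (- y)" for y
  have P: "(P has_vector_derivative p' y + p' (- y)) (at y)" for y
  proof -
    have "(uminus has_vector_derivative (-1::real)) (at y)"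
      using has_vector_derivative_minus[OF has_vector_derivative_id[of "at y"]] by simp
    from vector_diff_chain_at[OF this p[of "- y"]]
    have "((\<lambda>y. p (- y)) has_vector_derivative - p' (- y)) (at y)" by (simp add: o_def)
    from has_vector_derivative_diff[OF p this] show ?thesis by (simp add: P_def[abs_def])
  qed
  define J where "J y = v y * w y + m * (v y * u y)" for y
  have contv: "continuous_on UNIV v" unfolding v_def by (intro continuous_intros)
  have contJ: "continuous_on A J" for A unfolding J_def v_def
    by (intro continuous_intros schwartz_continuous u w)
  obtain C where C: "C \<ge> 0" "\<And>y. cmod (v y) \<le> C * (1 + \<bar>x\<bar>) * (1 + \<bar>y\<bar>)"
    using dline_bound[of 0] unfolding v_def by blast
  have rapid_v: "rapid (\<lambda>y. v y * h y)" if "h \<in> schwartz" for h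
    by (rule rapid_growth[OF schwartz_rapid[OF that], of _ "C * (1 + \<bar>x\<bar>)" 1])
       (auto simp: norm_mult intro!: mult_right_mono C(2))
  have meas_v: "(\<lambda>y. v y * h y) \<in> borel_measurable borel" if "h \<in> schwartz" for h
    by (intro borel_measurable_continuous_onI continuous_intros contv schwartz_continuous that)
  have int_v: "integrable wmeas (\<lambda>y. v y * h y)" if "h \<in> schwartz" for h
    by (intro rapid_integrable rapid_v meas_v that)
  have J_int: "integrable wmeas J" unfolding J_def
    by (intro Bochner_Integration.integrable_add integrable_mult_right int_v u w)
  have J_meas: "J \<in> borel_measurable borel" by (intro borel_measurable_continuous_onI contJ)
  define j where "j y = (\<bar>y\<bar> powr (2 * b)) *\<^sub>R J y" for y
  have j_int: "integrable lborel j"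
    using J_int unfolding integrable_wmeas[OF J_meas] j_def[abs_def] .
  define F where "F y = (y powr (2 * b)) *\<^sub>R P y" for y
  have key: "of_real y * (J y + J (- y)) = of_real y * (p' y + p' (- y)) + 2 * of_real b * P y" for y
  proof -
    have 1: "of_real y * J y = (of_real y * w y) * v y + u y * (of_real y * m * v y)" for y
      by (simp add: J_def algebra_simps)
    have 2: "of_real y * J y = of_real y * p' y + of_real b * (2 * p y - u (- y) * v y - u y * v (- y))" for y
    proof -
      have v: "of_real y * m * v y = of_real y * v' y + of_real b * (v y - v (- y))"
        using v_ode[of y] by simp
      show ?thesis unfolding 1 dunkl_relD[OF rel] v p_def p'_def by (simp add: algebra_simps)
    qed
    have "of_real y * (J y + J (- y)) = of_real y * J y - of_real (- y) * J (- y)" by (simp add: algebra_simps)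
    also have "\<dots> = of_real y * (p' y + p' (- y)) + 2 * of_real b * P y"
      unfolding 2 by (simp add: P_def algebra_simps)
    finally show ?thesis .
  qed
  have "(\<integral>y. j y \<partial>lborel) = (\<integral>y. indicator {0<..} y *\<^sub>R (j y + j (- y)) \<partial>lborel)"
    by (rule integral_fold_halfline(1)[OF j_int])
  also have "\<dots> = 0"
  proof (rule halfline_integral_zero[where F = F])
    show "set_integrable lborel {0<..} (\<lambda>y. j y + j (- y))" by (rule integral_fold_halfline(2)[OF j_int])
    show "isCont (\<lambda>y. j y + j (- y)) y" if "y > 0" for y
    proof -
      have "isCont J z" for z using contJ[of UNIV] by (simp add: continuous_on_eq_continuous_at)
      then have J1: "isCont J y" and J2: "isCont (\<lambda>y. J (- y)) y"
        by (auto intro: isCont_o2[where g = J] continuous_intros)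
      from J1 J2 show ?thesis unfolding j_def by (intro continuous_intros) (use that in auto)
    qed
    show "(F has_vector_derivative j y + j (- y)) (at y)" if "y > 0" for y
    proof -
      have "((\<lambda>y. y powr (2 * b)) has_real_derivative 2 * b * y powr (2 * b - 1)) (at y)"
        using that by (auto intro!: derivative_eq_intros)
      from has_vector_derivative_scaleR[OF this P]
      have "(F has_vector_derivative (y powr (2 * b) *\<^sub>R (p' y + p' (- y)) + (2 * b * y powr (2 * b - 1)) *\<^sub>R P y)) (at y)"
        by (simp add: F_def[abs_def])
      moreover have "y powr (2 * b) *\<^sub>R (p' y + p' (- y)) + (2 * b * y powr (2 * b - 1)) *\<^sub>R P y
          = (y powr (2 * b - 1)) *\<^sub>R (of_real y * (p' y + p' (- y)) + 2 * of_real b * P y)"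
        using that by (simp add: scaleR_conv_of_real powr_diff field_simps)
      moreover have "\<dots> = j y + j (- y)"
        unfolding key[symmetric] j_def using that by (simp add: scaleR_conv_of_real powr_diff field_simps)
      ultimately show ?thesis by simp
    qed
    show "(F \<longlongrightarrow> 0) (at_right 0)"
    proof (rule Lim_null_comparison)
      define D where "D = p' 0 + p' (- 0)"
      have "(P has_derivative (\<lambda>h. h *\<^sub>R D)) (at 0)"
        using P[of 0] by (simp add: has_vector_derivative_def D_def)
      then have "((\<lambda>h. norm (P h - h *\<^sub>R D) / norm h) \<longlongrightarrow> 0) (at 0)"
        by (simp add: has_derivative_at P_def)
      then have 1: "((\<lambda>h. norm (P h - h *\<^sub>R D) / norm h) \<longlongrightarrow> 0) (at_right 0)"
        by (rule tendsto_within_subset) auto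
      have 2: "((\<lambda>y. y powr (2 * b + 1)) \<longlongrightarrow> 0) (at_right (0::real))"
        by (rule tendsto_zero_powrI[OF tendsto_ident_at tendsto_const])
           (use b_gt in \<open>auto simp: eventually_at_right_less eventually_at_filter\<close>)
      show "((\<lambda>y. y powr (2 * b + 1) * (norm (P y - y *\<^sub>R D) / norm y + norm D)) \<longlongrightarrow> 0) (at_right 0)"
        using tendsto_mult[OF 2 tendsto_add[OF 1 tendsto_const[of "norm D"]]] by simp
      show "\<forall>\<^sub>F y in at_right 0. norm (F y) \<le> y powr (2 * b + 1) * (norm (P y - y *\<^sub>R D) / norm y + norm D)"
        unfolding eventually_at_filter
      proof (intro always_eventually allI impI)
        fix y :: real assume "y \<in> {0<..}"
        then have y: "y > 0" by simp
        have "norm (P y) \<le> norm (P y - y *\<^sub>R D) + norm (y *\<^sub>R D)"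
          using norm_triangle_ineq[of "P y - y *\<^sub>R D" "y *\<^sub>R D"] by simp
        then have "norm (F y) \<le> y powr (2 * b) * (norm (P y - y *\<^sub>R D) + y * norm D)"
          using y unfolding F_def by (auto intro!: mult_left_mono)
        also have "\<dots> = y powr (2 * b + 1) * (norm (P y - y *\<^sub>R D) / norm y + norm D)"
          using y by (simp add: powr_add field_simps)
        finally show "norm (F y) \<le> \<dots>" .
      qed
    qed
    have "rapid P" unfolding P_def p_def using rapid_v[OF u]
      by (intro rapid_diff rapid_reflect[of "\<lambda>y. u y * v y"]) (simp_all add: mult.commute)
    then show "(F \<longlongrightarrow> 0) at_top" unfolding F_def by (rule rapid_powr_tendsto)
  qed
  finally have "(\<integral>y. J y \<partial>wmeas) = 0"
    unfolding integral_wmeas[OF J_meas] j_def .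
  also have "(\<integral>y. J y \<partial>wmeas) = (\<integral>y. v y * w y \<partial>wmeas) + m * (\<integral>y. v y * u y \<partial>wmeas)"
    unfolding J_def by (subst Bochner_Integration.integral_add)
      (auto intro!: integrable_mult_right int_v u w)
  finally show ?thesis by (simp add: v_def m_def eq_neg_iff_add_eq_0)
qed

text \<open>\<open>dtr 0\<close> is the Dunkl transform with kernel \<open>E(ixs)\<close> in both directions; the transform with kernel
  \<open>E(-ixs)\<close> differs from it by a reflection.  \<open>dtr n\<close> is its \<open>n\<close>-th derivative.\<close>

definition dtr :: "nat \<Rightarrow> (real \<Rightarrow> complex) \<Rightarrow> real \<Rightarrow> complex" where
  "dtr n a x = (\<integral>s. dline n x s * ((\<i> * of_real s) ^ n * a s) \<partial>wmeas)"

lemma schwartz_is: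
  "a \<in> schwartz \<Longrightarrow> (\<lambda>s. \<i> * of_real s * a s) \<in> schwartz"
  using schwartz_cmult[OF schwartz_times_x, of a \<i>] by (simp add: mult_ac)

lemma schwartz_is_power:
  assumes "a \<in> schwartz" shows "(\<lambda>s. (\<i> * of_real s) ^ n * a s) \<in> schwartz"
proof (induction n)
  case (Suc n)
  from schwartz_is[OF this] show ?case by (simp add: mult_ac)
qed (use assms in simp)

lemma dline_integrable:
  assumes "a \<in> schwartz" shows "integrable wmeas (\<lambda>s. dline n x s * a s)"
proof (rule rapid_integrable)
  show "(\<lambda>s. dline n x s * a s) \<in> borel_measurable borel"
    by (intro borel_measurable_continuous_onI continuous_intros schwartz_continuous assms)
  obtain C where C: "C \<ge> 0" "\<And>x y. cmod (dline n x y) \<le> C * (1 + \<bar>x\<bar>) * (1 + \<bar>y\<bar>)"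
    using dline_bound by blast
  show "rapid (\<lambda>s. dline n x s * a s)"
    by (rule rapid_growth[OF schwartz_rapid[OF assms], of _ "C * (1 + \<bar>x\<bar>)" 1])
       (auto simp: norm_mult intro!: mult_right_mono C(2))
qed

lemma dtr_growth:
  assumes a: "a \<in> schwartz" shows "\<exists>K. \<forall>x. cmod (dtr 0 a x) \<le> K * (1 + \<bar>x\<bar>)"
proof -
  obtain C where C: "C \<ge> 0" "\<And>x y. cmod (dline 0 x y) \<le> C * (1 + \<bar>x\<bar>) * (1 + \<bar>y\<bar>)"
    using dline_bound by blast
  have int: "integrable wmeas (\<lambda>s. (1 + \<bar>s\<bar>) * cmod (a s))"
  proof -
    have "integrable wmeas (\<lambda>s. of_real (1 + \<bar>s\<bar>) * a s)"
    proof (rule rapid_integrable)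
      show "(\<lambda>s. of_real (1 + \<bar>s\<bar>) * a s) \<in> borel_measurable borel"
        by (intro borel_measurable_continuous_onI continuous_intros schwartz_continuous a)
      show "rapid (\<lambda>s. of_real (1 + \<bar>s\<bar>) * a s)"
      proof (rule rapid_growth[OF schwartz_rapid[OF a], of _ 1 1])
        fix s :: real
        have "cmod (of_real (1 + \<bar>s\<bar>)) = 1 + \<bar>s\<bar>" by (subst norm_of_real) simp
        then show "cmod (of_real (1 + \<bar>s\<bar>) * a s) \<le> 1 * (1 + \<bar>s\<bar>) ^ 1 * cmod (a s)" by (simp add: norm_mult)
      qed
    qed
    from integrable_norm[OF this] show ?thesis by (simp add: norm_mult del: of_real_add)
  qed
  have "cmod (dtr 0 a x) \<le> C * (\<integral>s. (1 + \<bar>s\<bar>) * cmod (a s) \<partial>wmeas) * (1 + \<bar>x\<bar>)" for x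
  proof -
    have "cmod (dtr 0 a x) \<le> (\<integral>s. cmod (dline 0 x s * a s) \<partial>wmeas)"
      unfolding dtr_def by simp
    also have "\<dots> \<le> (\<integral>s. C * (1 + \<bar>x\<bar>) * ((1 + \<bar>s\<bar>) * cmod (a s)) \<partial>wmeas)"
    proof (rule integral_mono)
      show "integrable wmeas (\<lambda>s. cmod (dline 0 x s * a s))" by (intro integrable_norm dline_integrable a)
      show "integrable wmeas (\<lambda>s. C * (1 + \<bar>x\<bar>) * ((1 + \<bar>s\<bar>) * cmod (a s)))" by (intro integrable_mult_right int)
      show "cmod (dline 0 x s * a s) \<le> C * (1 + \<bar>x\<bar>) * ((1 + \<bar>s\<bar>) * cmod (a s))" for s
        using mult_right_mono[OF C(2)[of x s], of "cmod (a s)"] by (simp add: norm_mult mult.assoc)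
    qed
    also have "\<dots> = C * (\<integral>s. (1 + \<bar>s\<bar>) * cmod (a s) \<partial>wmeas) * (1 + \<bar>x\<bar>)"
      unfolding integral_mult_right_zero by (simp only: mult_ac)
    finally show ?thesis .
  qed
  then show ?thesis by blast
qed

lemma dtr_deriv:
  assumes a: "a \<in> schwartz" shows "(dtr n a has_vector_derivative dtr (Suc n) a x) (at x)"
proof -
  define f where "f z s = dkd n (\<i> * z * of_real s) * ((\<i> * of_real s) ^ n * a s)" for z s
  define f' where "f' z s = dkd (Suc n) (\<i> * z * of_real s) * ((\<i> * of_real s) ^ Suc n * a s)" for z s
  define S :: "complex set" where "S = of_real ` ball x 1"
  obtain C where C: "C \<ge> 0" "\<And>x y. cmod (dline (Suc n) x y) \<le> C * (1 + \<bar>x\<bar>) * (1 + \<bar>y\<bar>)"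
    using dline_bound by blast
  have f: "f (of_real x) s = dline n x s * ((\<i> * of_real s) ^ n * a s)" for x s
    by (simp add: f_def dline_def mult_ac)
  have f': "f' (of_real x) s = dline (Suc n) x s * ((\<i> * of_real s) ^ Suc n * a s)" for x s
    by (simp add: f'_def dline_def mult_ac)
  have rs: "(\<lambda>s. of_real s * ((\<i> * of_real s) ^ Suc n * a s)) \<in> schwartz" "(\<lambda>s. (\<i> * of_real s) ^ Suc n * a s) \<in> schwartz"
    by (intro schwartz_times_x schwartz_is_power a)+
  let ?A = "\<lambda>s. cmod ((\<i> * of_real s) ^ Suc n * a s) + cmod (of_real s * ((\<i> * of_real s) ^ Suc n * a s))"
  let ?g = "\<lambda>s. C * (2 + \<bar>x\<bar>) * ?A s"
  have g: "integrable wmeas ?g"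
    using rs by (intro integrable_mult_right Bochner_Integration.integrable_add integrable_norm rapid_integrable
        schwartz_measurable schwartz_rapid)
  have "((\<lambda>w. \<integral>s. f w s \<partial>wmeas) has_field_derivative (\<integral>s. f' (of_real x) s \<partial>wmeas)) (at (of_real x) within S)"
  proof (rule has_field_derivative_integral[where g = ?g])
    show "convex S" unfolding S_def by (intro convex_linear_image bounded_linear.linear[OF bounded_linear_of_real]) auto
    show "of_real x \<in> S" by (auto simp: S_def)
    show "((\<lambda>w. f w s) has_field_derivative f' w s) (at w within S)" for w s
      unfolding f_def f'_def
      by (rule has_field_derivative_at_within)
         (auto intro!: derivative_eq_intros DERIV_chain2[OF dkd_DERIV] simp: mult_ac)
    show "cmod (f' w s) \<le> ?g s" if wS: "w \<in> S" for w s
    proof -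
      obtain y where y: "w = of_real y" "\<bar>y - x\<bar> < 1" using wS by (auto simp: S_def dist_real_def abs_minus_commute)
      have "cmod (f' w s) \<le> (C * (1 + \<bar>y\<bar>) * (1 + \<bar>s\<bar>)) * cmod ((\<i> * of_real s) ^ Suc n * a s)"
        unfolding y(1) f' norm_mult[of "dline _ _ _"] by (intro mult_right_mono C) auto
      also have "\<dots> = C * (1 + \<bar>y\<bar>) * ?A s" by (simp add: norm_mult algebra_simps)
      also have "\<dots> \<le> ?g s" using y(2) C(1) by (intro mult_right_mono mult_left_mono) auto
      finally show ?thesis .
    qed
    show "integrable wmeas (f w)" if wS: "w \<in> S" for w
    proof -
      obtain y where y: "w = of_real y" using wS by (auto simp: S_def)
      show ?thesis unfolding y f[abs_def] by (intro dline_integrable schwartz_is_power a)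
    qed
    show "f' (of_real x) \<in> borel_measurable wmeas"
      using borel_measurable_integrable[OF dline_integrable[OF rs(2)]] by (simp add: f'[abs_def])
  qed (rule g)
  moreover have "((of_real :: real \<Rightarrow> complex) has_vector_derivative 1) (at x within ball x 1)"
    using bounded_linear.has_vector_derivative[OF bounded_linear_of_real has_vector_derivative_id] by simp
  ultimately have "(((\<lambda>w. \<integral>s. f w s \<partial>wmeas) \<circ> of_real) has_vector_derivative (1 * (\<integral>s. f' (of_real x) s \<partial>wmeas))) (at x within ball x 1)"
    unfolding S_def by (intro field_vector_diff_chain_within)
  then have "((\<lambda>x. dtr n a x) has_vector_derivative dtr (Suc n) a x) (at x within ball x 1)"
    by (simp add: o_def f[abs_def] f'[abs_def] dtr_def)
  then show ?thesis by (subst (asm) at_within_open) auto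
qed

text \<open>The integrated form of \<open>dkd_ode\<close>.  It shows inductively that all derivatives of a transform decrease
  as fast as the transforms themselves.\<close>

lemma dtr_rel:
  assumes a: "a \<in> schwartz"
  shows "of_real x * dtr (Suc n) a x + of_nat n * dtr n a x
    = of_real x * dtr n (\<lambda>s. \<i> * of_real s * a s) x + of_nat n * dtr (n - 1) (\<lambda>s. \<i> * of_real s * a s) x
      - of_real b * (dtr n a x - (-1) ^ n * dtr n a (- x))"
proof -
  let ?e = "\<lambda>s. \<i> * of_real s :: complex"
  have sa: "(\<lambda>s. ?e s * a s) \<in> schwartz" by (rule schwartz_is[OF a])
  have i: "integrable wmeas (\<lambda>s. dline m x s * (?e s ^ k * h s))" if "h \<in> schwartz" for m k h x
    by (intro dline_integrable schwartz_is_power that)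
  have pw: "of_real x * (dline (Suc n) x s * (?e s ^ Suc n * a s)) + of_nat n * (dline n x s * (?e s ^ n * a s))
    = of_real x * (dline n x s * (?e s ^ n * (?e s * a s))) + of_nat n * (dline (n - 1) x s * (?e s ^ (n - 1) * (?e s * a s)))
      - of_real b * (dline n x s * (?e s ^ n * a s) - (-1) ^ n * (dline n (- x) s * (?e s ^ n * a s)))" for s
  proof -
    have n: "of_nat n * (?e s ^ (n - 1) * ?e s) = of_nat n * ?e s ^ n" by (cases n) auto
    have 1: "\<i> * of_real (x * s) = of_real x * ?e s" by simp
    have 2: "\<i> * of_real (- x * s) = - (\<i> * of_real (x * s))" by simp
    have "of_nat n * (dline (n - 1) x s * (?e s ^ (n - 1) * (?e s * a s)))
        = (of_nat n * (?e s ^ (n - 1) * ?e s)) * dline (n - 1) x s * a s" by (simp only: mult_ac)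
    then have 3: "of_nat n * (dline (n - 1) x s * (?e s ^ (n - 1) * (?e s * a s)))
        = of_nat n * ?e s ^ n * dline (n - 1) x s * a s" by (simp only: n)
    have "(of_real x * ?e s * dline (Suc n) x s + of_nat n * dline n x s) * (?e s ^ n * a s)
       = (of_real x * ?e s * dline n x s + of_nat n * dline (n - 1) x s
          - of_real b * (dline n x s - (- 1) ^ n * dline n (- x) s)) * (?e s ^ n * a s)"
      using dkd_ode[of "\<i> * of_real (x * s)" n] unfolding dline_def 2 by (simp only: 1[symmetric])
    then show ?thesis unfolding 3 by (simp add: algebra_simps)
  qed
  have "of_real x * dtr (Suc n) a x + of_nat n * dtr n a x
    = (\<integral>s. of_real x * (dline (Suc n) x s * (?e s ^ Suc n * a s)) + of_nat n * (dline n x s * (?e s ^ n * a s)) \<partial>wmeas)"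
    unfolding dtr_def using a by (subst Bochner_Integration.integral_add) (auto intro!: integrable_mult_right i simp del: power_Suc)
  also have "\<dots> = of_real x * dtr n (\<lambda>s. ?e s * a s) x + of_nat n * dtr (n - 1) (\<lambda>s. ?e s * a s) x
      - of_real b * (dtr n a x - (-1) ^ n * dtr n a (- x))"
    unfolding pw dtr_def
    by (simp only: Bochner_Integration.integral_add Bochner_Integration.integral_diff
          integral_mult_right_zero Bochner_Integration.integrable_add Bochner_Integration.integrable_diff
          integrable_mult_right i[OF a] i[OF sa])
  finally show ?thesis .
qed

lemma dtr_dunkl_rel:
  assumes "a \<in> schwartz" shows "dunkl_rel (dtr 0 a) (dtr 0 (\<lambda>s. \<i> * of_real s * a s))"
proof -
  have "vd (dtr 0 a) = dtr (Suc 0) a" by (rule vdI, rule dtr_deriv[OF assms])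
  then show ?thesis unfolding dunkl_rel_def using dtr_rel[OF assms, of _ 0] by (simp add: algebra_simps)
qed

lemma dtr_of_rel:
  assumes "u \<in> schwartz" "w \<in> schwartz" "dunkl_rel u w"
  shows "dtr 0 w x = - \<i> * of_real x * dtr 0 u x"
  using dunkl_parts[OF assms] by (simp add: dtr_def)

text \<open>Each factor \<open>x\<close> is moved onto \<open>a\<close> as a Dunkl operator.  The remaining transforms grow at most
  linearly, which the spare factors \<open>x\<close> compensate.\<close>

lemma dtr_rapid_0:
  assumes "a \<in> schwartz" shows "rapid (dtr 0 a)"
proof -
  have *: "\<exists>K. \<forall>x. \<bar>x\<bar> ^ k * cmod (dtr 0 a x) \<le> K * (1 + \<bar>x\<bar>)" if "a \<in> schwartz" for k a
    using that
  proof (induction k arbitrary: a)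
    case 0
    then show ?case using dtr_growth by simp
  next
    case (Suc k)
    obtain w where w: "w \<in> schwartz" "dunkl_rel a w" using dunkl_rel_exists[OF Suc.prems] .
    obtain K where K: "\<And>x. \<bar>x\<bar> ^ k * cmod (dtr 0 w x) \<le> K * (1 + \<bar>x\<bar>)" using Suc.IH[OF w(1)] by blast
    have "\<bar>x\<bar> ^ Suc k * cmod (dtr 0 a x) \<le> K * (1 + \<bar>x\<bar>)" for x
      using K[of x] unfolding dtr_of_rel[OF Suc.prems w] by (simp add: norm_mult mult_ac)
    then show ?case by blast
  qed
  show ?thesis unfolding rapid_def
  proof
    fix k
    obtain K1 K2 where K: "\<And>x. \<bar>x\<bar> ^ k * cmod (dtr 0 a x) \<le> K1 * (1 + \<bar>x\<bar>)"
        "\<And>x. \<bar>x\<bar> ^ Suc k * cmod (dtr 0 a x) \<le> K2 * (1 + \<bar>x\<bar>)" using *[OF assms] by metis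
    have "\<bar>x\<bar> ^ k * cmod (dtr 0 a x) \<le> K1 + K2" for x
    proof -
      have "(1 + \<bar>x\<bar>) * (\<bar>x\<bar> ^ k * cmod (dtr 0 a x)) \<le> (1 + \<bar>x\<bar>) * (K1 + K2)"
        using add_mono[OF K(1)[of x] K(2)[of x]] by (simp add: algebra_simps)
      then show ?thesis by (subst (asm) mult_le_cancel_left_pos) auto
    qed
    then show "\<exists>C. \<forall>x. \<bar>x\<bar> ^ k * cmod (dtr 0 a x) \<le> C" by blast
  qed
qed

lemma dtr_rapid: "a \<in> schwartz \<Longrightarrow> rapid (dtr n a)"
proof (induction n arbitrary: a rule: less_induct)
  case (less m)
  show ?case
  proof (cases m)
    case 0
    then show ?thesis using dtr_rapid_0[OF less.prems] by simp
  next
    case (Suc n)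
    note a = less.prems
    let ?a = "\<lambda>s. \<i> * of_real s * a s"
    have sa: "?a \<in> schwartz" by (rule schwartz_is[OF a])
    show ?thesis unfolding Suc
    proof (rule rapid_divide[of 0])
      have eq: "of_real (x - 0) * dtr (Suc n) a x = of_real x * dtr n ?a x + of_nat n * dtr (n - 1) ?a x
      - of_real b * (dtr n a x - (-1) ^ n * dtr n a (- x)) - of_nat n * dtr n a x" for x
        using dtr_rel[OF a, of x n] by (simp add: algebra_simps)
      have "n < m" "n - 1 < m" using Suc by auto
      then show "rapid (\<lambda>x. of_real (x - 0) * dtr (Suc n) a x)"
        unfolding eq using a sa
        by (intro rapid_diff rapid_add rapid_cmult rapid_times_x rapid_reflect[of "dtr n a"] less.IH)
      show "continuous_on UNIV (dtr (Suc n) a)"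
        using dtr_deriv[OF a] by (meson continuous_at_imp_continuous_on has_vector_derivative_continuous)
    qed
  qed
qed

lemma dtr_schwartz:
  assumes "a \<in> schwartz" shows "dtr 0 a \<in> schwartz"
proof (rule schwartz_coinduct[where P = "range (\<lambda>n. dtr n a)"])
  fix h assume "h \<in> range (\<lambda>n. dtr n a)"
  then obtain n where n: "h = dtr n a" by blast
  then show "rapid h" using dtr_rapid[OF assms] by simp
  show "\<exists>h'\<in>range (\<lambda>n. dtr n a). \<forall>x. (h has_vector_derivative h' x) (at x)"
    using dtr_deriv[OF assms, of n] n by blast
qed simp

end

section \<open>The inversion formula\<close>

definition gauss :: "real \<Rightarrow> complex" where
  "gauss x = of_real (exp (- x\<^sup>2 / 2))"

lemma gauss_deriv: "(gauss has_vector_derivative - of_real x * gauss x) (at x)"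
proof -
  have "((\<lambda>x. exp (- x\<^sup>2 / 2)) has_real_derivative - x * exp (- x\<^sup>2 / 2)) (at x)"
    by (auto intro!: derivative_eq_intros)
  from bounded_linear.has_vector_derivative[OF bounded_linear_of_real this[unfolded has_real_derivative_iff_has_vector_derivative]]
  show ?thesis by (simp add: gauss_def[abs_def])
qed

lemma gauss_schwartz: "gauss \<in> schwartz"
proof -
  have "rapid gauss" unfolding rapid_def
  proof
    fix k
    have "\<bar>x\<bar> ^ k * cmod (gauss x) \<le> 1 + 2 ^ k * fact k" for x
    proof -
      have "(x\<^sup>2 / 2) ^ k * exp (- (x\<^sup>2 / 2)) \<le> fact k" by (rule power_mult_exp_le) simp
      then have 1: "\<bar>x\<bar> ^ (2 * k) * exp (- (x\<^sup>2 / 2)) \<le> 2 ^ k * fact k"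
        by (simp add: power_divide divide_simps mult_ac power_even_abs flip: power_mult)
      have "\<bar>x\<bar> ^ k \<le> 1 + \<bar>x\<bar> ^ (2 * k)"
      proof (cases "\<bar>x\<bar> \<le> 1")
        case True
        then have "\<bar>x\<bar> ^ k \<le> 1" by (intro power_le_one) auto
        moreover have "0 \<le> \<bar>x\<bar> ^ (2 * k)" by simp
        ultimately show ?thesis by linarith
      next
        case False
        then have "\<bar>x\<bar> ^ k \<le> \<bar>x\<bar> ^ (2 * k)" by (intro power_increasing) auto
        then show ?thesis by simp
      qed
      then have "\<bar>x\<bar> ^ k * exp (- (x\<^sup>2 / 2)) \<le> (1 + \<bar>x\<bar> ^ (2 * k)) * exp (- (x\<^sup>2 / 2))"
        by (intro mult_right_mono) auto
      also have "\<dots> = exp (- (x\<^sup>2 / 2)) + \<bar>x\<bar> ^ (2 * k) * exp (- (x\<^sup>2 / 2))" by (simp only: distrib_right mult_1)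
      also have "\<dots> \<le> 1 + 2 ^ k * fact k" using 1 by (intro add_mono) auto
      finally show ?thesis by (simp add: gauss_def)
    qed
    then show "\<exists>C. \<forall>x. \<bar>x\<bar> ^ k * cmod (gauss x) \<le> C" by blast
  qed
  show ?thesis
  proof (rule schwartz_coinduct[where P = "range (\<lambda>p x. poly p (of_real x) * gauss x)"])
    show "gauss \<in> range (\<lambda>p x. poly p (of_real x) * gauss x)"
      by (rule range_eqI[of _ _ 1]) simp
  next
    fix h assume "h \<in> range (\<lambda>p x. poly p (of_real x) * gauss x)"
    then obtain p where h: "h = (\<lambda>x. poly p (of_real x) * gauss x)" by blast
    have "rapid (\<lambda>x. poly p (of_real x) * gauss x)"
    proof (induction p)
      case 0
      show ?case by (auto simp: rapid_def intro: exI[of _ 0])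
    next
      case (pCons a p)
      have "rapid (\<lambda>x. a * gauss x + of_real x * (poly p (of_real x) * gauss x))"
        by (intro rapid_add rapid_cmult rapid_times_x pCons.IH \<open>rapid gauss\<close>)
      then show ?case by (simp add: algebra_simps)
    qed
    then show "rapid h" by (simp add: h)
    have "(h has_vector_derivative poly (pderiv p - [:0, 1:] * p) (of_real x) * gauss x) (at x)" for x
    proof -
      have "((\<lambda>x. of_real x :: complex) has_vector_derivative 1) (at x)"
        using bounded_linear.has_vector_derivative[OF bounded_linear_of_real has_vector_derivative_id] by simp
      from has_vector_derivative_mult[OF field_vector_diff_chain_at[OF this poly_DERIV[of p]] gauss_deriv]
      show ?thesis unfolding h by (simp add: o_def algebra_simps)
    qed
    then show "\<exists>h'\<in>range (\<lambda>p x. poly p (of_real x) * gauss x). \<forall>x. (h has_vector_derivative h' x) (at x)"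
      by (intro bexI[OF _ rangeI[of _ "pderiv p - [:0, 1:] * p"]] allI)
  qed
qed

lemma schwartz_cnj:
  assumes "g \<in> schwartz" shows "(\<lambda>x. cnj (g x)) \<in> schwartz"
proof (rule schwartz_coinduct[where P = "{\<lambda>x. cnj (g x) | g. g \<in> schwartz}"])
  fix f assume "f \<in> {\<lambda>x. cnj (g x) | g. g \<in> schwartz}"
  then obtain g where f: "f = (\<lambda>x. cnj (g x))" "g \<in> schwartz" by blast
  show "rapid f" by (rule rapid_growth[OF schwartz_rapid[OF f(2)], of _ 1 0]) (simp add: f)
  show "\<exists>h'\<in>{\<lambda>x. cnj (g x) | g. g \<in> schwartz}. \<forall>x. (f has_vector_derivative h' x) (at x)"
    unfolding f(1) using schwartz_vd[OF f(2)]
    by (intro bexI[of _ "\<lambda>x. cnj (vd g x)"])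
       (auto intro!: bounded_linear.has_vector_derivative[OF bounded_linear_cnj] schwartz_deriv f)
qed (use assms in blast)

lemma integrable_product_bound:
  fixes f :: "'a \<times> 'b \<Rightarrow> complex" and A :: "'a \<Rightarrow> real" and B :: "'b \<Rightarrow> real"
  assumes M: "sigma_finite_measure M1" "sigma_finite_measure M2"
    and f: "f \<in> borel_measurable (M1 \<Otimes>\<^sub>M M2)"
    and AB: "integrable M1 A" "integrable M2 B"
    and bound: "\<And>x y. cmod (f (x, y)) \<le> A x * B y"
  shows "integrable (M1 \<Otimes>\<^sub>M M2) f"
proof -
  interpret pair_sigma_finite M1 M2 using M by (simp add: pair_sigma_finite_def)
  have [measurable]: "A \<in> borel_measurable M1" "B \<in> borel_measurable M2"
    using AB by auto
  have "integrable (M1 \<Otimes>\<^sub>M M2) (\<lambda>(x, y). A x * B y)"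
  proof (rule Fubini_integrable)
    have "(\<lambda>x. \<integral>y. norm (case (x, y) of (x, y) \<Rightarrow> A x * B y) \<partial>M2) = (\<lambda>x. \<bar>A x\<bar> * (\<integral>y. \<bar>B y\<bar> \<partial>M2))"
      by (simp add: abs_mult)
    then show "integrable M1 (\<lambda>x. \<integral>y. norm (case (x, y) of (x, y) \<Rightarrow> A x * B y) \<partial>M2)"
      using AB by auto
  qed (use AB in auto)
  then show ?thesis
    by (rule Bochner_Integration.integrable_bound[OF _ f])
       (auto intro!: AE_I2 order_trans[OF bound])
qed

context dunkl
begin

lemma dtr_add:
  assumes "g \<in> schwartz" "h \<in> schwartz"
  shows "dtr 0 (\<lambda>s. g s + h s) x = dtr 0 g x + dtr 0 h x"
  unfolding dtr_def using assms
  by (simp add: distrib_left Bochner_Integration.integral_add dline_integrable)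

lemma dtr_cmult: "dtr 0 (\<lambda>s. c * g s) x = c * dtr 0 g x"
  unfolding dtr_def by (simp add: mult.left_commute)

lemma dtr_diff:
  assumes "g \<in> schwartz" "h \<in> schwartz"
  shows "dtr 0 (\<lambda>s. g s - h s) x = dtr 0 g x - dtr 0 h x"
  using dtr_add[OF assms(1) schwartz_cmult[OF assms(2), of "-1"]] dtr_cmult[of "-1" h] by simp

lemma dtr_reflect:
  assumes "a \<in> schwartz" shows "dtr 0 (\<lambda>s. a (- s)) x = dtr 0 a (- x)"
proof -
  have "(\<integral>s. dline 0 (- x) (- s) * a (- s) \<partial>wmeas) = (\<integral>s. dline 0 (- x) s * a s \<partial>wmeas)"
    by (rule integral_wmeas_reflect)
       (intro borel_measurable_continuous_onI continuous_intros schwartz_continuous assms)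
  then show ?thesis by (simp add: dtr_def dline_def)
qed

text \<open>The integral of the Gaussian against the weight, which is the eigenvalue of the transform on the
  Gaussian.\<close>

definition dconst :: real where "dconst = 2 powr (b + 1/2) * Gamma (b + 1/2)"

text \<open>The substitution \<open>t = y\<^sup>2 / 2\<close> in the Euler integral of \<open>\<Gamma>(b + 1/2)\<close>.\<close>

lemma gauss_integral: "(\<integral>s. gauss s \<partial>wmeas) = of_real dconst"
proof -
  define e where "e y = y powr (2 * b) * exp (- y\<^sup>2 / 2)" for y :: real
  define f where "f t = t powr (b - 1/2) / exp t" for t :: real
  define c where "c = (2::real) powr (1/2 - b)"
  have f: "f absolutely_integrable_on {0<..}" "integral {0<..} f = Gamma (b + 1/2)"
  proof -
    have "((\<lambda>t. t powr ((b + 1/2) - 1) / exp t) has_integral Gamma (b + 1/2)) {0..}"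
      by (rule Gamma_integral_real) (use b_gt in simp)
    then have "(f has_integral Gamma (b + 1/2)) {0..}" by (simp add: f_def[abs_def])
    then have "(f has_integral Gamma (b + 1/2)) {0<..}"
    proof (rule has_integral_spike_set_eq[THEN iffD1, rotated -1])
      have "{x \<in> {0..} - {0<..}. f x \<noteq> 0} \<subseteq> {0}" by auto
      then show "negligible {x \<in> {0..} - {0<..}. f x \<noteq> 0}" using negligible_sing negligible_subset by blast
      have "{x \<in> {0<..} - {0..}. f x \<noteq> 0} = {}" by auto
      then show "negligible {x \<in> {0<..} - {0..}. f x \<noteq> 0}" by (simp only: negligible_empty)
    qed
    then show "f absolutely_integrable_on {0<..}" "integral {0<..} f = Gamma (b + 1/2)"
      by (auto simp: has_integral_iff f_def intro!: nonnegative_absolutely_integrable_1)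
  qed
  have img: "(\<lambda>y::real. y\<^sup>2 / 2) ` {0<..} = {0<..}"
  proof (intro equalityI subsetI)
    fix t :: real assume "t \<in> {0<..}"
    then show "t \<in> (\<lambda>y. y\<^sup>2 / 2) ` {0<..}" by (intro image_eqI[of _ _ "sqrt (2 * t)"]) auto
  qed auto
  have "(\<lambda>y. \<bar>y\<bar> * f (y\<^sup>2 / 2)) absolutely_integrable_on {0<..} \<and>
      integral {0<..} (\<lambda>y. \<bar>y\<bar> * f (y\<^sup>2 / 2)) = Gamma (b + 1/2)"
    using f by (subst has_absolute_integral_change_of_variables_1')
      (auto intro!: derivative_eq_intros inj_onI simp: img)
  moreover have eq: "\<bar>y\<bar> * f (y\<^sup>2 / 2) = c * e y" if "y \<in> {0<..}" for y
  proof -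
    define \<beta> where "\<beta> = b - 1/2"
    have y: "y > 0" using that by simp
    have c: "c = inverse (2 powr \<beta>)" unfolding c_def \<beta>_def by (simp flip: powr_minus)
    have "(y\<^sup>2 / 2) powr \<beta> = (y\<^sup>2) powr \<beta> / 2 powr \<beta>" using y by (simp add: powr_divide)
    also have "(y\<^sup>2) powr \<beta> = (y powr 2) powr \<beta>" using y by simp
    also have "\<dots> = y powr (2 * \<beta>)" by (rule powr_powr)
    finally have 1: "(y\<^sup>2 / 2) powr \<beta> = y powr (2 * \<beta>) * c"
      unfolding c by (simp only: divide_inverse)
    have 2: "y * y powr (2 * \<beta>) = y powr (2 * b)"
      using y powr_add[of y 1 "2 * \<beta>"] by (simp add: \<beta>_def)
    have 3: "exp (- y\<^sup>2 / 2) = inverse (exp (y\<^sup>2 / 2))" by (simp flip: exp_minus)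
    have "\<bar>y\<bar> * f (y\<^sup>2 / 2) = (y * y powr (2 * \<beta>)) * c * inverse (exp (y\<^sup>2 / 2))"
    proof -
      have f: "f t = t powr \<beta> * inverse (exp t)" for t by (simp only: f_def \<beta>_def divide_inverse)
      show ?thesis unfolding f 1 using y by (simp only: abs_of_pos mult_ac)
    qed
    then show ?thesis unfolding 2 e_def 3 by (simp only: mult_ac)
  qed
  moreover have "((\<lambda>y. \<bar>y\<bar> * f (y\<^sup>2 / 2)) absolutely_integrable_on {0<..})
      = ((\<lambda>y. c * e y) absolutely_integrable_on {0<..})"
    by (rule set_integrable_cong[OF refl refl eq])
  moreover have "integral {0<..} (\<lambda>y. \<bar>y\<bar> * f (y\<^sup>2 / 2)) = integral {0<..} (\<lambda>y. c * e y)"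
    by (rule Henstock_Kurzweil_Integration.integral_cong) (rule eq)
  ultimately have ce: "(\<lambda>y. c * e y) absolutely_integrable_on {0<..}" "integral {0<..} (\<lambda>y. c * e y) = Gamma (b + 1/2)"
    by simp_all
  have em: "(\<lambda>y. indicator {0<..} y *\<^sub>R (c * e y)) \<in> borel_measurable lborel" unfolding e_def by measurable
  have 1: "(\<integral>y. indicator {0<..} y *\<^sub>R (c * e y) \<partial>lborel) = Gamma (b + 1/2)"
  proof -
    have "(LINT y:{0<..}|lebesgue. c * e y) = Gamma (b + 1/2)"
      unfolding set_lebesgue_integral_eq_integral(2)[OF ce(1)] by (rule ce(2))
    then show ?thesis unfolding set_lebesgue_integral_def integral_completion[OF em] .
  qed
  have cp: "c > 0" by (simp add: c_def)
  have 2: "(\<integral>y. indicator {0<..} y *\<^sub>R e y \<partial>lborel) = Gamma (b + 1/2) / c"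
  proof -
    have "(\<integral>y. indicator {0<..} y *\<^sub>R (c * e y) \<partial>lborel) = (\<integral>y. c * (indicator {0<..} y *\<^sub>R e y) \<partial>lborel)"
      by (simp add: mult_ac)
    then show ?thesis using 1 cp by (simp add: field_simps)
  qed
  have "(\<integral>s. gauss s \<partial>wmeas) = (\<integral>y. (\<bar>y\<bar> powr (2 * b)) *\<^sub>R gauss y \<partial>lborel)"
    by (rule integral_wmeas[OF schwartz_measurable[OF gauss_schwartz]])
  also have "\<dots> = (\<integral>y. indicator {0<..} y *\<^sub>R ((\<bar>y\<bar> powr (2 * b)) *\<^sub>R gauss y + (\<bar>- y\<bar> powr (2 * b)) *\<^sub>R gauss (- y)) \<partial>lborel)"
    using rapid_integrable[OF schwartz_measurable[OF gauss_schwartz] schwartz_rapid[OF gauss_schwartz]]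
    unfolding integrable_wmeas[OF schwartz_measurable[OF gauss_schwartz]]
    by (rule integral_fold_halfline)
  also have "\<dots> = (\<integral>y. of_real (2 * (indicator {0<..} y *\<^sub>R e y)) \<partial>lborel)"
    by (intro Bochner_Integration.integral_cong) (auto simp: indicator_def gauss_def e_def scaleR_conv_of_real)
  also have "\<dots> = of_real (\<integral>y. 2 * (indicator {0<..} y *\<^sub>R e y) \<partial>lborel)" by (rule integral_complex_of_real)
  also have "(\<integral>y. 2 * (indicator {0<..} y *\<^sub>R e y) \<partial>lborel) = 2 * (Gamma (b + 1/2) / c)"
    by (simp only: integral_mult_right_zero 2)
  also have "\<dots> = dconst"
  proof -
    have "inverse c = 2 powr (b - 1/2)" unfolding c_def by (simp flip: powr_minus)
    then have "2 * inverse c = 2 powr (1 + (b - 1/2))" by (simp only: powr_mult_base[of 2, symmetric])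
    also have "1 + (b - 1/2) = b + 1/2" by simp
    finally have *: "2 * inverse c = 2 powr (b + 1/2)" .
    have "2 * (Gamma (b + 1/2) / c) = (2 * inverse c) * Gamma (b + 1/2)"
      unfolding divide_inverse[of _ c] by (simp only: mult_ac)
    then show ?thesis unfolding * dconst_def .
  qed
  finally show ?thesis .
qed

lemma dconst_pos: "dconst > 0"
  using b_gt by (simp add: dconst_def Gamma_real_pos)

text \<open>The Gaussian is determined up to a factor by the equation \<open>T \<gamma> = - x \<gamma>\<close>, which the transform
  turns into itself.\<close>

lemma dtr_gauss: "dtr 0 gauss x = of_real dconst * gauss x"
proof -
  define h where "h = dtr 0 gauss"
  have hS: "h \<in> schwartz" unfolding h_def by (rule dtr_schwartz[OF gauss_schwartz])
  have even: "h (- x) = h x" for x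
  proof -
    have "(\<lambda>s. gauss (- s)) = gauss" by (simp add: gauss_def fun_eq_iff)
    then show ?thesis using dtr_reflect[OF gauss_schwartz, of x] by (simp add: h_def)
  qed
  have vdg: "vd gauss = (\<lambda>x. - of_real x * gauss x)" by (rule vdI) (rule gauss_deriv)
  have ig: "(\<lambda>x. (-1) * (of_real x * gauss x)) \<in> schwartz"
    by (intro schwartz_cmult schwartz_times_x gauss_schwartz)
  have "dunkl_rel gauss (\<lambda>x. (-1) * (of_real x * gauss x))"
    by (simp add: dunkl_rel_def vdg gauss_def)
  from dtr_of_rel[OF gauss_schwartz ig this]
  have 1: "dtr 0 (\<lambda>s. of_real s * gauss s) x = \<i> * of_real x * h x" for x
    unfolding dtr_cmult h_def by simp
  have "dtr 0 (\<lambda>s. \<i> * (of_real s * gauss s)) x = - (of_real x * h x)" for x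
    unfolding dtr_cmult 1 by (simp add: mult.assoc)
  then have 2: "dtr 0 (\<lambda>s. \<i> * of_real s * gauss s) x = - (of_real x * h x)" for x
    by (simp add: mult.assoc)
  have vdh: "vd h x = - of_real x * h x" for x
  proof (cases "x = 0")
    case False
    have "of_real x * dtr 0 (\<lambda>s. \<i> * of_real s * gauss s) x = of_real x * vd h x"
      using dunkl_relD[OF dtr_dunkl_rel[OF gauss_schwartz], of x] even[of x] by (simp add: h_def)
    then have "of_real x * vd h x = of_real x * (- of_real x * h x)" unfolding 2 by simp
    then show ?thesis using False by (subst (asm) mult_cancel_left) simp
  next
    case True
    have "(uminus has_vector_derivative (-1::real)) (at 0)"
      using has_vector_derivative_minus[OF has_vector_derivative_id[of "at 0"]] by simp
    from vector_diff_chain_at[OF this schwartz_deriv[OF hS]]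
    have "(h has_vector_derivative - vd h 0) (at 0)" by (simp add: o_def even)
    from vector_derivative_unique_at[OF this schwartz_deriv[OF hS]]
    show ?thesis using True by (simp add: eq_neg_iff_add_eq_0)
  qed
  define r where "r x = h x * of_real (exp (x\<^sup>2 / 2))" for x
  have "(r has_vector_derivative 0) (at x within UNIV)" for x
  proof -
    have "((\<lambda>x. exp (x\<^sup>2 / 2)) has_real_derivative x * exp (x\<^sup>2 / 2)) (at x)"
      by (auto intro!: derivative_eq_intros)
    from bounded_linear.has_vector_derivative[OF bounded_linear_of_real this[unfolded has_real_derivative_iff_has_vector_derivative]]
    have "((\<lambda>x. of_real (exp (x\<^sup>2 / 2)) :: complex) has_vector_derivative of_real (x * exp (x\<^sup>2 / 2))) (at x)" .
    from has_vector_derivative_mult[OF schwartz_deriv[OF hS] this]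
    show ?thesis by (simp add: r_def[abs_def] vdh)
  qed
  then obtain c where c: "\<And>x. r x = c"
    using has_vector_derivative_zero_constant[of UNIV r] by auto
  have "h 0 = of_real dconst"
    unfolding h_def dtr_def gauss_integral[symmetric] by (simp add: dline_def)
  then have "c = of_real dconst" using c[of 0] by (simp add: r_def)
  then have "r x = of_real dconst" using c by simp
  then have "r x * gauss x = of_real dconst * gauss x" by simp
  moreover have "r x * gauss x = h x * of_real (exp (x\<^sup>2 / 2) * exp (- x\<^sup>2 / 2))"
    by (simp only: r_def gauss_def of_real_mult mult.assoc)
  moreover have "exp (x\<^sup>2 / 2) * exp (- x\<^sup>2 / 2) = 1" by (simp flip: exp_add)
  ultimately have "h x * of_real 1 = of_real dconst * gauss x" by (simp only:)
  then show ?thesis by (simp add: h_def)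
qed

text \<open>Up to a reflection, the square of the transform commutes with multiplication by \<open>x\<close>.  Hence its
  value at \<open>a\<close> depends only on the value of the function at \<open>a\<close>: a Schwartz function that vanishes
  there is \<open>x - a\<close> times another one.  The factor is found by testing on the Gaussian.\<close>

lemma dtr_inversion:
  assumes g: "g \<in> schwartz"
  shows "dtr 0 (dtr 0 g) (- a) = of_real (dconst\<^sup>2) * g a"
proof -
  define c where "c = g a / gauss a"
  have ga: "gauss a \<noteq> 0" by (simp add: gauss_def)
  define G where "G s = g s - c * gauss s" for s
  have G: "G \<in> schwartz" unfolding G_def by (intro schwartz_diff schwartz_cmult g gauss_schwartz)
  have "G a = 0" using ga by (simp add: G_def c_def)
  with G obtain k where k: "k \<in> schwartz" "\<And>s. G s = of_real (s - a) * k s"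
    using schwartz_divide[of G a] by blast
  have GE: "G = (\<lambda>s. (- \<i>) * (\<i> * of_real s * k s) - of_real a * k s)" using k(2) by (simp add: fun_eq_iff algebra_simps)
  have ik: "(\<lambda>s. \<i> * of_real s * k s) \<in> schwartz" by (rule schwartz_is[OF k(1)])
  have Gh: "dtr 0 G = (\<lambda>x. (- \<i>) * dtr 0 (\<lambda>s. \<i> * of_real s * k s) x - of_real a * dtr 0 k x)"
    unfolding GE by (rule ext) (simp only: dtr_diff[OF schwartz_cmult[OF ik] schwartz_cmult[OF k(1)]] dtr_cmult)
  have "dtr 0 (dtr 0 G) (- a) = (- \<i>) * dtr 0 (dtr 0 (\<lambda>s. \<i> * of_real s * k s)) (- a) - of_real a * dtr 0 (dtr 0 k) (- a)"
    unfolding Gh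
    by (simp only: dtr_diff[OF schwartz_cmult[OF dtr_schwartz[OF ik]] schwartz_cmult[OF dtr_schwartz[OF k(1)]]] dtr_cmult)
  also have "dtr 0 (dtr 0 (\<lambda>s. \<i> * of_real s * k s)) (- a) = - \<i> * of_real (- a) * dtr 0 (dtr 0 k) (- a)"
    by (rule dtr_of_rel[OF dtr_schwartz[OF k(1)] dtr_schwartz[OF ik] dtr_dunkl_rel[OF k(1)]])
  finally have 0: "dtr 0 (dtr 0 G) (- a) = 0" by (simp add: mult.assoc)
  have gE: "g = (\<lambda>s. G s + c * gauss s)" by (simp add: G_def)
  have gauss2: "dtr 0 gauss = (\<lambda>x. of_real dconst * gauss x)" using dtr_gauss by blast
  have "dtr 0 g = (\<lambda>x. dtr 0 G x + c * (of_real dconst * gauss x))"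
    by (subst gE, rule ext) (simp only: dtr_add[OF G schwartz_cmult[OF gauss_schwartz]] dtr_cmult gauss2)
  then have "dtr 0 (dtr 0 g) (- a) = dtr 0 (dtr 0 G) (- a) + c * (of_real dconst * (of_real dconst * gauss (- a)))"
    by (simp only: dtr_add[OF dtr_schwartz[OF G] schwartz_cmult[OF schwartz_cmult[OF gauss_schwartz]]] dtr_cmult gauss2)
  also have "gauss (- a) = gauss a" by (simp add: gauss_def)
  finally show ?thesis using ga by (simp add: 0 c_def power2_eq_square)
qed

lemma dtr_symmetric:
  assumes a: "a \<in> schwartz" and m: "m \<in> schwartz"
  shows "(\<integral>x. dtr 0 a x * m x \<partial>wmeas) = (\<integral>s. a s * dtr 0 m s \<partial>wmeas)"
proof -
  interpret pair_sigma_finite wmeas wmeas by (simp add: pair_sigma_finite_def sigma_finite_wmeas)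
  obtain C where C: "C \<ge> 0" "\<And>x y. cmod (dline 0 x y) \<le> C * (1 + \<bar>x\<bar>) * (1 + \<bar>y\<bar>)"
    using dline_bound by blast
  have int: "integrable wmeas (\<lambda>s. (1 + \<bar>s\<bar>) * cmod (a s))" if "a \<in> schwartz" for a
  proof -
    have "integrable wmeas (\<lambda>s. cmod (a s) + cmod (of_real s * a s))"
      using that by (intro Bochner_Integration.integrable_add integrable_norm rapid_integrable
        schwartz_measurable schwartz_rapid schwartz_times_x)
    then show ?thesis by (simp add: norm_mult distrib_right)
  qed
  have f: "integrable (wmeas \<Otimes>\<^sub>M wmeas) (\<lambda>(x, s). dline 0 x s * a s * m x)"
  proof (rule integrable_product_bound[OF sigma_finite_wmeas sigma_finite_wmeas])
    have "continuous_on UNIV (\<lambda>p::real \<times> real. dline 0 (fst p) (snd p) * a (snd p) * m (fst p))"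
      by (intro continuous_intros continuous_on_compose2[OF schwartz_continuous[OF a, of UNIV]]
          continuous_on_compose2[OF schwartz_continuous[OF m, of UNIV]]) auto
    then have "(\<lambda>p::real \<times> real. dline 0 (fst p) (snd p) * a (snd p) * m (fst p)) \<in> borel_measurable (borel \<Otimes>\<^sub>M borel)"
      unfolding borel_prod by (rule borel_measurable_continuous_onI)
    moreover have "borel_measurable (wmeas \<Otimes>\<^sub>M wmeas) = (borel_measurable (borel \<Otimes>\<^sub>M borel) :: (real \<times> real \<Rightarrow> complex) set)"
      by (intro measurable_cong_sets sets_pair_measure_cong) auto
    ultimately show "(\<lambda>(x, s). dline 0 x s * a s * m x) \<in> borel_measurable (wmeas \<Otimes>\<^sub>M wmeas)"
      by (simp add: case_prod_beta)
    show "integrable wmeas (\<lambda>x. C * ((1 + \<bar>x\<bar>) * cmod (m x)))" by (intro integrable_mult_right int m)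
    show "integrable wmeas (\<lambda>s. (1 + \<bar>s\<bar>) * cmod (a s))" by (rule int[OF a])
    show "cmod (case (x, s) of (x, s) \<Rightarrow> dline 0 x s * a s * m x) \<le> C * ((1 + \<bar>x\<bar>) * cmod (m x)) * ((1 + \<bar>s\<bar>) * cmod (a s))" for x s
      using mult_right_mono[OF C(2)[of x s], of "cmod (a s) * cmod (m x)"] by (simp add: norm_mult mult_ac)
  qed
  have "(\<integral>x. dtr 0 a x * m x \<partial>wmeas) = (\<integral>x. (\<integral>s. dline 0 x s * a s * m x \<partial>wmeas) \<partial>wmeas)"
    unfolding dtr_def by simp
  also have "\<dots> = (\<integral>s. (\<integral>x. dline 0 x s * a s * m x \<partial>wmeas) \<partial>wmeas)"
    by (rule Fubini_integral[OF f, symmetric])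
  also have "\<dots> = (\<integral>s. a s * dtr 0 m s \<partial>wmeas)"
  proof (rule Bochner_Integration.integral_cong[OF refl])
    fix s
    have "(\<integral>x. dline 0 x s * a s * m x \<partial>wmeas) = (\<integral>x. a s * (dline 0 s x * m x) \<partial>wmeas)"
      by (simp add: dline_def mult_ac)
    then show "(\<integral>x. dline 0 x s * a s * m x \<partial>wmeas) = a s * dtr 0 m s"
      by (simp add: dtr_def)
  qed
  finally show ?thesis .
qed

lemma dline_cnj: "cnj (dline 0 x y) = dline 0 (- x) y"
  by (simp add: dline_def dk_cnj[symmetric])

text \<open>By symmetry of the kernel the square of the norm is the pairing of \<open>a\<close> with the transform of
  the conjugate of \<open>dtr 0 a\<close>, and this transform is given by the inversion formula.\<close>

lemma dtr_plancherel:
  assumes a: "a \<in> schwartz"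
  shows "(\<integral>x. (cmod (dtr 0 a x))\<^sup>2 \<partial>wmeas) = dconst\<^sup>2 * (\<integral>s. (cmod (a s))\<^sup>2 \<partial>wmeas)"
proof -
  define m where "m x = cnj (dtr 0 a x)" for x
  have m: "m \<in> schwartz" unfolding m_def by (intro schwartz_cnj dtr_schwartz a)
  have "dtr 0 m s = cnj (dtr 0 (dtr 0 a) (- s))" for s
  proof -
    have "cnj (dtr 0 (dtr 0 a) (- s)) = (\<integral>x. cnj (dline 0 (- s) x * ((\<i> * of_real x) ^ 0 * dtr 0 a x)) \<partial>wmeas)"
      unfolding dtr_def[of 0 "dtr 0 a"] by (rule Bochner_Integration.integral_cnj[symmetric])
    then show ?thesis by (simp add: dtr_def[of 0 m] m_def dline_cnj)
  qed
  then have dm: "dtr 0 m s = of_real (dconst\<^sup>2) * cnj (a s)" for s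
    unfolding dtr_inversion[OF a] by simp
  have "of_real (\<integral>x. (cmod (dtr 0 a x))\<^sup>2 \<partial>wmeas) = (\<integral>x. dtr 0 a x * m x \<partial>wmeas)"
    unfolding integral_complex_of_real[symmetric] m_def complex_norm_square ..
  also have "\<dots> = (\<integral>s. a s * dtr 0 m s \<partial>wmeas)" by (rule dtr_symmetric[OF a m])
  also have "\<dots> = (\<integral>s. of_real (dconst\<^sup>2 * (cmod (a s))\<^sup>2) \<partial>wmeas)"
    unfolding dm of_real_mult complex_norm_square by (simp add: mult_ac)
  also have "\<dots> = of_real (\<integral>s. dconst\<^sup>2 * (cmod (a s))\<^sup>2 \<partial>wmeas)" by (rule integral_complex_of_real)
  finally have "(\<integral>x. (cmod (dtr 0 a x))\<^sup>2 \<partial>wmeas) = (\<integral>s. dconst\<^sup>2 * (cmod (a s))\<^sup>2 \<partial>wmeas)"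
    by (simp only: of_real_eq_iff)
  then show ?thesis by simp
qed

end

section \<open>Uniqueness of the evolution\<close>

lemma L2D: "f \<in> L2 \<Longrightarrow> f \<in> borel_measurable borel" "f \<in> L2 \<Longrightarrow> integrable lborel (\<lambda>x. (cmod (f x))\<^sup>2)"
  by (auto simp: L2_def)

lemma L2_norm_nonneg [simp]: "L2_norm f \<ge> 0"
  by (simp add: L2_norm_def)

lemma L2_norm_sq: "(L2_norm f)\<^sup>2 = (\<integral>x. (cmod (f x))\<^sup>2 \<partial>lborel)"
  by (simp add: L2_norm_def)

text \<open>Integrated and optimized over the weight \<open>r\<close> this gives Minkowski's inequality.\<close>

lemma norm_add_sq_weighted:
  fixes x y :: complex
  assumes "r > 0"
  shows "(cmod (x + y))\<^sup>2 \<le> (1 + r) * (cmod x)\<^sup>2 + (1 + 1 / r) * (cmod y)\<^sup>2"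
proof -
  have "(cmod (x + y))\<^sup>2 \<le> (cmod x + cmod y)\<^sup>2" by (intro power_mono norm_triangle_ineq) auto
  also have "\<dots> = (cmod x)\<^sup>2 + (cmod y)\<^sup>2 + 2 * (cmod x * cmod y)"
    by (simp add: power2_eq_square algebra_simps)
  also have "2 * (cmod x * cmod y) \<le> r * (cmod x)\<^sup>2 + (1 / r) * (cmod y)\<^sup>2"
  proof -
    have "0 \<le> (r * cmod x - cmod y)\<^sup>2 / r" using assms by simp
    also have "\<dots> = r * (cmod x)\<^sup>2 + (1 / r) * (cmod y)\<^sup>2 - 2 * (cmod x * cmod y)"
      using assms by (simp add: power2_eq_square field_simps)
    finally show ?thesis by simp
  qed
  finally show ?thesis by (simp add: distrib_right)
qed

lemma L2_lincomb:
  assumes "f \<in> L2" "g \<in> L2" shows "(\<lambda>x. a * f x + c * g x) \<in> L2"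
  unfolding L2_def
proof (intro CollectI conjI)
  have [measurable]: "f \<in> borel_measurable borel" "g \<in> borel_measurable borel" using assms by (auto dest: L2D)
  show "(\<lambda>x. a * f x + c * g x) \<in> borel_measurable lborel" by simp
  show "integrable lborel (\<lambda>x. (cmod (a * f x + c * g x))\<^sup>2)"
  proof (rule Bochner_Integration.integrable_bound)
    show "integrable lborel (\<lambda>x. (1 + 1) * ((cmod a)\<^sup>2 * (cmod (f x))\<^sup>2) + (1 + 1 / 1) * ((cmod c)\<^sup>2 * (cmod (g x))\<^sup>2))"
      using assms by (intro Bochner_Integration.integrable_add integrable_mult_right L2D)
    show "AE x in lborel. norm ((cmod (a * f x + c * g x))\<^sup>2)
       \<le> norm ((1 + 1) * ((cmod a)\<^sup>2 * (cmod (f x))\<^sup>2) + (1 + 1 / 1) * ((cmod c)\<^sup>2 * (cmod (g x))\<^sup>2))"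
      using norm_add_sq_weighted[of 1 "a * f _" "c * g _"]
      by (intro AE_I2) (simp add: norm_mult power_mult_distrib)
  qed simp
qed

lemma L2_diff: "f \<in> L2 \<Longrightarrow> g \<in> L2 \<Longrightarrow> (\<lambda>x. f x - g x) \<in> L2"
  using L2_lincomb[of f g 1 "-1"] by simp

lemma L2_add: "f \<in> L2 \<Longrightarrow> g \<in> L2 \<Longrightarrow> (\<lambda>x. f x + g x) \<in> L2"
  using L2_lincomb[of f g 1 1] by simp

lemma L2_cmult: "f \<in> L2 \<Longrightarrow> (\<lambda>x. c * f x) \<in> L2"
  using L2_lincomb[of f f c 0] by simp

lemma L2_norm_cong:
  assumes "f \<in> L2" "g \<in> L2" "L2_eq f g" shows "L2_norm f = L2_norm g"
proof -
  have [measurable]: "f \<in> borel_measurable borel" "g \<in> borel_measurable borel" using assms by (auto dest: L2D)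
  have "(\<integral>x. (cmod (f x))\<^sup>2 \<partial>lborel) = (\<integral>x. (cmod (g x))\<^sup>2 \<partial>lborel)"
    using assms(3) unfolding L2_eq_def by (intro integral_cong_AE) auto
  then show ?thesis by (simp add: L2_norm_def)
qed

lemma L2_norm_cmult: "L2_norm (\<lambda>x. c * f x) = cmod c * L2_norm f"
  by (simp add: L2_norm_def norm_mult power_mult_distrib real_sqrt_mult)

lemma L2_norm_AE_zero:
  assumes "AE x in lborel. f x = 0" shows "L2_norm f = 0"
proof -
  have "(\<integral>x. (cmod (f x))\<^sup>2 \<partial>lborel) = 0"
    using assms by (intro integral_eq_zero_AE) auto
  then show ?thesis by (simp add: L2_norm_def)
qed

lemma L2_norm_eq_0D:
  assumes "f \<in> L2" "L2_norm f = 0" shows "AE x in lborel. f x = 0"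
proof -
  have "(\<integral>x. (cmod (f x))\<^sup>2 \<partial>lborel) = 0" using assms(2) by (simp add: L2_norm_def)
  then have "AE x in lborel. (cmod (f x))\<^sup>2 = 0"
    by (subst (asm) integral_nonneg_eq_0_iff_AE) (use L2D(2)[OF assms(1)] in auto)
  then show ?thesis by eventually_elim simp
qed

lemma L2_triangle:
  assumes f: "f \<in> L2" and g: "g \<in> L2"
  shows "L2_norm (\<lambda>x. f x + g x) \<le> L2_norm f + L2_norm g"
proof (rule field_le_epsilon)
  fix e :: real assume e: "e > 0"
  \<comment> \<open>the optimal weight is the quotient of the norms; \<open>e\<close> keeps both of them positive\<close>
  define p q where "p = L2_norm f + e / 2" and "q = L2_norm g + e / 2"
  have pq: "p > 0" "q > 0" "L2_norm f \<le> p" "L2_norm g \<le> q"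
    using e by (auto simp: p_def q_def intro: add_nonneg_pos)
  define l where "l = q / p"
  have l: "l > 0" using pq by (simp add: l_def)
  have "(L2_norm (\<lambda>x. f x + g x))\<^sup>2 \<le> (\<integral>x. (1 + l) * (cmod (f x))\<^sup>2 + (1 + 1 / l) * (cmod (g x))\<^sup>2 \<partial>lborel)"
    unfolding L2_norm_sq
    by (intro integral_mono L2D(2) L2_add f g Bochner_Integration.integrable_add integrable_mult_right
        norm_add_sq_weighted l)
  also have "\<dots> = (1 + l) * (L2_norm f)\<^sup>2 + (1 + 1 / l) * (L2_norm g)\<^sup>2"
    unfolding L2_norm_sq using L2D(2)[OF f] L2D(2)[OF g] by (subst Bochner_Integration.integral_add) auto
  also have "\<dots> \<le> (1 + l) * p\<^sup>2 + (1 + 1 / l) * q\<^sup>2"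
    using l pq by (intro add_mono mult_left_mono power_mono) auto
  also have "\<dots> = (p + q)\<^sup>2" using pq by (simp add: l_def power2_eq_square field_simps)
  finally have "L2_norm (\<lambda>x. f x + g x) \<le> p + q" by (rule power2_le_imp_le) (use pq in auto)
  then show "L2_norm (\<lambda>x. f x + g x) \<le> L2_norm f + L2_norm g + e" by (simp add: p_def q_def)
qed

lemma L2_norm_minus_commute: "L2_norm (\<lambda>x. f x - g x) = L2_norm (\<lambda>x. g x - f x)"
  by (simp add: L2_norm_def norm_minus_commute)

lemma L2_triangle_diff:
  assumes "f \<in> L2" "g \<in> L2"
  shows "L2_norm (\<lambda>x. f x - g x) \<le> L2_norm f + L2_norm g"
  using L2_triangle[OF assms(1) L2_cmult[OF assms(2), of "-1"]] L2_norm_cmult[of "-1" g] by simp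

lemma L2_reverse_triangle:
  assumes "f \<in> L2" "g \<in> L2" "h \<in> L2"
  shows "\<bar>L2_norm (\<lambda>x. f x - h x) - L2_norm (\<lambda>x. g x - h x)\<bar> \<le> L2_norm (\<lambda>x. f x - g x)"
  using L2_triangle[OF L2_diff[OF assms(1,2)] L2_diff[OF assms(2,3)]]
    L2_triangle[OF L2_diff[OF assms(2,1)] L2_diff[OF assms(1,3)]] L2_norm_minus_commute[of f g]
  by simp

text \<open>The distance between \<open>v t\<close> and \<open>U t (v 0)\<close> is constant, because it changes by \<open>o(h)\<close> between
  \<open>t\<close> and \<open>t + h\<close>: by unitarity it may be measured after applying \<open>U h\<close>, and both \<open>v (t + h)\<close> and
  \<open>U h (v t)\<close> are \<open>v t + h w t + o(h)\<close>.\<close>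

lemma unitary_group_unique:
  assumes U: "unitary_group U"
    and v: "\<And>t. v t \<in> L2" and gen: "\<And>t. (v t, w t) \<in> generator U"
    and der: "\<And>t. ((\<lambda>h. L2_norm (\<lambda>x. (v (t + h) x - v t x) / of_real h - w t x)) \<longlongrightarrow> 0) (at 0)"
  shows "L2_eq (U t (v 0)) (v t)"
proof -
  have UL2: "U t f \<in> L2" if "f \<in> L2" for t f using U that unfolding unitary_group_def unitary_L2_def by blast
  have Unorm: "L2_norm (U t f) = L2_norm f" if "f \<in> L2" for t f
    using U that unfolding unitary_group_def unitary_L2_def by blast
  have Ulin: "L2_eq (U t (\<lambda>x. a * f x + c * g x)) (\<lambda>x. a * U t f x + c * U t g x)"
    if "f \<in> L2" "g \<in> L2" for t f g a c using U that unfolding unitary_group_def unitary_L2_def by blast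
  have Uadd: "L2_eq (U (s + t) f) (U s (U t f))" if "f \<in> L2" for s t f
    using U that unfolding unitary_group_def by blast
  have U0: "L2_eq (U 0 f) f" if "f \<in> L2" for f using U that unfolding unitary_group_def by blast
  have w: "w t \<in> L2" for t using gen[of t] by (simp add: generator_def)
  define N where "N t = L2_norm (\<lambda>x. v t x - U t (v 0) x)" for t
  have step: "\<bar>N (t + h) - N t\<bar> \<le> \<bar>h\<bar> * (L2_norm (\<lambda>x. (v (t + h) x - v t x) / of_real h - w t x)
        + L2_norm (\<lambda>x. (U h (v t) x - v t x) / of_real h - w t x))" if h: "h \<noteq> 0" for t h
  proof -
    let ?a = "v (t + h)" and ?b = "U h (v t)" and ?c = "U (t + h) (v 0)"
    have L: "?a \<in> L2" "?b \<in> L2" "?c \<in> L2" "U h (U t (v 0)) \<in> L2" by (intro UL2 v)+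
    have "N t = L2_norm (U h (\<lambda>x. 1 * v t x + (-1) * U t (v 0) x))"
      unfolding N_def by (subst Unorm) (auto intro!: L2_diff UL2 v)
    also have "\<dots> = L2_norm (\<lambda>x. ?b x - ?c x)"
    proof (rule L2_norm_cong)
      have "L2_eq (U h (\<lambda>x. 1 * v t x + (-1) * U t (v 0) x)) (\<lambda>x. 1 * ?b x + (-1) * U h (U t (v 0)) x)"
        by (intro Ulin v UL2)
      moreover have "L2_eq ?c (U h (U t (v 0)))" using Uadd[OF v, of h t 0] by (simp add: add.commute)
      ultimately show "L2_eq (U h (\<lambda>x. 1 * v t x + (-1) * U t (v 0) x)) (\<lambda>x. ?b x - ?c x)"
        unfolding L2_eq_def by eventually_elim simp
      show "U h (\<lambda>x. 1 * v t x + - 1 * U t (v 0) x) \<in> L2" by (intro UL2 L2_lincomb v)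
      show "(\<lambda>x. ?b x - ?c x) \<in> L2" by (intro L2_diff L)
    qed
    finally have Nt: "N t = L2_norm (\<lambda>x. ?b x - ?c x)" .
    have Nth: "N (t + h) = L2_norm (\<lambda>x. ?a x - ?c x)" by (simp add: N_def)
    have "\<bar>N (t + h) - N t\<bar> \<le> L2_norm (\<lambda>x. ?a x - ?b x)"
      unfolding Nt Nth by (rule L2_reverse_triangle[OF L(1-3)])
    also have "\<dots> = L2_norm (\<lambda>x. of_real h * (((?a x - v t x) / of_real h - w t x) - ((?b x - v t x) / of_real h - w t x)))"
    proof -
      have "((p - r) / of_real h - q) - ((p' - r) / of_real h - q) = (p - p') / of_real h" for p p' q r :: complex
        by (simp add: diff_divide_distrib)
      then show ?thesis using h by simp
    qed
    also have "\<dots> = \<bar>h\<bar> * L2_norm (\<lambda>x. ((?a x - v t x) / of_real h - w t x) - ((?b x - v t x) / of_real h - w t x))"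
      by (subst L2_norm_cmult) simp
    also have "L2_norm (\<lambda>x. ((?a x - v t x) / of_real h - w t x) - ((?b x - v t x) / of_real h - w t x))
       \<le> L2_norm (\<lambda>x. (?a x - v t x) / of_real h - w t x) + L2_norm (\<lambda>x. (?b x - v t x) / of_real h - w t x)"
    proof -
      have q: "(\<lambda>x. (f x - v t x) / of_real h - w t x) \<in> L2" if "f \<in> L2" for f
        using L2_diff[OF L2_cmult[OF L2_diff[OF that v[of t]], of "1 / of_real h"] w] by simp
      show ?thesis
        by (rule L2_triangle_diff[OF q[OF L(1)] q[OF L(2)]])
    qed
    finally show ?thesis by (simp add: mult_left_mono)
  qed
  have "(N has_real_derivative 0) (at t)" for t
    unfolding has_field_derivative_def has_derivative_at
  proof (intro conjI)
    show "bounded_linear ((*) (0::real))" by (rule bounded_linear_mult_right)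
    show "((\<lambda>h. norm (N (t + h) - N t - 0 * h) / norm h) \<longlongrightarrow> 0) (at 0)"
    proof (rule Lim_null_comparison)
      have "((\<lambda>h. L2_norm (\<lambda>x. (U h (v t) x - v t x) / of_real h - w t x)) \<longlongrightarrow> 0) (at 0)"
        using gen[of t] by (simp add: generator_def)
      from tendsto_add[OF der[of t] this]
      show "((\<lambda>h. L2_norm (\<lambda>x. (v (t + h) x - v t x) / of_real h - w t x)
        + L2_norm (\<lambda>x. (U h (v t) x - v t x) / of_real h - w t x)) \<longlongrightarrow> 0) (at 0)" by simp
      show "\<forall>\<^sub>F h in at 0. norm (norm (N (t + h) - N t - 0 * h) / norm h)
         \<le> L2_norm (\<lambda>x. (v (t + h) x - v t x) / of_real h - w t x)
        + L2_norm (\<lambda>x. (U h (v t) x - v t x) / of_real h - w t x)"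
        unfolding eventually_at_filter
        using step by (intro always_eventually allI impI) (simp add: divide_le_eq mult.commute)
    qed
  qed
  then have "N t = N 0" using DERIV_isconst_all[of N] by blast
  also have "N 0 = 0" unfolding N_def
  proof (rule L2_norm_AE_zero)
    show "AE x in lborel. v 0 x - U 0 (v 0) x = 0" using U0[OF v[of 0]] unfolding L2_eq_def by eventually_elim simp
  qed
  finally have "L2_norm (\<lambda>x. v t x - U t (v 0) x) = 0" by (simp add: N_def)
  from L2_norm_eq_0D[OF L2_diff[OF v UL2[OF v]] this] show ?thesis
    unfolding L2_eq_def by eventually_elim simp
qed

lemma norm_exp_minus_linear: "cmod (exp (\<i> * of_real r) - 1 - \<i> * of_real r) \<le> r\<^sup>2"
proof -
  have "cmod (exp (\<i> * of_real r) - (\<Sum>i\<le>1. exp 0 * (\<i> * of_real r - 0) ^ i / fact i))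
      \<le> 1 * cmod (\<i> * of_real r - 0) ^ Suc 1 / fact 1"
  proof (rule complex_Taylor[where f = "\<lambda>_. exp" and S = "{z. Re z = 0}"])
    show "convex {z. Re z = 0}" by (simp add: convex_alt)
  qed (auto intro!: derivative_eq_intros)
  then show ?thesis by (simp add: norm_mult power2_eq_square diff_diff_eq)
qed

context dunkl
begin

text \<open>The unitary map from the weighted space of \<open>wmeas\<close> to \<open>L2\<close> that intertwines the Dunkl operator and \<open>D\<close>.\<close>

definition wlift :: "(real \<Rightarrow> complex) \<Rightarrow> real \<Rightarrow> complex" where
  "wlift g x = of_real (\<bar>x\<bar> powr b) * g x"

lemma wlift_norm_sq: "(cmod (wlift g x))\<^sup>2 = (\<bar>x\<bar> powr (2 * b)) *\<^sub>R (cmod (g x))\<^sup>2"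
proof -
  have "(\<bar>x\<bar> powr b)\<^sup>2 = \<bar>x\<bar> powr (b + b)" unfolding powr_add power2_eq_square ..
  then show ?thesis by (simp add: wlift_def norm_mult power_mult_distrib)
qed

lemma schwartz_sq_integrable:
  assumes "g \<in> schwartz" shows "integrable wmeas (\<lambda>x. (cmod (g x))\<^sup>2)"
proof -
  obtain C where C: "\<And>x. \<bar>x\<bar> ^ 0 * cmod (g x) \<le> C" using schwartz_rapid[OF assms] unfolding rapid_def by meson
  have "rapid (\<lambda>x. g x * g x)"
    by (rule rapid_growth[OF schwartz_rapid[OF assms], of _ C 0]) (use C in \<open>auto simp: norm_mult intro!: mult_right_mono\<close>)
  then have "integrable wmeas (\<lambda>x. g x * g x)"
    using schwartz_measurable[OF assms] by (intro rapid_integrable) auto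
  from integrable_norm[OF this] show ?thesis by (simp add: norm_mult power2_eq_square)
qed

lemma wlift_L2:
  assumes g: "g \<in> schwartz" shows "wlift g \<in> L2"
proof -
  have [measurable]: "g \<in> borel_measurable borel" by (rule schwartz_measurable[OF g])
  have "wlift g \<in> borel_measurable lborel" unfolding wlift_def[abs_def] by measurable
  moreover have "integrable lborel (\<lambda>x. (cmod (wlift g x))\<^sup>2)"
    unfolding wlift_norm_sq using schwartz_sq_integrable[OF g] by (subst (asm) integrable_wmeas) auto
  ultimately show ?thesis by (simp add: L2_def)
qed

lemma wlift_L2_norm:
  assumes g: "g \<in> schwartz" shows "L2_norm (wlift g) = sqrt (\<integral>x. (cmod (g x))\<^sup>2 \<partial>wmeas)"
proof -
  have [measurable]: "g \<in> borel_measurable borel" by (rule schwartz_measurable[OF g])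
  show ?thesis unfolding L2_norm_def wlift_norm_sq by (subst integral_wmeas) auto
qed

lemma wlift_weighted_schwartz: "g \<in> schwartz \<Longrightarrow> wlift g \<in> weighted_schwartz b"
  unfolding weighted_schwartz_def wlift_def by blast

lemma D_op_wlift:
  assumes g: "g \<in> schwartz" and w: "dunkl_rel g w" and x: "x \<noteq> 0"
  shows "D_op b (wlift g) x = wlift w x"
proof -
  have abs: "\<bar>x\<bar> powr b = (x\<^sup>2) powr (b / 2)" for x :: real
  proof (cases "x = 0")
    case False
    then have "x\<^sup>2 = \<bar>x\<bar> powr 2" by simp
    then show ?thesis by (simp add: powr_powr del: powr_numeral)
  qed simp
  have "((\<lambda>x. (x\<^sup>2) powr (b / 2)) has_real_derivative b / x * (x\<^sup>2) powr (b / 2)) (at x)"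
  proof -
    have "x\<^sup>2 > 0" using x by simp
    then have "((\<lambda>z. z powr (b / 2)) has_real_derivative b / 2 * (x\<^sup>2) powr (b / 2 - 1)) (at (x\<^sup>2))"
      by (rule has_real_derivative_powr)
    moreover have "((\<lambda>x. x\<^sup>2) has_real_derivative 2 * x) (at x)" by (auto intro!: derivative_eq_intros)
    ultimately have "((\<lambda>x. (x\<^sup>2) powr (b / 2)) has_real_derivative b / 2 * (x\<^sup>2) powr (b / 2 - 1) * (2 * x)) (at x)"
      by (rule DERIV_chain2)
    moreover have "(x\<^sup>2) powr (b / 2 - 1) = (x\<^sup>2) powr (b / 2) / x\<^sup>2"
      using \<open>x\<^sup>2 > 0\<close> by (simp add: powr_diff)
    ultimately show ?thesis using x by (simp add: power2_eq_square)
  qed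
  then have "((\<lambda>x. \<bar>x\<bar> powr b) has_real_derivative b / x * \<bar>x\<bar> powr b) (at x)" unfolding abs .
  from bounded_linear.has_vector_derivative[OF bounded_linear_of_real this[unfolded has_real_derivative_iff_has_vector_derivative]]
  have "((\<lambda>x. of_real (\<bar>x\<bar> powr b) :: complex) has_vector_derivative of_real (b / x * \<bar>x\<bar> powr b)) (at x)" .
  from has_vector_derivative_mult[OF this schwartz_deriv[OF g]]
  have "vector_derivative (wlift g) (at x) = of_real (\<bar>x\<bar> powr b) * vd g x + of_real (b / x * \<bar>x\<bar> powr b) * g x"
    unfolding wlift_def[abs_def] by (rule vector_derivative_at)
  then have D: "D_op b (wlift g) x = of_real (\<bar>x\<bar> powr b) * (vd g x + of_real b / of_real x * (g x - g (- x)))"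
    by (simp add: D_op_def wlift_def algebra_simps)
  have "of_real x * w x = of_real x * (vd g x + of_real b / of_real x * (g x - g (- x)))"
    unfolding dunkl_relD[OF w] using x by (simp add: distrib_left)
  then have "w x = vd g x + of_real b / of_real x * (g x - g (- x))" using x by (subst (asm) mult_cancel_left) auto
  then show ?thesis by (simp add: D wlift_def)
qed

text \<open>\<open>D_op b (wlift g)\<close> itself has an arbitrary value at the origin.  The closure of the graph only sees
  its class, which contains \<open>wlift w\<close>.\<close>

lemma D_closure_wlift:
  assumes g: "g \<in> schwartz" and w: "w \<in> schwartz" and rel: "dunkl_rel g w"
  shows "(wlift g, wlift w) \<in> L2_closure (D_graph b)"
proof -
  have "(wlift g, D_op b (wlift g)) \<in> D_graph b"
    using wlift_weighted_schwartz[OF g] by (auto simp: D_graph_def)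
  moreover have "L2_norm (\<lambda>x. D_op b (wlift g) x - wlift w x) = 0"
  proof (rule L2_norm_AE_zero)
    have "AE x in lborel. x \<noteq> (0::real)" by (rule AE_lborel_singleton)
    then show "AE x in lborel. D_op b (wlift g) x - wlift w x = 0"
      by eventually_elim (simp add: D_op_wlift[OF g rel])
  qed
  moreover have "L2_norm (\<lambda>x. wlift g x - wlift g x) = 0" by (simp add: L2_norm_def)
  ultimately have "(\<forall>n::nat. (wlift g, D_op b (wlift g)) \<in> D_graph b)
      \<and> (\<lambda>n::nat. L2_norm (\<lambda>x. wlift g x - wlift g x)) \<longlonglongrightarrow> 0
      \<and> (\<lambda>n::nat. L2_norm (\<lambda>x. D_op b (wlift g) x - wlift w x)) \<longlonglongrightarrow> 0" by simp
  then have "\<exists>u v. (\<forall>n::nat. (u n, v n) \<in> D_graph b)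
      \<and> (\<lambda>n. L2_norm (\<lambda>x. u n x - wlift g x)) \<longlonglongrightarrow> 0
      \<and> (\<lambda>n. L2_norm (\<lambda>x. v n x - wlift w x)) \<longlonglongrightarrow> 0"
    by (rule exI[of _ "\<lambda>_. wlift g", OF exI[of _ "\<lambda>_. D_op b (wlift g)"]])
  then show ?thesis unfolding L2_closure_def using wlift_L2[OF g] wlift_L2[OF w] by simp
qed

text \<open>On the side of the transform the Dunkl operator is multiplication by \<open>is\<close>, so its exponential is
  multiplication by \<open>e\<^bsup>its\<^esup>\<close>.\<close>

definition spec :: "(real \<Rightarrow> complex) \<Rightarrow> real \<Rightarrow> real \<Rightarrow> complex" where
  "spec g t s = exp (\<i> * of_real (t * s)) * dtr 0 g (- s)"

definition evol :: "real \<Rightarrow> (real \<Rightarrow> complex) \<Rightarrow> real \<Rightarrow> complex" where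
  "evol t g x = inverse (of_real (dconst\<^sup>2)) * dtr 0 (spec g t) x"

lemma spec_schwartz: "g \<in> schwartz \<Longrightarrow> spec g t \<in> schwartz"
  unfolding spec_def[abs_def] by (intro schwartz_exp schwartz_reflect[of "dtr 0 g"] dtr_schwartz)

lemma evol_schwartz: "g \<in> schwartz \<Longrightarrow> evol t g \<in> schwartz"
  unfolding evol_def[abs_def] by (intro schwartz_cmult dtr_schwartz spec_schwartz)

lemma evol_0: "g \<in> schwartz \<Longrightarrow> evol 0 g = g"
proof
  fix x assume g: "g \<in> schwartz"
  have "spec g 0 = (\<lambda>s. dtr 0 g (- s))" by (simp add: spec_def[abs_def])
  then have "dtr 0 (spec g 0) x = of_real (dconst\<^sup>2) * g x"
    using dtr_inversion[OF g, of x] by (simp add: dtr_reflect[OF dtr_schwartz[OF g]])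
  then show "evol 0 g x = g x" using dconst_pos by (simp add: evol_def)
qed

lemma evol_dunkl_rel:
  assumes g: "g \<in> schwartz"
  shows "dunkl_rel (evol t g) (\<lambda>x. inverse (of_real (dconst\<^sup>2)) * dtr 0 (\<lambda>s. \<i> * of_real s * spec g t s) x)"
proof -
  let ?c = "inverse (of_real (dconst\<^sup>2)) :: complex"
  note S = spec_schwartz[OF g, of t]
  have "vd (evol t g) = (\<lambda>x. ?c * vd (dtr 0 (spec g t)) x)"
    unfolding evol_def[abs_def]
    by (intro vdI has_vector_derivative_mult_right schwartz_deriv dtr_schwartz S)
  then have vd: "vd (evol t g) x = ?c * vd (dtr 0 (spec g t)) x" for x by simp
  show ?thesis unfolding dunkl_rel_def
  proof
    fix y
    have "?c * (of_real y * dtr 0 (\<lambda>s. \<i> * of_real s * spec g t s) y)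
        = ?c * (of_real y * vd (dtr 0 (spec g t)) y + of_real b * (dtr 0 (spec g t) y - dtr 0 (spec g t) (- y)))"
      by (simp only: dunkl_relD[OF dtr_dunkl_rel[OF S]])
    then show "of_real y * (?c * dtr 0 (\<lambda>s. \<i> * of_real s * spec g t s) y)
        = of_real y * vd (evol t g) y + of_real b * (evol t g y - evol t g (- y))"
      unfolding vd evol_def by (simp only: mult.left_commute distrib_left right_diff_distrib)
  qed
qed

text \<open>By the Plancherel formula the norm in question is that of the spectral function, where
  \<open>\<bar>e\<^bsup>ir\<^esup> - 1 - ir\<bar> \<le> r\<^sup>2\<close> bounds it by a multiple of \<open>h\<close>.\<close>

lemma evol_strong_derivative:
  assumes g: "g \<in> schwartz"
  shows "((\<lambda>h. L2_norm (\<lambda>x. (wlift (evol (t + h) g) x - wlift (evol t g) x) / of_real h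
            - wlift (\<lambda>x. inverse (of_real (dconst\<^sup>2)) * dtr 0 (\<lambda>s. \<i> * of_real s * spec g t s) x) x)) \<longlongrightarrow> 0) (at 0)"
proof (rule Lim_null_comparison)
  let ?c = "inverse (of_real (dconst\<^sup>2)) :: complex"
  define a where "a s = of_real s * (of_real s * dtr 0 g (- s))" for s :: real
  have a: "a \<in> schwartz" unfolding a_def
    by (intro schwartz_times_x schwartz_reflect[of "dtr 0 g"] dtr_schwartz g)
  define K where "K = inverse dconst * sqrt (\<integral>s. (cmod (a s))\<^sup>2 \<partial>wmeas)"
  show "((\<lambda>h::real. \<bar>h\<bar> * K) \<longlongrightarrow> 0) (at 0)" by (auto intro!: tendsto_eq_intros)
  show "\<forall>\<^sub>F h in at 0. norm (L2_norm (\<lambda>x. (wlift (evol (t + h) g) x - wlift (evol t g) x) / of_real h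
            - wlift (\<lambda>x. ?c * dtr 0 (\<lambda>s. \<i> * of_real s * spec g t s) x) x)) \<le> \<bar>h\<bar> * K"
    unfolding eventually_at_filter
  proof (intro always_eventually allI impI)
    fix h :: real assume h: "h \<noteq> 0"
    define \<rho> where "\<rho> s = inverse (of_real h) * (spec g (t + h) s - spec g t s) - \<i> * of_real s * spec g t s" for s
    have \<rho>: "\<rho> \<in> schwartz" unfolding \<rho>_def[abs_def]
      by (intro schwartz_diff schwartz_cmult schwartz_is spec_schwartz g)
    have d\<rho>: "dtr 0 \<rho> x = inverse (of_real h) * (dtr 0 (spec g (t + h)) x - dtr 0 (spec g t) x)
          - dtr 0 (\<lambda>s. \<i> * of_real s * spec g t s) x" for x
      unfolding \<rho>_def[abs_def] using g
      by (simp only: dtr_diff dtr_cmult schwartz_diff schwartz_cmult schwartz_is spec_schwartz)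
    have eq: "(wlift (evol (t + h) g) x - wlift (evol t g) x) / of_real h
            - wlift (\<lambda>x. ?c * dtr 0 (\<lambda>s. \<i> * of_real s * spec g t s) x) x = ?c * wlift (dtr 0 \<rho>) x" for x
      unfolding wlift_def evol_def d\<rho> by (simp add: divide_inverse algebra_simps)
    have bound: "cmod (\<rho> s) \<le> \<bar>h\<bar> * cmod (a s)" for s
    proof -
      have "exp (\<i> * of_real ((t + h) * s)) = exp (\<i> * of_real (t * s)) * exp (\<i> * of_real (h * s))"
        by (simp add: algebra_simps flip: exp_add)
      then have "of_real h * \<rho> s = (exp (\<i> * of_real (h * s)) - 1 - \<i> * of_real (h * s)) * (exp (\<i> * of_real (t * s)) * dtr 0 g (- s))"
        using h by (simp add: \<rho>_def spec_def field_simps)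
      then have "\<bar>h\<bar> * cmod (\<rho> s) = cmod (exp (\<i> * of_real (h * s)) - 1 - \<i> * of_real (h * s)) * cmod (dtr 0 g (- s))"
        by (metis norm_mult norm_of_real norm_exp_i_times mult_1)
      also have "\<dots> \<le> (h * s)\<^sup>2 * cmod (dtr 0 g (- s))" by (intro mult_right_mono norm_exp_minus_linear) auto
      also have "\<dots> = \<bar>h\<bar> * (\<bar>h\<bar> * cmod (a s))"
        by (simp add: a_def norm_mult power2_eq_square abs_mult_self_eq mult_ac flip: abs_mult)
      finally show ?thesis using h by (subst (asm) mult_le_cancel_left_pos) auto
    qed
    have "(\<integral>s. (cmod (\<rho> s))\<^sup>2 \<partial>wmeas) \<le> (\<integral>s. \<bar>h\<bar>\<^sup>2 * (cmod (a s))\<^sup>2 \<partial>wmeas)"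
      using power_mono[OF bound, of _ 2]
      by (intro integral_mono schwartz_sq_integrable[OF \<rho>] integrable_mult_right schwartz_sq_integrable[OF a])
         (simp add: power_mult_distrib)
    also have "\<dots> = \<bar>h\<bar>\<^sup>2 * (\<integral>s. (cmod (a s))\<^sup>2 \<partial>wmeas)" by simp
    finally have le: "sqrt (\<integral>s. (cmod (\<rho> s))\<^sup>2 \<partial>wmeas) \<le> \<bar>h\<bar> * sqrt (\<integral>s. (cmod (a s))\<^sup>2 \<partial>wmeas)"
      using real_sqrt_le_mono by (fastforce simp: real_sqrt_mult)
    have "L2_norm (\<lambda>x. ?c * wlift (dtr 0 \<rho>) x) = inverse (dconst\<^sup>2) * (dconst * sqrt (\<integral>s. (cmod (\<rho> s))\<^sup>2 \<partial>wmeas))"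
      unfolding L2_norm_cmult wlift_L2_norm[OF dtr_schwartz[OF \<rho>]] dtr_plancherel[OF \<rho>] norm_inverse norm_of_real
      using dconst_pos by (simp add: real_sqrt_mult)
    also have "\<dots> = inverse dconst * sqrt (\<integral>s. (cmod (\<rho> s))\<^sup>2 \<partial>wmeas)"
      using dconst_pos by (simp add: power2_eq_square)
    also have "\<dots> \<le> inverse dconst * (\<bar>h\<bar> * sqrt (\<integral>s. (cmod (a s))\<^sup>2 \<partial>wmeas))"
      using dconst_pos by (intro mult_left_mono le) auto
    finally show "norm (L2_norm (\<lambda>x. (wlift (evol (t + h) g) x - wlift (evol t g) x) / of_real h
            - wlift (\<lambda>x. ?c * dtr 0 (\<lambda>s. \<i> * of_real s * spec g t s) x) x)) \<le> \<bar>h\<bar> * K"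
      unfolding eq K_def by (simp add: mult_ac)
  qed
qed

text \<open>The lifted evolution is a differentiable curve in the domain of the generator and solves the
  evolution equation, so it is the orbit of the group.\<close>

lemma exp_D_eq_evol:
  assumes U: "is_exp_D b U" and g: "g \<in> schwartz" and f: "\<And>x. x \<noteq> 0 \<Longrightarrow> f x = of_real (\<bar>x\<bar> powr b) * g x"
  shows "L2_eq (U t f) (wlift (evol t g))"
proof -
  have ug: "unitary_group U" and gen: "generator U = L2_closure (D_graph b)" using U by (auto simp: is_exp_D_def)
  have ae: "AE x in lborel. f x = wlift g x"
    using AE_lborel_singleton[of 0] by eventually_elim (simp add: f wlift_def)
  have [measurable]: "wlift g \<in> borel_measurable borel" by (rule L2D(1)[OF wlift_L2[OF g]])
  have "f = (\<lambda>x. if x = 0 then f 0 else wlift g x)" using f by (auto simp: wlift_def)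
  moreover have "(\<lambda>x. if x = 0 then f 0 else wlift g x) \<in> borel_measurable borel" by measurable
  ultimately have fm: "f \<in> borel_measurable borel" by simp
  have fL2: "f \<in> L2"
    unfolding L2_def
  proof (intro CollectI conjI)
    show "integrable lborel (\<lambda>x. (cmod (f x))\<^sup>2)"
      using L2D(2)[OF wlift_L2[OF g]]
    proof (rule integrable_cong_AE_imp)
      show "AE x in lborel. (cmod (wlift g x))\<^sup>2 = (cmod (f x))\<^sup>2" using ae by eventually_elim simp
    qed (use fm in measurable)
  qed (use fm in simp)
  have "L2_eq (U t (wlift (evol 0 g))) (wlift (evol t g))"
  proof (rule unitary_group_unique[OF ug, where v = "\<lambda>t. wlift (evol t g)"])
    fix t
    let ?w = "\<lambda>x. inverse (of_real (dconst\<^sup>2)) * dtr 0 (\<lambda>s. \<i> * of_real s * spec g t s) x"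
    show "wlift (evol t g) \<in> L2" by (intro wlift_L2 evol_schwartz g)
    have "?w \<in> schwartz" by (intro schwartz_cmult dtr_schwartz schwartz_is spec_schwartz g)
    then show "(wlift (evol t g), wlift ?w) \<in> generator U"
      unfolding gen by (intro D_closure_wlift evol_schwartz evol_dunkl_rel g)
    show "((\<lambda>h. L2_norm (\<lambda>x. (wlift (evol (t + h) g) x - wlift (evol t g) x) / of_real h - wlift ?w x)) \<longlongrightarrow> 0) (at 0)"
      by (rule evol_strong_derivative[OF g])
  qed
  moreover have "L2_eq (U t f) (U t (wlift g))"
    using ug ae fL2 wlift_L2[OF g] unfolding unitary_group_def unitary_L2_def L2_eq_def by blast
  ultimately show ?thesis
    unfolding L2_eq_def evol_0[OF g] by eventually_elim simp
qed

end

section \<open>The Laplace transform of a product of two Dunkl kernels\<close>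

text \<open>The exponential cut off to the positive half-line: integrals against it over the whole line are
  Laplace transforms.\<close>

definition hexp :: "complex \<Rightarrow> real \<Rightarrow> complex" where
  "hexp z s = indicator {0<..} s *\<^sub>R exp (\<i> * z * of_real s)"

lemma hexp_measurable [measurable]: "hexp z \<in> borel_measurable borel"
proof -
  have "(\<lambda>s. exp (\<i> * z * of_real s)) \<in> borel_measurable borel"
    by (intro borel_measurable_continuous_onI continuous_intros)
  then show ?thesis unfolding hexp_def[abs_def] by measurable
qed

lemma hexp_norm: "cmod (hexp z s) = indicator {0<..} s * exp (- Im z * s)"
  by (simp add: hexp_def)

lemma hexp_rapid:
  assumes "Im z > 0" shows "rapid (hexp z)"
  unfolding rapid_def
proof
  fix k
  have "\<bar>s\<bar> ^ k * cmod (hexp z s) \<le> fact k / Im z ^ k" for s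
  proof (cases "s > 0")
    case True
    then have "(Im z * s) ^ k * exp (- (Im z * s)) \<le> fact k"
      using assms by (intro power_mult_exp_le) simp
    then have "Im z ^ k * (s ^ k * exp (- (Im z * s))) \<le> fact k" by (simp add: power_mult_distrib mult.assoc)
    then show ?thesis using True assms by (simp add: hexp_norm field_simps)
  next
    case False
    then show ?thesis using assms by (simp add: hexp_norm)
  qed
  then show "\<exists>C. \<forall>s. \<bar>s\<bar> ^ k * cmod (hexp z s) \<le> C" by blast
qed

lemma Gamma_half_line:
  fixes a \<eta> :: real
  assumes a: "a > 0" and \<eta>: "\<eta> > 0"
  shows "(\<integral>s. indicator {0<..} s * (s powr (a - 1) * exp (- \<eta> * s)) \<partial>lborel) = Gamma a * \<eta> powr (- a)"
proof -
  define f where "f s = indicator {0<..} s * (s powr (a - 1) * exp (- \<eta> * s))" for s :: real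
  have f0: "indicator {0..} t * t powr (a - 1) / exp t = indicator {0<..} t * (t powr (a - 1) * exp (- t))" for t :: real
    by (auto simp: indicator_def exp_minus divide_inverse)
  have "(\<integral>\<^sup>+t. ennreal (indicator {0<..} t * (t powr (a - 1) * exp (- t))) \<partial>lborel) = ennreal (Gamma a)"
    by (rule Gamma_conv_nn_integral_real[OF a, unfolded f0, symmetric])
  then have 1: "(\<integral>t. indicator {0<..} t * (t powr (a - 1) * exp (- t)) \<partial>lborel) = Gamma a"
    using Gamma_real_pos[OF a]
    by (intro has_bochner_integral_integral_eq has_bochner_integral_nn_integral) auto
  have "(\<integral>s. f s \<partial>lborel) = \<bar>1 / \<eta>\<bar> *\<^sub>R (\<integral>t. f (0 + 1 / \<eta> * t) \<partial>lborel)"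
    by (rule lborel_integral_real_affine) (use \<eta> in simp)
  also have "(\<lambda>t. f (0 + 1 / \<eta> * t)) = (\<lambda>t. \<eta> powr (1 - a) * (indicator {0<..} t * (t powr (a - 1) * exp (- t))))"
  proof
    fix t
    show "f (0 + 1 / \<eta> * t) = \<eta> powr (1 - a) * (indicator {0<..} t * (t powr (a - 1) * exp (- t)))"
    proof (cases "t > 0")
      case True
      have "(t / \<eta>) powr (a - 1) = t powr (a - 1) / \<eta> powr (a - 1)" using True \<eta> by (simp add: powr_divide)
      also have "\<dots> = t powr (a - 1) * \<eta> powr (1 - a)" using powr_minus[of \<eta> "a - 1"] by (simp add: divide_inverse)
      finally show ?thesis using True \<eta> by (simp add: f_def)
    next
      case False
      then have "\<not> 0 < t / \<eta>" using \<eta> by (simp add: zero_less_divide_iff)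
      then show ?thesis using False by (simp add: f_def)
    qed
  qed
  also have "(\<integral>t. \<eta> powr (1 - a) * (indicator {0<..} t * (t powr (a - 1) * exp (- t))) \<partial>lborel) = \<eta> powr (1 - a) * Gamma a"
    by (simp only: integral_mult_right_zero 1)
  also have "\<bar>1 / \<eta>\<bar> *\<^sub>R (\<eta> powr (1 - a) * Gamma a) = Gamma a * \<eta> powr (- a)"
    using \<eta> by (simp add: powr_diff powr_minus divide_inverse)
  finally show ?thesis by (simp add: f_def)
qed

context dunkl
begin

definition dprod :: "real \<Rightarrow> real \<Rightarrow> real \<Rightarrow> complex" where
  "dprod x y s = dline 0 x s * dline 0 (- y) s"

definition lap :: "real \<Rightarrow> real \<Rightarrow> complex \<Rightarrow> complex" where
  "lap x y z = (\<integral>s. hexp z s * dprod x y s \<partial>wmeas)"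

definition dlap :: "real \<Rightarrow> real \<Rightarrow> complex \<Rightarrow> complex" where
  "dlap x y z = (\<integral>s. hexp z s * (\<i> * of_real s * dprod x y s) \<partial>wmeas)"

lemma dprod_continuous: "continuous_on A (dprod x y)"
  unfolding dprod_def[abs_def] by (intro continuous_intros)

lemma dprod_measurable [measurable]: "dprod x y \<in> borel_measurable borel"
  by (intro borel_measurable_continuous_onI dprod_continuous)

lemma dprod_bound: "\<exists>K\<ge>0. \<forall>s. cmod (dprod x y s) \<le> K * (1 + \<bar>s\<bar>) ^ 2"
proof -
  obtain C where C: "C \<ge> 0" "\<And>x y. cmod (dline 0 x y) \<le> C * (1 + \<bar>x\<bar>) * (1 + \<bar>y\<bar>)"
    using dline_bound by blast
  have "cmod (dprod x y s) \<le> (C * (1 + \<bar>x\<bar>)) * (C * (1 + \<bar>y\<bar>)) * (1 + \<bar>s\<bar>) ^ 2" for s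
  proof -
    have "cmod (dprod x y s) \<le> (C * (1 + \<bar>x\<bar>) * (1 + \<bar>s\<bar>)) * (C * (1 + \<bar>- y\<bar>) * (1 + \<bar>s\<bar>))"
      unfolding dprod_def norm_mult using C(1) by (intro mult_mono C) auto
    then show ?thesis by (simp add: power2_eq_square mult_ac)
  qed
  then show ?thesis using C(1) by (intro exI[of _ "(C * (1 + \<bar>x\<bar>)) * (C * (1 + \<bar>y\<bar>))"]) auto
qed

lemma hexp_dprod_rapid:
  assumes "Im z > 0" shows "rapid (\<lambda>s. hexp z s * ((\<i> * of_real s) ^ n * dprod x y s))"
proof -
  obtain K where K: "K \<ge> 0" "\<And>s. cmod (dprod x y s) \<le> K * (1 + \<bar>s\<bar>) ^ 2" using dprod_bound by blast
  show ?thesis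
  proof (rule rapid_growth[OF hexp_rapid[OF assms], of _ K "n + 2"])
    fix s
    have "cmod ((\<i> * of_real s) ^ n * dprod x y s) \<le> (1 + \<bar>s\<bar>) ^ n * (K * (1 + \<bar>s\<bar>) ^ 2)"
      unfolding norm_mult norm_power using K by (intro mult_mono power_mono) auto
    also have "\<dots> = K * (1 + \<bar>s\<bar>) ^ (n + 2)" by (simp only: power_add mult_ac)
    finally show "cmod (hexp z s * ((\<i> * of_real s) ^ n * dprod x y s)) \<le> K * (1 + \<bar>s\<bar>) ^ (n + 2) * cmod (hexp z s)"
      unfolding norm_mult[of "hexp z s"] by (subst mult.commute) (intro mult_right_mono, auto)
  qed
qed

lemma hexp_dprod_integrable:
  assumes "Im z > 0" shows "integrable wmeas (\<lambda>s. hexp z s * ((\<i> * of_real s) ^ n * dprod x y s))"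
  by (intro rapid_integrable hexp_dprod_rapid assms) measurable

lemma lap_integrable:
  assumes "Im z > 0"
  shows "integrable wmeas (\<lambda>s. hexp z s * dprod x y s)" "integrable wmeas (\<lambda>s. hexp z s * (\<i> * of_real s * dprod x y s))"
  using hexp_dprod_integrable[OF assms, of 0] hexp_dprod_integrable[OF assms, of 1] by simp_all

lemma lap_DERIV:
  assumes z: "Im z > 0" shows "(lap x y has_field_derivative dlap x y z) (at z)"
proof -
  define S where "S = {w. Im w > Im z / 2}"
  have S1: "open S" unfolding S_def by (rule open_halfspace_Im_gt)
  have S2: "convex S" unfolding S_def by (rule convex_halfspace_Im_gt)
  have "z \<in> S" using z by (simp add: S_def)
  note S = S1 S2 this
  define z0 where "z0 = \<i> * of_real (Im z / 2)"
  have z0: "Im z0 > 0" using z by (simp add: z0_def)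
  have "((\<lambda>w. \<integral>s. hexp w s * dprod x y s \<partial>wmeas) has_field_derivative (\<integral>s. hexp z s * (\<i> * of_real s * dprod x y s) \<partial>wmeas)) (at z within S)"
  proof (rule has_field_derivative_integral[OF S(2,3), where g = "\<lambda>s. cmod (hexp z0 s * (\<i> * of_real s * dprod x y s))"])
    fix w s assume w: "w \<in> S"
    have "((\<lambda>w. hexp w s) has_field_derivative hexp w s * (\<i> * of_real s)) (at w within S)"
      unfolding hexp_def scaleR_conv_of_real by (auto intro!: derivative_eq_intros)
    from DERIV_cmult_right[OF this, of "dprod x y s"]
    show "((\<lambda>w. hexp w s * dprod x y s) has_field_derivative hexp w s * (\<i> * of_real s * dprod x y s)) (at w within S)"
      by (simp add: mult_ac)
    have "cmod (hexp w s) \<le> cmod (hexp z0 s)"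
    proof (cases "s > 0")
      case True
      have "Im z0 * s \<le> Im w * s" using w True by (intro mult_right_mono) (auto simp: z0_def S_def)
      then show ?thesis using True by (simp add: hexp_norm)
    qed (simp add: hexp_norm)
    then show "cmod (hexp w s * (\<i> * of_real s * dprod x y s)) \<le> cmod (hexp z0 s * (\<i> * of_real s * dprod x y s))"
      unfolding norm_mult[of "hexp _ _"] by (intro mult_right_mono) auto
  next
    fix w assume "w \<in> S"
    then have "Im w > 0" using z by (simp add: S_def)
    then show "integrable wmeas (\<lambda>s. hexp w s * dprod x y s)" by (rule lap_integrable)
  next
    show "integrable wmeas (\<lambda>s. cmod (hexp z0 s * (\<i> * of_real s * dprod x y s)))"
      by (intro integrable_norm lap_integrable z0)
    show "(\<lambda>s. hexp z s * (\<i> * of_real s * dprod x y s)) \<in> borel_measurable wmeas"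
      by (rule borel_measurable_integrable[OF lap_integrable(2)[OF z]])
  qed
  then show ?thesis unfolding lap_def[abs_def] dlap_def at_within_open[OF S(3,1)] .
qed

lemma dline_reflect: "dline n x (- s) = dline n (- x) s"
  by (simp add: dline_def)

text \<open>This is \<open>\<integral> d/ds (s\<^bsup>2b+1\<^esup> e\<^bsup>izs\<^esup> E(isx) E(-isy)) ds = 0\<close>, that is homogeneity of the transform
  combined with the two eigenvalue equations.\<close>

lemma lap_ode:
  assumes z: "Im z > 0"
  shows "(of_real (x - y) + z) * dlap x y z = - lap x y z - of_real b * lap (- x) y z - of_real b * lap x (- y) z"
proof -
  define e' where "e' s = dline 0 x s * (\<i> * of_real (- y) * dline (Suc 0) (- y) s) + \<i> * of_real x * dline (Suc 0) x s * dline 0 (- y) s" for s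
  have e: "(dprod x y has_vector_derivative e' s) (at s)" for s
    unfolding dprod_def[abs_def] e'_def by (intro has_vector_derivative_mult dline_deriv)
  have e_ode: "of_real s * e' s = \<i> * of_real s * of_real (x - y) * dprod x y s - 2 * of_real b * dprod x y s
      + of_real b * dprod (- x) y s + of_real b * dprod x (- y) s" for s
  proof -
    have "of_real s * e' s = dline 0 x s * (of_real s * (\<i> * of_real (- y) * dline (Suc 0) (- y) s))
        + (of_real s * (\<i> * of_real x * dline (Suc 0) x s)) * dline 0 (- y) s"
      by (simp add: e'_def algebra_simps)
    then show ?thesis unfolding dline_ode dprod_def by (simp add: dline_reflect algebra_simps)
  qed
  define J where "J s = dprod x y s + (of_real (x - y) + z) * (\<i> * of_real s * dprod x y s)
       + of_real b * dprod (- x) y s + of_real b * dprod x (- y) s" for s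
  have Jc: "continuous_on A J" for A unfolding J_def by (intro continuous_intros dprod_continuous)
  define X where "X s = exp (\<i> * z * of_real s)" for s :: real
  have Xd: "(X has_vector_derivative \<i> * z * X s) (at s)" for s
  proof -
    have "((\<lambda>s. \<i> * z * of_real s) has_vector_derivative \<i> * z) (at s)"
      using has_vector_derivative_mult_right[OF bounded_linear.has_vector_derivative[OF bounded_linear_of_real has_vector_derivative_id[of "at s"]], of "\<i> * z"]
      by simp
    from field_vector_diff_chain_at[OF this DERIV_exp] show ?thesis by (simp add: X_def[abs_def] o_def)
  qed
  have Xc: "continuous_on A X" for A unfolding X_def by (intro continuous_intros)
  define F where "F s = (s powr (2 * b + 1)) *\<^sub>R (X s * dprod x y s)" for s
  define f where "f s = (\<bar>s\<bar> powr (2 * b)) *\<^sub>R (X s * J s)" for s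
  have int: "integrable wmeas (\<lambda>s. hexp z s * J s)" "(\<integral>s. hexp z s * J s \<partial>wmeas)
      = lap x y z + (of_real (x - y) + z) * dlap x y z + of_real b * lap (- x) y z + of_real b * lap x (- y) z"
  proof -
    have eq: "hexp z s * J s = hexp z s * dprod x y s + (of_real (x - y) + z) * (hexp z s * (\<i> * of_real s * dprod x y s))
       + of_real b * (hexp z s * dprod (- x) y s) + of_real b * (hexp z s * dprod x (- y) s)" for s
      by (simp add: J_def algebra_simps)
    note i = lap_integrable[OF z]
    show "integrable wmeas (\<lambda>s. hexp z s * J s)" unfolding eq
      by (intro Bochner_Integration.integrable_add integrable_mult_right i)
    show "(\<integral>s. hexp z s * J s \<partial>wmeas)
      = lap x y z + (of_real (x - y) + z) * dlap x y z + of_real b * lap (- x) y z + of_real b * lap x (- y) z"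
      unfolding eq lap_def dlap_def
      by (simp only: Bochner_Integration.integral_add Bochner_Integration.integrable_add integral_mult_right_zero
          integrable_mult_right i)
  qed
  have hm: "(\<lambda>s. hexp z s * J s) \<in> borel_measurable borel"
    using borel_measurable_continuous_onI[OF Jc] by measurable
  have hf: "(\<bar>s\<bar> powr (2 * b)) *\<^sub>R (hexp z s * J s) = indicator {0<..} s *\<^sub>R f s" for s
    by (simp add: hexp_def f_def X_def)
  have "(\<integral>s. indicator {0<..} s *\<^sub>R f s \<partial>lborel) = 0"
  proof (rule halfline_integral_zero[where F = F])
    show "set_integrable lborel {0<..} f"
      using int(1) unfolding integrable_wmeas[OF hm] hf set_integrable_def .
    show "isCont f s" if "s > 0" for s
    proof -
      have "isCont J s" "isCont X s" using Jc[of UNIV] Xc[of UNIV] by (simp_all add: continuous_on_eq_continuous_at)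
      then show ?thesis unfolding f_def by (intro continuous_intros) (use that in auto)
    qed
    show "(F has_vector_derivative f s) (at s)" if s: "s > 0" for s
    proof -
      have "((\<lambda>y. y powr (2 * b + 1)) has_real_derivative (2 * b + 1) * s powr (2 * b)) (at s)"
        using s by (auto intro!: derivative_eq_intros)
      from has_vector_derivative_scaleR[OF this has_vector_derivative_mult[OF Xd e]]
      have "(F has_vector_derivative (s powr (2 * b + 1)) *\<^sub>R (X s * e' s + \<i> * z * X s * dprod x y s)
           + ((2 * b + 1) * s powr (2 * b)) *\<^sub>R (X s * dprod x y s)) (at s)"
        by (simp add: F_def[abs_def])
      moreover have "(s powr (2 * b + 1)) *\<^sub>R (X s * e' s + \<i> * z * X s * dprod x y s)
           + ((2 * b + 1) * s powr (2 * b)) *\<^sub>R (X s * dprod x y s)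
        = of_real (s powr (2 * b)) * (X s * (of_real s * e' s + \<i> * z * of_real s * dprod x y s + of_real (2 * b + 1) * dprod x y s))"
        using s by (simp add: scaleR_conv_of_real powr_add algebra_simps)
      moreover have "\<dots> = f s"
        unfolding e_ode using s by (simp add: f_def J_def scaleR_conv_of_real algebra_simps)
      ultimately show ?thesis by simp
    qed
    show "(F \<longlongrightarrow> 0) (at_right 0)"
    proof -
      have 1: "((\<lambda>y. y powr (2 * b + 1)) \<longlongrightarrow> 0) (at_right (0::real))"
        by (rule tendsto_zero_powrI[OF tendsto_ident_at tendsto_const])
           (use b_gt in \<open>auto simp: eventually_at_right_less eventually_at_filter\<close>)
      have "isCont (\<lambda>s. X s * dprod x y s) 0"
        using continuous_on_mult[OF Xc[of UNIV] dprod_continuous[of UNIV x y]] by (simp add: continuous_on_eq_continuous_at)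
      then have 2: "((\<lambda>s. X s * dprod x y s) \<longlongrightarrow> X 0 * dprod x y 0) (at_right 0)"
        unfolding isCont_def by (rule tendsto_within_subset) auto
      show ?thesis unfolding F_def using tendsto_scaleR[OF 1 2] by simp
    qed
    have "((\<lambda>s. (s powr (2 * b + 1)) *\<^sub>R (hexp z s * dprod x y s)) \<longlongrightarrow> 0) at_top"
      using rapid_powr_tendsto[OF hexp_dprod_rapid[OF z, of 0 x y]] by simp
    moreover have "\<forall>\<^sub>F s in at_top. (s powr (2 * b + 1)) *\<^sub>R (hexp z s * dprod x y s) = F s"
      using eventually_gt_at_top[of 0] by eventually_elim (simp add: hexp_def F_def X_def)
    ultimately show "(F \<longlongrightarrow> 0) at_top" by (rule Lim_transform_eventually)
  qed
  then have "(\<integral>s. hexp z s * J s \<partial>wmeas) = 0" unfolding integral_wmeas[OF hm] hf .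
  then show ?thesis unfolding int(2) by (simp add: add_eq_0_iff algebra_simps)
qed

text \<open>Multiplication by \<open>x - y + z\<close> removes the diagonal term of the system \<open>lap_ode\<close>.\<close>

definition mlap :: "real \<Rightarrow> real \<Rightarrow> complex \<Rightarrow> complex" where
  "mlap x y z = (of_real (x - y) + z) * lap x y z"

lemma mlap_DERIV:
  assumes z: "Im z > 0"
  shows "(mlap x y has_field_derivative
     - of_real b * (mlap (- x) y z / (z - of_real (x + y)) + mlap x (- y) z / (z + of_real (x + y)))) (at z)"
proof -
  have nz: "z - of_real (x + y) \<noteq> 0" "z + of_real (x + y) \<noteq> 0" using z by (auto simp: complex_eq_iff)
  have "(mlap x y has_field_derivative lap x y z + (of_real (x - y) + z) * dlap x y z) (at z)"
    unfolding mlap_def[abs_def] by (auto intro!: derivative_eq_intros lap_DERIV[OF z])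
  moreover have "mlap (- x) y z / (z - of_real (x + y)) = lap (- x) y z"
  proof -
    have "mlap (- x) y z = (z - of_real (x + y)) * lap (- x) y z" by (simp add: mlap_def algebra_simps)
    then show ?thesis using nz by (simp del: of_real_add)
  qed
  moreover have "mlap x (- y) z / (z + of_real (x + y)) = lap x (- y) z"
  proof -
    have "mlap x (- y) z = (z + of_real (x + y)) * lap x (- y) z" by (simp add: mlap_def algebra_simps)
    then show ?thesis using nz by (simp del: of_real_add)
  qed
  ultimately show ?thesis unfolding lap_ode[OF z] by (simp add: algebra_simps)
qed

text \<open>Moments of the exponential; they turn the Taylor expansion of the kernel at the origin into the
  asymptotics of the Laplace transform along the imaginary axis.\<close>

lemma hexp_moment:
  assumes \<eta>: "\<eta> > 0"
  shows "(\<integral>s. hexp (\<i> * of_real \<eta>) s * of_real s ^ n \<partial>wmeas) = of_real (Gamma (2 * b + 1 + real n) * \<eta> powr (- (2 * b + 1 + real n)))"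
    and "integrable wmeas (\<lambda>s. hexp (\<i> * of_real \<eta>) s * of_real s ^ n)"
proof -
  have r: "rapid (\<lambda>s. hexp (\<i> * of_real \<eta>) s * of_real s ^ n)"
  proof (rule rapid_growth[OF hexp_rapid, of _ _ 1 n])
    show "cmod (hexp (\<i> * of_real \<eta>) s * of_real s ^ n) \<le> 1 * (1 + \<bar>s\<bar>) ^ n * cmod (hexp (\<i> * of_real \<eta>) s)" for s
      unfolding norm_mult norm_power by (subst mult.commute) (auto intro!: mult_right_mono power_mono)
  qed (use \<eta> in simp)
  have m: "(\<lambda>s. hexp (\<i> * of_real \<eta>) s * of_real s ^ n) \<in> borel_measurable borel" by measurable
  show "integrable wmeas (\<lambda>s. hexp (\<i> * of_real \<eta>) s * of_real s ^ n)" by (rule rapid_integrable[OF m r])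
  have "(\<integral>s. hexp (\<i> * of_real \<eta>) s * of_real s ^ n \<partial>wmeas)
     = (\<integral>s. of_real (indicator {0<..} s * (s powr ((2 * b + 1 + real n) - 1) * exp (- \<eta> * s))) \<partial>lborel)"
    unfolding integral_wmeas[OF m]
  proof (rule Bochner_Integration.integral_cong[OF refl])
    fix s :: real
    show "(\<bar>s\<bar> powr (2 * b)) *\<^sub>R (hexp (\<i> * of_real \<eta>) s * of_real s ^ n)
       = of_real (indicator {0<..} s * (s powr ((2 * b + 1 + real n) - 1) * exp (- \<eta> * s)))"
    proof (cases "s > 0")
      case True
      have "\<i> * (\<i> * of_real \<eta>) * of_real s = of_real (- \<eta> * s)" by (simp add: algebra_simps)
      then have "hexp (\<i> * of_real \<eta>) s = of_real (exp (- \<eta> * s))" using True by (simp add: hexp_def exp_of_real[symmetric] del: of_real_mult)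
      moreover have "s powr ((2 * b + 1 + real n) - 1) = s powr (2 * b) * s ^ n"
        using True by (simp add: powr_add powr_realpow)
      ultimately show ?thesis using True by (simp add: scaleR_conv_of_real mult_ac)
    qed (simp add: hexp_def)
  qed
  also have "\<dots> = of_real (\<integral>s. indicator {0<..} s * (s powr ((2 * b + 1 + real n) - 1) * exp (- \<eta> * s)) \<partial>lborel)"
    by (rule integral_complex_of_real)
  also have "\<dots> = of_real (Gamma (2 * b + 1 + real n) * \<eta> powr (- (2 * b + 1 + real n)))"
    by (subst Gamma_half_line) (use b_gt \<eta> in auto)
  finally show "(\<integral>s. hexp (\<i> * of_real \<eta>) s * of_real s ^ n \<partial>wmeas) = of_real (Gamma (2 * b + 1 + real n) * \<eta> powr (- (2 * b + 1 + real n)))" .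
qed

lemma dkd_1_0: "dkd (Suc 0) 0 = of_real (1 / (2 * b + 1))"
proof -
  have "(1 + 2 * of_real b) * dkd (Suc 0) 0 = 1"
    using dkd_ode[of 0 1] by (simp add: algebra_simps)
  moreover have "(1 + 2 * of_real b :: complex) = of_real (2 * b + 1)" by simp
  moreover have "2 * b + 1 \<noteq> 0" using b_gt by simp
  ultimately show ?thesis by (simp only: of_real_divide of_real_1) (metis mult.commute nonzero_eq_divide_eq of_real_eq_0_iff)
qed

lemma dk_taylor: "\<exists>C\<ge>0. \<forall>s. cmod (dk (\<i> * of_real s) - 1 - \<i> * of_real s * of_real (1 / (2 * b + 1))) \<le> C * \<bar>s\<bar>\<^sup>2 * (1 + \<bar>s\<bar>)"
proof -
  obtain C where C: "C \<ge> 0" "\<And>s. cmod (dkd 2 (\<i> * of_real s)) \<le> C * (1 + \<bar>s\<bar>)" using dkd_bound by blast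
  have "cmod (dk (\<i> * of_real s) - 1 - \<i> * of_real s * of_real (1 / (2 * b + 1))) \<le> C * \<bar>s\<bar>\<^sup>2 * (1 + \<bar>s\<bar>)" for s
  proof -
    define S where "S = closed_segment 0 (\<i> * of_real s)"
    have "cmod (dkd 0 (\<i> * of_real s) - (\<Sum>i\<le>1. dkd i 0 * (\<i> * of_real s - 0) ^ i / fact i))
      \<le> (C * (1 + \<bar>s\<bar>)) * cmod (\<i> * of_real s - 0) ^ Suc 1 / fact 1"
    proof (rule complex_Taylor[where f = dkd and S = S])
      show "(dkd i has_field_derivative dkd (Suc i) w) (at w within S)" for i w
        by (rule has_field_derivative_at_within[OF dkd_DERIV])
      show "cmod (dkd (Suc 1) w) \<le> C * (1 + \<bar>s\<bar>)" if "w \<in> S" for w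
      proof -
        have "\<exists>u. 0 \<le> u \<and> u \<le> 1 \<and> w = (1 - u) *\<^sub>R 0 + u *\<^sub>R (\<i> * of_real s)"
          using that unfolding S_def in_segment(1) .
        then obtain u where u: "0 \<le> u" "u \<le> 1" "w = (1 - u) *\<^sub>R 0 + u *\<^sub>R (\<i> * of_real s)"
          by (elim exE conjE)
        have w: "w = \<i> * of_real (u * s)" unfolding u(3) by (simp add: scaleR_conv_of_real)
        have "cmod (dkd (Suc 1) w) \<le> C * (1 + \<bar>u * s\<bar>)" unfolding w using C(2)[of "u * s"] by (simp add: numeral_2_eq_2)
        also have "\<dots> \<le> C * (1 + \<bar>s\<bar>)" using u C(1)
        proof (intro mult_left_mono add_left_mono)
          have "\<bar>u\<bar> * \<bar>s\<bar> \<le> 1 * \<bar>s\<bar>" using u by (intro mult_right_mono) auto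
          then show "\<bar>u * s\<bar> \<le> \<bar>s\<bar>" by (simp add: abs_mult)
        qed
        finally show ?thesis .
      qed
    qed (auto simp: S_def)
    then show ?thesis by (simp add: dkd_1_0 norm_mult power2_eq_square mult_ac diff_diff_eq)
  qed
  then show ?thesis using C(1) by blast
qed

text \<open>Only the two leading coefficients matter below, and for the linear one its exact value.\<close>

lemma dprod_taylor:
  "\<exists>K\<ge>0. \<forall>s. cmod (dprod x y s - (1 + \<i> * of_real ((x - y) / (2 * b + 1)) * of_real s)) \<le> K * (\<bar>s\<bar> ^ 2 + \<bar>s\<bar> ^ 4)"
proof -
  define \<kappa> where "\<kappa> = 1 / (2 * b + 1)"
  obtain C where C: "C \<ge> 0" "\<And>s. cmod (dk (\<i> * of_real s) - 1 - \<i> * of_real s * of_real \<kappa>) \<le> C * \<bar>s\<bar>\<^sup>2 * (1 + \<bar>s\<bar>)"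
    using dk_taylor unfolding \<kappa>_def by blast
  obtain D where D: "D \<ge> 0" "\<And>x y. cmod (dline 0 x y) \<le> D * (1 + \<bar>x\<bar>) * (1 + \<bar>y\<bar>)"
    using dline_bound by blast
  define r where "r x s = dline 0 x s - (1 + \<i> * of_real (x * s) * of_real \<kappa>)" for x s
  have r: "cmod (r x s) \<le> (C * \<bar>x\<bar>\<^sup>2 * (1 + \<bar>x\<bar>)) * (\<bar>s\<bar>\<^sup>2 * (1 + \<bar>s\<bar>))" for x s
  proof -
    have "cmod (r x s) \<le> C * \<bar>x * s\<bar>\<^sup>2 * (1 + \<bar>x * s\<bar>)"
      using C(2)[of "x * s"] by (simp add: r_def dline_def diff_diff_eq)
    also have "\<dots> \<le> C * \<bar>x * s\<bar>\<^sup>2 * ((1 + \<bar>x\<bar>) * (1 + \<bar>s\<bar>))"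
      using C(1) by (intro mult_left_mono) (auto simp: abs_mult algebra_simps)
    finally show ?thesis by (simp add: abs_mult power_mult_distrib mult_ac)
  qed
  define K where "K = 2 * (C * \<bar>x\<bar>\<^sup>2 * (1 + \<bar>x\<bar>) * (D * (1 + \<bar>y\<bar>)) + (1 + \<bar>x * \<kappa>\<bar>) * (C * \<bar>y\<bar>\<^sup>2 * (1 + \<bar>y\<bar>)) + \<bar>x * \<kappa>\<bar> * \<bar>y * \<kappa>\<bar>)"
  have "cmod (dprod x y s - (1 + \<i> * of_real ((x - y) / (2 * b + 1)) * of_real s)) \<le> K * (\<bar>s\<bar> ^ 2 + \<bar>s\<bar> ^ 4)" for s
  proof -
    let ?P = "\<bar>s\<bar>\<^sup>2 * (1 + \<bar>s\<bar>)\<^sup>2"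
    have "dprod x y s - (1 + \<i> * of_real ((x - y) / (2 * b + 1)) * of_real s)
       = r x s * dline 0 (- y) s + (1 + \<i> * of_real (x * s) * of_real \<kappa>) * r (- y) s
         + (\<i> * of_real (x * s) * of_real \<kappa>) * (\<i> * of_real (- y * s) * of_real \<kappa>)"
    proof -
      have \<kappa>: "(x - y) / (2 * b + 1) = (x - y) * \<kappa>" by (simp add: \<kappa>_def)
      show ?thesis unfolding \<kappa> dprod_def r_def by (simp add: algebra_simps)
    qed
    also have "cmod \<dots> \<le> cmod (r x s) * cmod (dline 0 (- y) s) + cmod (1 + \<i> * of_real (x * s) * of_real \<kappa>) * cmod (r (- y) s)
         + cmod (\<i> * of_real (x * s) * of_real \<kappa>) * cmod (\<i> * of_real (- y * s) * of_real \<kappa>)"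
      unfolding norm_mult[symmetric] by (intro order_trans[OF norm_triangle_ineq] add_mono norm_triangle_ineq order_refl)
    also have "\<dots> \<le> ((C * \<bar>x\<bar>\<^sup>2 * (1 + \<bar>x\<bar>)) * (\<bar>s\<bar>\<^sup>2 * (1 + \<bar>s\<bar>))) * (D * (1 + \<bar>y\<bar>) * (1 + \<bar>s\<bar>))
        + ((1 + \<bar>x * \<kappa>\<bar>) * (1 + \<bar>s\<bar>)) * ((C * \<bar>y\<bar>\<^sup>2 * (1 + \<bar>y\<bar>)) * (\<bar>s\<bar>\<^sup>2 * (1 + \<bar>s\<bar>)))
        + (\<bar>x * \<kappa>\<bar> * \<bar>s\<bar>) * (\<bar>y * \<kappa>\<bar> * \<bar>s\<bar>)"
    proof (intro add_mono mult_mono)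
      show "cmod (r x s) \<le> (C * \<bar>x\<bar>\<^sup>2 * (1 + \<bar>x\<bar>)) * (\<bar>s\<bar>\<^sup>2 * (1 + \<bar>s\<bar>))" by (rule r)
      show "cmod (dline 0 (- y) s) \<le> D * (1 + \<bar>y\<bar>) * (1 + \<bar>s\<bar>)" using D(2)[of "- y" s] by simp
      show "cmod (r (- y) s) \<le> (C * \<bar>y\<bar>\<^sup>2 * (1 + \<bar>y\<bar>)) * (\<bar>s\<bar>\<^sup>2 * (1 + \<bar>s\<bar>))" using r[of "- y" s] by simp
      have "cmod (1 + \<i> * of_real (x * s) * of_real \<kappa>) \<le> cmod 1 + cmod (\<i> * of_real (x * s) * of_real \<kappa>)" by (rule norm_triangle_ineq)
      also have "\<dots> \<le> (1 + \<bar>x * \<kappa>\<bar>) * (1 + \<bar>s\<bar>)" by (simp add: norm_mult abs_mult algebra_simps)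
      finally show "cmod (1 + \<i> * of_real (x * s) * of_real \<kappa>) \<le> (1 + \<bar>x * \<kappa>\<bar>) * (1 + \<bar>s\<bar>)" .
    qed (use C(1) D(1) in \<open>auto simp: norm_mult abs_mult mult_ac\<close>)
    also have "\<dots> \<le> (C * \<bar>x\<bar>\<^sup>2 * (1 + \<bar>x\<bar>)) * (D * (1 + \<bar>y\<bar>)) * ?P + (1 + \<bar>x * \<kappa>\<bar>) * (C * \<bar>y\<bar>\<^sup>2 * (1 + \<bar>y\<bar>)) * ?P
        + \<bar>x * \<kappa>\<bar> * \<bar>y * \<kappa>\<bar> * ?P"
    proof (intro add_mono)
      have "\<bar>s\<bar>\<^sup>2 * 1 \<le> ?P" by (intro mult_left_mono) (auto simp: power2_eq_square algebra_simps)
      then have "(\<bar>x * \<kappa>\<bar> * \<bar>y * \<kappa>\<bar>) * \<bar>s\<bar>\<^sup>2 \<le> (\<bar>x * \<kappa>\<bar> * \<bar>y * \<kappa>\<bar>) * ?P" by (intro mult_left_mono) auto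
      moreover have "(\<bar>x * \<kappa>\<bar> * \<bar>s\<bar>) * (\<bar>y * \<kappa>\<bar> * \<bar>s\<bar>) = (\<bar>x * \<kappa>\<bar> * \<bar>y * \<kappa>\<bar>) * \<bar>s\<bar>\<^sup>2"
        by (simp only: power2_eq_square mult_ac)
      ultimately show "(\<bar>x * \<kappa>\<bar> * \<bar>s\<bar>) * (\<bar>y * \<kappa>\<bar> * \<bar>s\<bar>) \<le> \<bar>x * \<kappa>\<bar> * \<bar>y * \<kappa>\<bar> * ?P"
        by (simp only:)
    qed (simp_all add: power2_eq_square mult_ac)
    also have "\<dots> = K / 2 * ?P" by (simp add: K_def algebra_simps)
    also have "\<dots> \<le> K / 2 * (2 * (\<bar>s\<bar> ^ 2 + \<bar>s\<bar> ^ 4))"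
      (is "_ \<le> ?R")
    proof (intro mult_left_mono)
      have "(1 + \<bar>s\<bar>)\<^sup>2 \<le> 2 * (1 + \<bar>s\<bar>\<^sup>2)"
        using zero_le_power2[of "1 - \<bar>s\<bar>"] by (simp add: power2_eq_square algebra_simps)
      then have "?P \<le> \<bar>s\<bar>\<^sup>2 * (2 * (1 + \<bar>s\<bar>\<^sup>2))" by (intro mult_left_mono) auto
      also have "\<dots> = 2 * (\<bar>s\<bar> ^ 2 + \<bar>s\<bar> ^ 4)"
      proof -
        have "\<bar>s\<bar> ^ 4 = \<bar>s\<bar>\<^sup>2 * \<bar>s\<bar>\<^sup>2" by (simp only: power_add[symmetric]) simp
        then show ?thesis by (simp only: distrib_left mult_1_right mult_ac)
      qed
      finally show "?P \<le> 2 * (\<bar>s\<bar> ^ 2 + \<bar>s\<bar> ^ 4)" .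
      show "0 \<le> K / 2" using C(1) D(1) by (simp add: K_def)
    qed
    also have "?R = K * (\<bar>s\<bar> ^ 2 + \<bar>s\<bar> ^ 4)" by simp
    finally show ?thesis .
  qed
  moreover have "K \<ge> 0" using C(1) D(1) by (simp add: K_def)
  ultimately show ?thesis by blast
qed

end

section \<open>The Laplace transform as a Legendre function\<close>

lemma constant_on_upper_halfplane:
  assumes "\<And>z. Im z > R \<Longrightarrow> (f has_field_derivative 0) (at z)"
  obtains c where "\<And>z. Im z > R \<Longrightarrow> f z = c"
proof -
  have "\<exists>c. \<forall>z\<in>{z. Im z > R}. f z = c"
    by (rule has_field_derivative_zero_constant[OF convex_halfspace_Im_gt])
       (use assms in \<open>auto intro: has_field_derivative_at_within\<close>)
  then show ?thesis using that by blast
qed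

lemma zero_on_upper_halfplane:
  assumes "\<And>z. Im z > R \<Longrightarrow> (f has_field_derivative 0) (at z)"
    and bound: "\<And>\<eta>. \<eta> \<ge> \<eta>0 \<Longrightarrow> cmod (f (\<i> * of_real \<eta>)) \<le> K * \<eta> powr (- e)" and e: "e > 0"
    and z: "Im z > R"
  shows "f z = 0"
proof -
  obtain c where c: "\<And>z. Im z > R \<Longrightarrow> f z = c" using constant_on_upper_halfplane[OF assms(1)] by blast
  have "((\<lambda>\<eta>::real. K * \<eta> powr (- e)) \<longlongrightarrow> K * 0) at_top"
    by (intro tendsto_mult tendsto_const tendsto_neg_powr filterlim_ident) (use e in simp)
  then have lim: "((\<lambda>\<eta>::real. K * \<eta> powr (- e)) \<longlongrightarrow> 0) at_top" by simp
  have ev: "\<forall>\<^sub>F \<eta> in at_top. norm c \<le> K * \<eta> powr (- e)"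
    using eventually_ge_at_top[of \<eta>0] eventually_gt_at_top[of R]
  proof eventually_elim
    fix \<eta> assume "\<eta>0 \<le> \<eta>" "R < \<eta>"
    then show "norm c \<le> K * \<eta> powr (- e)" using bound[of \<eta>] c[of "\<i> * of_real \<eta>"] by simp
  qed
  have "((\<lambda>_::real. c) \<longlongrightarrow> 0) at_top" by (rule Lim_null_comparison[OF ev lim])
  then have "c = 0" by (simp add: tendsto_const_iff)
  then show ?thesis using c[OF z] by simp
qed

context dunkl
begin

text \<open>The relative error is of order \<open>\<eta>\<^sup>-\<^sup>2\<close>: the term of order \<open>\<eta>\<^sup>-\<^sup>1\<close> in the Laplace transform is cancelled by the
  factor \<open>x - y + i \<eta>\<close>.  With an error of order \<open>\<eta>\<^sup>-\<^sup>1\<close> the Wronskian below would be seen to vanish only for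
  \<open>b > - 1/4\<close>.\<close>

lemma mlap_asymp:
  "\<exists>K\<ge>0. \<forall>\<eta>\<ge>1. cmod (mlap x y (\<i> * of_real \<eta>) - \<i> * of_real (Gamma (2 * b + 1) * \<eta> powr (- 2 * b))) \<le> K * \<eta> powr (- 2 * b - 2)"
proof -
  define d where "d = x - y"
  define G0 where "G0 = Gamma (2 * b + 1)"
  define r where "r s = dprod x y s - (1 + \<i> * of_real (d / (2 * b + 1)) * of_real s)" for s
  obtain K where K: "K \<ge> 0" "\<And>s. cmod (r s) \<le> K * (\<bar>s\<bar> ^ 2 + \<bar>s\<bar> ^ 4)"
    using dprod_taylor unfolding r_def d_def by blast
  define L where "L = K * (Gamma (2 * b + 3) + Gamma (2 * b + 5))"
  have L: "L \<ge> 0" using K(1) b_gt Gamma_real_pos[of "2 * b + 3"] Gamma_real_pos[of "2 * b + 5"] by (simp add: L_def)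
  have G2: "Gamma (2 * b + 2) = (2 * b + 1) * G0"
  proof -
    have "2 * b + 1 \<notin> \<int>\<^sub>\<le>\<^sub>0" using b_gt by (auto elim!: nonpos_Ints_cases)
    from Gamma_plus1[OF this] show ?thesis by (simp add: G0_def add_ac)
  qed
  have "cmod (mlap x y (\<i> * of_real \<eta>) - \<i> * of_real (G0 * \<eta> powr (- 2 * b))) \<le> (\<bar>G0\<bar> * d\<^sup>2 + (\<bar>d\<bar> + 1) * L) * \<eta> powr (- 2 * b - 2)"
    if \<eta>: "\<eta> \<ge> 1" for \<eta>
  proof -
    let ?z = "\<i> * of_real \<eta> :: complex"
    have \<eta>0: "\<eta> > 0" using \<eta> by simp
    note mom = hexp_moment[OF \<eta>0]
    have rm: "r \<in> borel_measurable borel" unfolding r_def[abs_def] by measurable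
    have hn: "hexp ?z s * of_real s ^ n = of_real (cmod (hexp ?z s) * s ^ n)" for s n
    proof (cases "s > 0")
      case True
      have "\<i> * ?z * of_real s = of_real (- \<eta> * s)" by (simp add: algebra_simps)
      then have "hexp ?z s = of_real (exp (- \<eta> * s))" using True by (simp add: hexp_def exp_of_real[symmetric] del: of_real_mult)
      then show ?thesis by simp
    qed (simp add: hexp_def)
    have cm: "(\<integral>s. cmod (hexp ?z s) * s ^ n \<partial>wmeas) = Gamma (2 * b + 1 + real n) * \<eta> powr (- (2 * b + 1 + real n))"
      "integrable wmeas (\<lambda>s. cmod (hexp ?z s) * s ^ n)" for n
      using mom[of n] unfolding hn integral_complex_of_real complex_of_real_integrable_eq of_real_eq_iff by auto
    have rint: "integrable wmeas (\<lambda>s. hexp ?z s * r s)" and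
        rle: "cmod (\<integral>s. hexp ?z s * r s \<partial>wmeas) \<le> L * \<eta> powr (- 2 * b - 3)"
    proof -
      have i: "integrable wmeas (\<lambda>s. K * (cmod (hexp ?z s) * s ^ 2 + cmod (hexp ?z s) * s ^ 4))"
        by (intro integrable_mult_right Bochner_Integration.integrable_add cm)
      have le: "cmod (hexp ?z s * r s) \<le> K * (cmod (hexp ?z s) * s ^ 2 + cmod (hexp ?z s) * s ^ 4)" for s
        using mult_left_mono[OF K(2)[of s], of "cmod (hexp ?z s)"] by (simp add: norm_mult algebra_simps)
      show ri: "integrable wmeas (\<lambda>s. hexp ?z s * r s)"
        by (rule Bochner_Integration.integrable_bound[OF i])
           (use rm in measurable, auto intro!: AE_I2 order_trans[OF le])
      have "cmod (\<integral>s. hexp ?z s * r s \<partial>wmeas) \<le> (\<integral>s. cmod (hexp ?z s * r s) \<partial>wmeas)" by simp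
      also have "\<dots> \<le> (\<integral>s. K * (cmod (hexp ?z s) * s ^ 2 + cmod (hexp ?z s) * s ^ 4) \<partial>wmeas)"
        by (intro integral_mono integrable_norm ri i le)
      also have "\<dots> = K * (Gamma (2 * b + 3) * \<eta> powr (- 2 * b - 3) + Gamma (2 * b + 5) * \<eta> powr (- 2 * b - 5))"
        by (simp add: Bochner_Integration.integral_add cm add.assoc diff_conv_add_uminus[symmetric])
      also have "\<dots> \<le> K * (Gamma (2 * b + 3) * \<eta> powr (- 2 * b - 3) + Gamma (2 * b + 5) * \<eta> powr (- 2 * b - 3))"
        using K(1) \<eta> b_gt Gamma_real_pos[of "2 * b + 5"]
        by (intro mult_left_mono add_left_mono powr_mono) auto
      finally show "cmod (\<integral>s. hexp ?z s * r s \<partial>wmeas) \<le> L * \<eta> powr (- 2 * b - 3)" by (simp add: L_def algebra_simps)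
    qed
    define \<rho> where "\<rho> = (\<integral>s. hexp ?z s * r s \<partial>wmeas)"
    define p where "p = \<eta> powr (- 2 * b - 2)"
    have pp: "\<eta> powr (- (2 * b + 1)) = \<eta> * p" "\<eta> powr (- 2 * b) = \<eta>\<^sup>2 * p" "\<eta> powr (- (2 * b + 2)) = p" "\<eta> * \<eta> powr (- 2 * b - 3) = p"
    proof -
      have *: "\<eta> * \<eta> powr a = \<eta> powr c" if "1 + a = c" for a c
        using powr_mult_base[of \<eta> a] \<eta>0 that by simp
      show "\<eta> powr (- (2 * b + 1)) = \<eta> * p" unfolding p_def by (rule *[symmetric]) simp
      show "\<eta> powr (- 2 * b) = \<eta>\<^sup>2 * p"
        unfolding p_def power2_eq_square mult.assoc *[OF refl] by (rule arg_cong[where f = "(powr) \<eta>"]) simp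
      show "\<eta> powr (- (2 * b + 2)) = p" unfolding p_def by (rule arg_cong[where f = "(powr) \<eta>"]) simp
      show "\<eta> * \<eta> powr (- 2 * b - 3) = p" unfolding p_def by (rule *) simp
    qed
    have "lap x y ?z = (\<integral>s. hexp ?z s * of_real s ^ 0 + (\<i> * of_real (d / (2 * b + 1))) * (hexp ?z s * of_real s ^ 1) + hexp ?z s * r s \<partial>wmeas)"
      unfolding lap_def by (rule Bochner_Integration.integral_cong) (auto simp: r_def algebra_simps)
    also have "\<dots> = (\<integral>s. hexp ?z s * of_real s ^ 0 \<partial>wmeas) + (\<i> * of_real (d / (2 * b + 1))) * (\<integral>s. hexp ?z s * of_real s ^ 1 \<partial>wmeas) + \<rho>"
      unfolding \<rho>_def by (simp only: Bochner_Integration.integral_add Bochner_Integration.integrable_add integral_mult_right_zero integrable_mult_right mom(2) rint)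
    also have "\<dots> = of_real (G0 * \<eta> powr (- (2 * b + 1))) + (\<i> * of_real (d / (2 * b + 1))) * of_real (Gamma (2 * b + 2) * \<eta> powr (- (2 * b + 2))) + \<rho>"
      unfolding mom(1) G0_def by (simp add: add.assoc)
    also have "(\<i> * of_real (d / (2 * b + 1))) * of_real (Gamma (2 * b + 2) * \<eta> powr (- (2 * b + 2))) = \<i> * of_real (d * G0 * p)"
    proof -
      have "2 * b + 1 \<noteq> 0" using b_gt by simp
      then have "d / (2 * b + 1) * ((2 * b + 1) * G0 * p) = d * G0 * p" by simp
      then show ?thesis unfolding G2 pp mult.assoc of_real_mult[symmetric] by (simp only:)
    qed
    finally have lap: "lap x y ?z = of_real (G0 * (\<eta> * p)) + \<i> * of_real (d * G0 * p) + \<rho>" unfolding pp .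
    have "mlap x y ?z - \<i> * of_real (G0 * (\<eta>\<^sup>2 * p)) = \<i> * of_real (G0 * d\<^sup>2 * p) + (of_real d + ?z) * \<rho>"
      unfolding mlap_def lap d_def[symmetric] by (simp add: algebra_simps power2_eq_square)
    also have "cmod \<dots> \<le> cmod (\<i> * of_real (G0 * d\<^sup>2 * p)) + cmod ((of_real d + ?z) * \<rho>)" by (rule norm_triangle_ineq)
    also have "\<dots> \<le> \<bar>G0\<bar> * d\<^sup>2 * p + (\<bar>d\<bar> + 1) * L * p"
    proof (rule add_mono)
      show "cmod (\<i> * of_real (G0 * d\<^sup>2 * p)) \<le> \<bar>G0\<bar> * d\<^sup>2 * p" by (simp add: norm_mult norm_power p_def)
      have "cmod (of_real d + ?z) \<le> \<bar>d\<bar> + \<eta>" using norm_triangle_ineq[of "of_real d" ?z] \<eta> by (simp add: norm_mult)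
      also have "\<dots> \<le> (\<bar>d\<bar> + 1) * \<eta>" 
      proof -
        have "\<bar>d\<bar> * 1 \<le> \<bar>d\<bar> * \<eta>" using \<eta> by (intro mult_left_mono) auto
        then show ?thesis by (simp add: distrib_right)
      qed
      finally have "cmod ((of_real d + ?z) * \<rho>) \<le> ((\<bar>d\<bar> + 1) * \<eta>) * (L * \<eta> powr (- 2 * b - 3))"
        unfolding norm_mult \<rho>_def by (intro mult_mono rle) (use \<eta> in auto)
      also have "\<dots> = (\<bar>d\<bar> + 1) * L * (\<eta> * \<eta> powr (- 2 * b - 3))" by (simp only: mult_ac)
      finally show "cmod ((of_real d + ?z) * \<rho>) \<le> (\<bar>d\<bar> + 1) * L * p" unfolding pp .
    qed
    finally show ?thesis unfolding pp p_def[symmetric] by (simp add: algebra_simps)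
  qed
  then show ?thesis unfolding G0_def[symmetric] using L
    by (intro exI[of _ "\<bar>G0\<bar> * d\<^sup>2 + (\<bar>d\<bar> + 1) * L"]) auto
qed

text \<open>Both sides have the same derivative, and their difference tends to zero along the imaginary
  axis.\<close>

lemma mlap_even:
  assumes z: "Im z > 0" shows "mlap (- x) (- y) z = mlap x y z"
proof -
  obtain K1 where K1: "\<And>\<eta>. \<eta> \<ge> 1 \<Longrightarrow> cmod (mlap x y (\<i> * of_real \<eta>) - \<i> * of_real (Gamma (2 * b + 1) * \<eta> powr (- 2 * b))) \<le> K1 * \<eta> powr (- 2 * b - 2)"
    using mlap_asymp by blast
  obtain K2 where K2: "\<And>\<eta>. \<eta> \<ge> 1 \<Longrightarrow> cmod (mlap (- x) (- y) (\<i> * of_real \<eta>) - \<i> * of_real (Gamma (2 * b + 1) * \<eta> powr (- 2 * b))) \<le> K2 * \<eta> powr (- 2 * b - 2)"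
    using mlap_asymp by blast
  have "mlap (- x) (- y) z - mlap x y z = 0"
  proof (rule zero_on_upper_halfplane[where R = 0 and f = "\<lambda>z. mlap (- x) (- y) z - mlap x y z"])
    fix z :: complex assume z: "0 < Im z"
    from DERIV_diff[OF mlap_DERIV[OF z, of "- x" "- y"] mlap_DERIV[OF z, of x y]]
    show "((\<lambda>z. mlap (- x) (- y) z - mlap x y z) has_field_derivative 0) (at z)"
      by (simp add: algebra_simps)
  next
    fix \<eta> :: real assume \<eta>: "\<eta> \<ge> 1"
    show "cmod (mlap (- x) (- y) (\<i> * of_real \<eta>) - mlap x y (\<i> * of_real \<eta>)) \<le> (K1 + K2) * \<eta> powr (- (2 * b + 2))"
    proof -
      let ?m = "\<i> * of_real (Gamma (2 * b + 1) * \<eta> powr (- 2 * b)) :: complex"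
      have "cmod (mlap (- x) (- y) (\<i> * of_real \<eta>) - mlap x y (\<i> * of_real \<eta>))
          \<le> cmod (mlap (- x) (- y) (\<i> * of_real \<eta>) - ?m) + cmod (mlap x y (\<i> * of_real \<eta>) - ?m)"
        using norm_triangle_ineq4[of "mlap (- x) (- y) (\<i> * of_real \<eta>) - ?m" "mlap x y (\<i> * of_real \<eta>) - ?m"] by simp
      also have "\<dots> \<le> K2 * \<eta> powr (- 2 * b - 2) + K1 * \<eta> powr (- 2 * b - 2)" by (intro add_mono K1 K2 \<eta>)
      also have "- 2 * b - 2 = - (2 * b + 2)" by simp
      finally show ?thesis by (simp only: distrib_right add.commute)
    qed
  qed (use b_gt z in auto)
  then show ?thesis by simp
qed

lemma mlap_DERIV':
  assumes z: "Im z > 0"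
  shows "(mlap x y has_field_derivative - 2 * of_real b * z * mlap (- x) y z / (z\<^sup>2 - (of_real (x + y))\<^sup>2)) (at z)"
proof -
  have nz: "z - of_real (x + y) \<noteq> 0" "z + of_real (x + y) \<noteq> 0" using z by (auto simp: complex_eq_iff)
  have e: "mlap x (- y) z = mlap (- x) y z" using mlap_even[OF z, of "- x" y] by simp
  have eq: "- of_real b * (m / (z - a) + m / (z + a)) = - 2 * of_real b * z * m / (z\<^sup>2 - a\<^sup>2)"
    if "z - a \<noteq> 0" "z + a \<noteq> 0" for m a :: complex
  proof -
    have "z\<^sup>2 - a\<^sup>2 = (z - a) * (z + a)" by (simp add: power2_eq_square algebra_simps)
    moreover have "m / (z - a) + m / (z + a) = (2 * z * m) / ((z - a) * (z + a))"
      using that by (simp add: divide_simps) (simp add: algebra_simps)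
    ultimately show ?thesis by (simp add: mult_ac)
  qed
  from mlap_DERIV[OF z, of x y] show ?thesis unfolding e eq[OF nz] .
qed

text \<open>The Gauss series of the Legendre functions, written with the generalized factorials: its even and
  its odd part are those of \<open>Q\<^bsub>b-1\<^esub>\<close> and \<open>Q\<^bsub>b\<^esub>\<close>.\<close>

definition lcoef :: "nat \<Rightarrow> real" where
  "lcoef n = pochhammer b n / dfact n"

definition legs :: "complex \<Rightarrow> complex" where
  "legs u = (\<Sum>n. of_real (lcoef n) * u ^ n)"

lemma lcoef_0 [simp]: "lcoef 0 = 1" by (simp add: lcoef_def)

lemma lcoef_Suc: "dnum (Suc n) * lcoef (Suc n) = (b + real n) * lcoef n"
  using dnum_pos[of "Suc n"] dfact_pos[of n] by (simp add: lcoef_def dfact_Suc pochhammer_Suc)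

lemma legs_summable:
  assumes u: "cmod u < 1" shows "summable (\<lambda>n. of_real (lcoef n) * u ^ n)"
proof -
  define c where "c = (1 + cmod u) / 2"
  have c: "cmod u < c" "c < 1" using u by (auto simp: c_def)
  have c0: "c \<ge> 0" using c(1) norm_ge_zero[of u] by linarith
  define N where "N = nat \<lceil>3 * \<bar>b\<bar> / (c - cmod u)\<rceil>"
  show ?thesis
  proof (rule summable_ratio_test[OF c(2)])
    fix n assume n: "n \<ge> N"
    have "3 * \<bar>b\<bar> / (c - cmod u) \<le> real n" using n unfolding N_def by linarith
    then have 1: "3 * \<bar>b\<bar> \<le> real n * c - real n * cmod u" using c by (simp add: field_simps)
    have 2: "real (Suc n) - 2 * \<bar>b\<bar> \<le> dnum (Suc n)" by (cases "even n") (auto simp: dnum_def)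
    have "\<bar>b\<bar> * cmod u \<le> \<bar>b\<bar> * 1" "c * \<bar>b\<bar> \<le> 1 * \<bar>b\<bar>" using u c by (intro mult_left_mono mult_right_mono; simp)+
    then have "(\<bar>b\<bar> + real n) * cmod u \<le> c * (real (Suc n) - 2 * \<bar>b\<bar>)"
      using 1 c0 by (simp add: algebra_simps)
    also have "\<dots> \<le> c * dnum (Suc n)" using 2 c(1) norm_ge_zero[of u] by (intro mult_left_mono) linarith+
    finally have 3: "(\<bar>b\<bar> + real n) * cmod u \<le> c * dnum (Suc n)" .
    have "\<bar>b + real n\<bar> * cmod u \<le> (\<bar>b\<bar> + real n) * cmod u" by (intro mult_right_mono) auto
    with 3 have 4: "\<bar>b + real n\<bar> * cmod u \<le> c * dnum (Suc n)" by simp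
    have dp: "dnum (Suc n) > 0" by (rule dnum_pos) simp
    have "dnum (Suc n) * norm (of_real (lcoef (Suc n)) * u ^ Suc n) = \<bar>dnum (Suc n) * lcoef (Suc n)\<bar> * (cmod u * cmod u ^ n)"
      using dp by (simp add: norm_mult norm_power abs_mult)
    also have "\<dots> = (\<bar>b + real n\<bar> * cmod u) * (\<bar>lcoef n\<bar> * cmod u ^ n)" unfolding lcoef_Suc by (simp add: abs_mult mult_ac)
    also have "\<dots> \<le> (c * dnum (Suc n)) * (\<bar>lcoef n\<bar> * cmod u ^ n)" by (intro mult_right_mono 4) auto
    also have "\<dots> = dnum (Suc n) * (c * norm (of_real (lcoef n) * u ^ n))" by (simp add: norm_mult norm_power mult_ac)
    finally show "norm (of_real (lcoef (Suc n)) * u ^ Suc n) \<le> c * norm (of_real (lcoef n) * u ^ n)"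
      using dp by (subst (asm) mult_le_cancel_left_pos)
  qed
qed

lemma legs_0 [simp]: "legs 0 = 1"
  unfolding legs_def by (subst powser_zero) simp

definition dlegs :: "complex \<Rightarrow> complex" where
  "dlegs u = (\<Sum>n. diffs (\<lambda>n. of_real (lcoef n)) n * u ^ n)"

lemma legs_DERIV: "cmod u < 1 \<Longrightarrow> (legs has_field_derivative dlegs u) (at u)"
  unfolding legs_def[abs_def] dlegs_def by (rule powser_euler(1)[OF legs_summable, of 1])

lemma legs_holomorphic: "legs holomorphic_on ball 0 1"
  unfolding holomorphic_on_def field_differentiable_def
proof
  fix u :: complex assume "u \<in> ball 0 1"
  then have "(legs has_field_derivative dlegs u) (at u within ball 0 1)"
    by (intro has_field_derivative_at_within[OF legs_DERIV]) simp
  then show "\<exists>f'. (legs has_field_derivative f') (at u within ball 0 1)" ..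
qed

text \<open>The recursion of the coefficients, \<open>dnum (n + 1) lcoef (n + 1) = (b + n) lcoef n\<close>, combined with
  \<open>b + n - dnum n = b (-1)\<^sup>n\<close>.\<close>

lemma legs_ode:
  assumes u: "cmod u < 1"
  shows "(1 - u) * (of_real b * legs u + u * dlegs u) = of_real b * legs (- u)"
proof -
  let ?c = "\<lambda>n. of_real (lcoef n) :: complex"
  have S: "(\<lambda>n. ?c n * v ^ n) sums legs v" if "cmod v < 1" for v
    unfolding legs_def by (rule summable_sums[OF legs_summable[OF that]])
  have "(\<lambda>n. of_real b * (?c n * u ^ n) + of_nat n * ?c n * u ^ n) sums (of_real b * legs u + u * dlegs u)"
    unfolding dlegs_def by (intro sums_add sums_mult S u powser_euler(2)[OF legs_summable, of 1])
  moreover have "of_real b * (?c n * u ^ n) + of_nat n * ?c n * u ^ n = of_real ((b + real n) * lcoef n) * u ^ n" for n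
    by (simp add: algebra_simps)
  ultimately have D: "(\<lambda>n. of_real ((b + real n) * lcoef n) * u ^ n) sums (of_real b * legs u + u * dlegs u)" by simp
  have "(\<lambda>n. u * (of_real ((b + real n) * lcoef n) * u ^ n)) sums (u * (of_real b * legs u + u * dlegs u))"
    by (rule sums_mult[OF D])
  moreover have "u * (of_real ((b + real n) * lcoef n) * u ^ n) = of_real (dnum (Suc n) * lcoef (Suc n)) * u ^ Suc n" for n
    by (simp only: lcoef_Suc power_Suc mult_ac)
  ultimately have "(\<lambda>n. of_real (dnum (Suc n) * lcoef (Suc n)) * u ^ Suc n) sums (u * (of_real b * legs u + u * dlegs u))"
    by (simp only:)
  then have E: "(\<lambda>n. of_real (dnum n * lcoef n) * u ^ n) sums (u * (of_real b * legs u + u * dlegs u))"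
    by (subst (asm) sums_Suc_iff) simp
  have "(\<lambda>n. of_real ((b + real n) * lcoef n) * u ^ n - of_real (dnum n * lcoef n) * u ^ n)
      sums ((of_real b * legs u + u * dlegs u) - u * (of_real b * legs u + u * dlegs u))"
    by (rule sums_diff[OF D E])
  moreover have "of_real ((b + real n) * lcoef n) * u ^ n - of_real (dnum n * lcoef n) * u ^ n = of_real b * (?c n * (- u) ^ n)" for n
    by (cases "even n") (simp_all add: dnum_def algebra_simps)
  ultimately have "(\<lambda>n. of_real b * (?c n * (- u) ^ n)) sums ((1 - u) * (of_real b * legs u + u * dlegs u))"
    by (simp add: left_diff_distrib)
  moreover have "(\<lambda>n. of_real b * (?c n * (- u) ^ n)) sums (of_real b * legs (- u))"
    using u by (intro sums_mult S) simp
  ultimately show ?thesis by (rule sums_unique2)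
qed

text \<open>The argument of the Legendre functions is \<open>qq x y z / (x y)\<close>.\<close>

definition qq :: "real \<Rightarrow> real \<Rightarrow> complex \<Rightarrow> complex" where
  "qq x y z = (of_real (x\<^sup>2 + y\<^sup>2) - z\<^sup>2) / 2"

lemma qq_nonpos:
  assumes "Im z > 0" shows "qq x y z \<notin> \<real>\<^sub>\<le>\<^sub>0"
proof
  assume "qq x y z \<in> \<real>\<^sub>\<le>\<^sub>0"
  then have I: "Im (qq x y z) = 0" and R: "Re (qq x y z) \<le> 0" by (auto simp: complex_nonpos_Reals_iff)
  have "Re z = 0" using I assms by (simp add: qq_def power2_eq_square)
  then have "Re (qq x y z) = (x\<^sup>2 + y\<^sup>2 + (Im z)\<^sup>2) / 2" by (simp add: qq_def power2_eq_square)
  moreover have "x\<^sup>2 + y\<^sup>2 + (Im z)\<^sup>2 > 0" using assms by (intro add_nonneg_pos) auto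
  ultimately show False using R by simp
qed

lemma qq_nonzero: "Im z > 0 \<Longrightarrow> qq x y z \<noteq> 0"
  using qq_nonpos[of z x y] by auto

lemma qq_lower: "2 * cmod (qq x y z) \<ge> (Im z)\<^sup>2 - x\<^sup>2 - y\<^sup>2"
proof -
  have "(Im z)\<^sup>2 \<le> (cmod z)\<^sup>2" using abs_Im_le_cmod[of z] by (metis abs_ge_zero power2_abs power_mono)
  also have "\<dots> = cmod (z\<^sup>2)" by (simp add: norm_power)
  also have "\<dots> \<le> cmod (of_real (x\<^sup>2 + y\<^sup>2)) + cmod (of_real (x\<^sup>2 + y\<^sup>2) - z\<^sup>2)"
    using norm_triangle_ineq4[of "of_real (x\<^sup>2 + y\<^sup>2)" "of_real (x\<^sup>2 + y\<^sup>2) - z\<^sup>2"] by simp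
  also have "cmod (of_real (x\<^sup>2 + y\<^sup>2)) = x\<^sup>2 + y\<^sup>2" unfolding norm_of_real by simp
  also have "cmod (of_real (x\<^sup>2 + y\<^sup>2) - z\<^sup>2) = 2 * cmod (qq x y z)" by (simp add: qq_def norm_divide)
  finally show ?thesis by simp
qed

lemma qq_large:
  assumes z: "Im z > \<bar>x\<bar> + \<bar>y\<bar>" shows "\<bar>x * y\<bar> < cmod (qq x y z)" "cmod (- of_real (x * y) / qq x y z) < 1"
proof -
  have "(\<bar>x\<bar> + \<bar>y\<bar>)\<^sup>2 < (Im z)\<^sup>2" using z by (intro power_strict_mono) auto
  moreover have "(\<bar>x\<bar> + \<bar>y\<bar>)\<^sup>2 = x\<^sup>2 + y\<^sup>2 + 2 * \<bar>x * y\<bar>" by (simp add: power2_eq_square algebra_simps abs_mult)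
  ultimately show *: "\<bar>x * y\<bar> < cmod (qq x y z)" using qq_lower[where x = x and y = y and z = z] by linarith
  then have "cmod (qq x y z) > 0" by (rule le_less_trans[rotated]) simp
  then show "cmod (- of_real (x * y) / qq x y z) < 1" using * by (simp add: norm_divide norm_mult abs_mult)
qed

text \<open>The function \<open>\<Phi>\<^sub>b(x, y; z)\<close> up to a constant, as given by the expansion at infinity.\<close>

definition phis :: "real \<Rightarrow> real \<Rightarrow> complex \<Rightarrow> complex" where
  "phis x y z = qq x y z powr (- of_real b) * legs (- of_real (x * y) / qq x y z)"

lemma qq_minus: "qq (- x) y z = qq x y z" by (simp add: qq_def)

text \<open>With \<open>u = - x y / q\<close> the chain rule produces exactly the combination on the left of \<open>legs_ode\<close>.  The
  outcome is the linear system that \<open>mlap_DERIV'\<close> gives for \<open>mlap\<close>.\<close>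

lemma phis_DERIV:
  assumes z: "Im z > \<bar>x\<bar> + \<bar>y\<bar>"
  shows "(phis x y has_field_derivative - 2 * of_real b * z * phis (- x) y z / (z\<^sup>2 - (of_real (x + y))\<^sup>2)) (at z)"
proof -
  have z0: "Im z > 0" using z by linarith
  define q where "q = qq x y z"
  define a where "a = (of_real (x * y) :: complex)"
  define u where "u = - a / q"
  have q: "q \<notin> \<real>\<^sub>\<le>\<^sub>0" "q \<noteq> 0" unfolding q_def using qq_nonpos[OF z0] qq_nonzero[OF z0] by auto
  have u: "cmod u < 1" unfolding u_def a_def q_def by (rule qq_large[OF z])
  have dq: "(qq x y has_field_derivative - z) (at z)"
    unfolding qq_def[abs_def] by (auto intro!: derivative_eq_intros)
  have 1: "((\<lambda>z. qq x y z powr (- of_real b)) has_field_derivative (- of_real b * q powr (- of_real b - 1)) * (- z)) (at z)"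
    unfolding q_def by (rule DERIV_chain2[OF has_field_derivative_powr dq]) (use q q_def in auto)
  have 2: "((\<lambda>z. - a / qq x y z) has_field_derivative - (a * z / q\<^sup>2)) (at z)"
    using q(2) unfolding q_def by (auto intro!: derivative_eq_intros dq simp: power2_eq_square)
  have 3: "((\<lambda>z. legs (- a / qq x y z)) has_field_derivative dlegs u * (- (a * z / q\<^sup>2))) (at z)"
    by (rule DERIV_chain2[OF _ 2]) (use legs_DERIV[OF u] in \<open>simp add: u_def q_def\<close>)
  have D: "(phis x y has_field_derivative (- of_real b * q powr (- of_real b - 1)) * (- z) * legs u
        + dlegs u * (- (a * z / q\<^sup>2)) * q powr (- of_real b)) (at z)"
    using DERIV_mult[OF 1 3] unfolding phis_def[abs_def] a_def q_def u_def by simp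
  have "(- of_real b * q powr (- of_real b - 1)) * (- z) * legs u + dlegs u * (- (a * z / q\<^sup>2)) * q powr (- of_real b)
     = z * q powr (- of_real b) / q * (of_real b * legs u + u * dlegs u)"
    using q(2) by (simp add: powr_diff u_def power2_eq_square field_simps)
  also have "\<dots> = z * q powr (- of_real b) / (q * (1 - u)) * ((1 - u) * (of_real b * legs u + u * dlegs u))"
    using u by auto
  also have "\<dots> = z * q powr (- of_real b) / (q * (1 - u)) * (of_real b * legs (- u))" unfolding legs_ode[OF u] ..
  also have "q * (1 - u) = q + a" using q(2) by (simp add: u_def field_simps)
  also have "q + a = - (z\<^sup>2 - (of_real (x + y))\<^sup>2) / 2"
  proof -
    have "(of_real (x + y) :: complex)\<^sup>2 = of_real (x\<^sup>2 + y\<^sup>2) + 2 * of_real (x * y)"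
      by (simp add: power2_eq_square algebra_simps)
    then show ?thesis by (simp add: q_def qq_def a_def add_divide_distrib diff_divide_distrib)
  qed
  also have "z * q powr (- of_real b) / (- (z\<^sup>2 - (of_real (x + y))\<^sup>2) / 2) * (of_real b * legs (- u))
     = - 2 * of_real b * z * phis (- x) y z / (z\<^sup>2 - (of_real (x + y))\<^sup>2)"
  proof -
    have gen: "w * P / (- D / 2) * (c * L) = - 2 * c * w * (P * L) / D" for w P D c L :: complex
      by (cases "D = 0") (simp_all add: field_simps)
    have ph: "phis (- x) y z = q powr (- of_real b) * legs (- u)"
      by (simp add: phis_def qq_minus q_def u_def a_def)
    show ?thesis unfolding ph by (rule gen)
  qed
  finally show ?thesis using D by simp
qed

lemma legs_lipschitz: "\<exists>K\<ge>0. \<forall>u. cmod u \<le> 1/2 \<longrightarrow> cmod (legs u) \<le> K \<and> cmod (legs (- u) - legs u) \<le> K * cmod u"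
proof -
  have "continuous_on (cball 0 (1/2)) (deriv legs)"
    by (intro holomorphic_on_imp_continuous_on holomorphic_on_subset[OF holomorphic_deriv[OF legs_holomorphic]]) auto
  then have "compact (deriv legs ` cball 0 (1/2))" by (intro compact_continuous_image) auto
  then have "bounded (deriv legs ` cball 0 (1/2))" by (rule compact_imp_bounded)
  then obtain B where B0: "\<forall>u\<in>cball 0 (1/2). cmod (deriv legs u) \<le> B" unfolding bounded_iff by blast
  have B: "cmod (dlegs u) \<le> B" if "u \<in> cball 0 (1/2)" for u
    using bspec[OF B0 that] DERIV_imp_deriv[OF legs_DERIV, of u] that by simp
  have B1: "B \<ge> 0" using B[of 0] norm_ge_zero[of "dlegs 0"] by (simp del: norm_ge_zero)
  have lip: "cmod (legs u - legs v) \<le> B * cmod (u - v)" if "u \<in> cball 0 (1/2)" "v \<in> cball 0 (1/2)" for u v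
  proof (rule field_differentiable_bound[OF convex_cball[of 0 "1/2"] _ _ that])
    fix w :: complex assume w: "w \<in> cball 0 (1/2)"
    show "(legs has_field_derivative dlegs w) (at w within cball 0 (1/2))"
      by (rule has_field_derivative_at_within[OF legs_DERIV]) (use w in auto)
    show "cmod (dlegs w) \<le> B" by (rule B[OF w])
  qed
  have "cmod (legs u) \<le> 2 * B + 1 \<and> cmod (legs (- u) - legs u) \<le> (2 * B + 1) * cmod u" if u: "cmod u \<le> 1/2" for u
  proof
    have "cmod (legs u) \<le> cmod (legs u - legs 0) + 1" using norm_triangle_ineq[of "legs u - legs 0" "legs 0"] by simp
    also have "cmod (legs u - legs 0) \<le> B * cmod (u - 0)" by (rule lip) (use u in auto)
    also have "\<dots> \<le> B * 1" using u B1 by (intro mult_left_mono) auto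
    finally show "cmod (legs u) \<le> 2 * B + 1" using B1 by simp
    have "cmod (legs (- u) - legs u) \<le> B * cmod (- u - u)" by (rule lip) (use u in auto)
    also have "cmod (- u - u) = 2 * cmod u"
    proof -
      have "- u - u = (- 2) * u" by simp
      then show ?thesis by (simp only: norm_mult) simp
    qed
    also have "B * (2 * cmod u) \<le> (2 * B + 1) * cmod u" by (simp add: algebra_simps)
    finally show "cmod (legs (- u) - legs u) \<le> (2 * B + 1) * cmod u" .
  qed
  then show ?thesis using B1 by (intro exI[of _ "2 * B + 1"]) auto
qed

lemma qq_imag: "qq x y (\<i> * of_real \<eta>) = of_real ((x\<^sup>2 + y\<^sup>2 + \<eta>\<^sup>2) / 2)"
  by (simp add: qq_def power_mult_distrib)

lemma phis_imag:
  assumes \<eta>: "\<eta> > 0"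
  shows "phis x y (\<i> * of_real \<eta>) = of_real (((x\<^sup>2 + y\<^sup>2 + \<eta>\<^sup>2) / 2 / \<eta>\<^sup>2) powr (- b) * \<eta> powr (- 2 * b)) * legs (- of_real (x * y / ((x\<^sup>2 + y\<^sup>2 + \<eta>\<^sup>2) / 2)))"
proof -
  define q where "q = (x\<^sup>2 + y\<^sup>2 + \<eta>\<^sup>2) / 2"
  have q: "q > 0" using \<eta> unfolding q_def by (intro divide_pos_pos add_nonneg_pos) auto
  have "q powr (- b) = (q / \<eta>\<^sup>2 * \<eta>\<^sup>2) powr (- b)" using \<eta> by simp
  also have "\<dots> = (q / \<eta>\<^sup>2) powr (- b) * (\<eta>\<^sup>2) powr (- b)" using q \<eta> by (intro powr_mult)
  also have "(\<eta>\<^sup>2) powr (- b) = (\<eta> powr 2) powr (- b)" using \<eta> by simp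
  also have "\<dots> = \<eta> powr (- 2 * b)" unfolding powr_powr by simp
  finally have 1: "q powr (- b) = (q / \<eta>\<^sup>2) powr (- b) * \<eta> powr (- 2 * b)" .
  have "of_real q powr (- of_real b) = (of_real (q powr (- b)) :: complex)"
    using powr_of_real[of q "- b"] q by simp
  then show ?thesis unfolding phis_def qq_imag q_def[symmetric] 1 by simp
qed

lemma phis_bounds:
  "\<exists>K \<eta>0. \<eta>0 \<ge> 1 \<and> K \<ge> 0 \<and> (\<forall>\<eta>\<ge>\<eta>0. cmod (phis x y (\<i> * of_real \<eta>)) \<le> K * \<eta> powr (- 2 * b)
       \<and> cmod (phis (- x) y (\<i> * of_real \<eta>) - phis x y (\<i> * of_real \<eta>)) \<le> K * \<eta> powr (- 2 * b - 2))"
proof -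
  obtain K where K: "K \<ge> 0" "\<And>u. cmod u \<le> 1/2 \<Longrightarrow> cmod (legs u) \<le> K" "\<And>u. cmod u \<le> 1/2 \<Longrightarrow> cmod (legs (- u) - legs u) \<le> K * cmod u"
    using legs_lipschitz by blast
  define c where "c = x\<^sup>2 + y\<^sup>2"
  have c: "c \<ge> 0" by (simp add: c_def)
  define A where "A = (1/2) powr (- b) + ((c + 1) / 2) powr (- b)"
  have A: "A \<ge> 0" by (simp add: A_def)
  \<comment> \<open>then the argument of \<open>legs\<close> has absolute value at most \<open>1/2\<close>\<close>
  define \<eta>0 where "\<eta>0 = 1 + 4 * \<bar>x * y\<bar>"
  define K' where "K' = A * K * (1 + 2 * \<bar>x * y\<bar>)"
  have "cmod (phis x y (\<i> * of_real \<eta>)) \<le> K' * \<eta> powr (- 2 * b)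
       \<and> cmod (phis (- x) y (\<i> * of_real \<eta>) - phis x y (\<i> * of_real \<eta>)) \<le> K' * \<eta> powr (- 2 * b - 2)" if \<eta>: "\<eta> \<ge> \<eta>0" for \<eta>
  proof -
    have \<eta>1: "\<eta> \<ge> 1" "\<eta> \<ge> 4 * \<bar>x * y\<bar>" using \<eta> by (auto simp: \<eta>0_def)
    have \<eta>2: "\<eta>\<^sup>2 \<ge> \<eta>" using \<eta>1 by (simp add: power2_eq_square)
    define t where "t = (c + \<eta>\<^sup>2) / 2 / \<eta>\<^sup>2"
    define u where "u = x * y / ((c + \<eta>\<^sup>2) / 2)"
    have "c \<le> c * \<eta>\<^sup>2" using \<eta>1 \<eta>2 c mult_left_mono[of 1 "\<eta>\<^sup>2" c] by simp
    then have t: "1/2 \<le> t" "t \<le> (c + 1) / 2" using \<eta>1 c by (auto simp: t_def field_simps)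
    have tA: "t powr (- b) \<le> A"
    proof (cases "b \<ge> 0")
      case True
      then have "t powr (- b) \<le> (1/2) powr (- b)" using t by (intro powr_mono2') auto
      also have "\<dots> \<le> A" unfolding A_def by simp
      finally show ?thesis .
    next
      case False
      then have "t powr (- b) \<le> ((c + 1) / 2) powr (- b)" using t by (intro powr_mono2) auto
      also have "\<dots> \<le> A" unfolding A_def by simp
      finally show ?thesis .
    qed
    have u0: "\<bar>u\<bar> \<le> 2 * \<bar>x * y\<bar> / \<eta>\<^sup>2"
    proof -
      have "\<bar>u\<bar> = 2 * \<bar>x * y\<bar> / (c + \<eta>\<^sup>2)" using c by (simp add: u_def abs_mult)
      also have "\<dots> \<le> 2 * \<bar>x * y\<bar> / \<eta>\<^sup>2" using c \<eta>1 by (intro divide_left_mono) (auto intro!: mult_pos_pos add_nonneg_pos)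
      finally show ?thesis .
    qed
    have "2 * \<bar>x * y\<bar> / \<eta>\<^sup>2 \<le> 1/2" using \<eta>1 \<eta>2 by (simp add: divide_le_eq)
    with u0 have u: "cmod (- of_real u) \<le> 1/2" by simp
    have e1: "phis x y (\<i> * of_real \<eta>) = of_real (t powr (- b) * \<eta> powr (- 2 * b)) * legs (- of_real u)"
      using phis_imag[of \<eta> x y] \<eta>1 by (simp add: t_def u_def c_def)
    have e2: "phis (- x) y (\<i> * of_real \<eta>) = of_real (t powr (- b) * \<eta> powr (- 2 * b)) * legs (- (- of_real u))"
      using phis_imag[of \<eta> "- x" y] \<eta>1 by (simp add: t_def u_def c_def)
    have n: "cmod (of_real (t powr (- b) * \<eta> powr (- 2 * b))) \<le> A * \<eta> powr (- 2 * b)"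
      unfolding norm_of_real using tA by (simp add: abs_mult mult_right_mono)
    have "cmod (phis x y (\<i> * of_real \<eta>)) \<le> (A * \<eta> powr (- 2 * b)) * K"
      unfolding e1 norm_mult[of "of_real _"] using A by (intro mult_mono n K(2) u) auto
    also have "\<dots> = A * K * \<eta> powr (- 2 * b) * 1" by simp
    also have "\<dots> \<le> A * K * \<eta> powr (- 2 * b) * (1 + 2 * \<bar>x * y\<bar>)" using A K(1) by (intro mult_left_mono) auto
    finally have r1: "cmod (phis x y (\<i> * of_real \<eta>)) \<le> K' * \<eta> powr (- 2 * b)" by (simp add: K'_def mult_ac)
    have "cmod (phis (- x) y (\<i> * of_real \<eta>) - phis x y (\<i> * of_real \<eta>))
        = cmod (of_real (t powr (- b) * \<eta> powr (- 2 * b))) * cmod (legs (- (- of_real u)) - legs (- of_real u))"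
      unfolding e1 e2 right_diff_distrib[symmetric] norm_mult[of "of_real _"] ..
    also have "\<dots> \<le> (A * \<eta> powr (- 2 * b)) * (K * cmod (- of_real u))"
      using A by (intro mult_mono n K(3) u) auto
    also have "\<dots> \<le> (A * \<eta> powr (- 2 * b)) * (K * (2 * \<bar>x * y\<bar> / \<eta>\<^sup>2))"
      using A K(1) u0 by (intro mult_left_mono) auto
    also have "\<dots> = A * K * (2 * \<bar>x * y\<bar>) * \<eta> powr (- 2 * b - 2)" using \<eta>1 by (simp add: powr_diff)
    also have "\<dots> \<le> A * K * (1 + 2 * \<bar>x * y\<bar>) * \<eta> powr (- 2 * b - 2)" using A K(1) by (intro mult_right_mono mult_left_mono) auto
    finally show ?thesis using r1 by (simp add: K'_def)
  qed
  moreover have "K' \<ge> 0" using A K(1) by (simp add: K'_def)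
  ultimately show ?thesis by (intro exI[of _ K'] exI[of _ \<eta>0]) (auto simp: \<eta>0_def)
qed

text \<open>The Wronskian is constant because the matrix of the system has trace zero.  It is of order
  \<open>\<eta>\<^bsup>-4b-2\<^esup>\<close> at \<open>z = i \<eta>\<close>, and \<open>4 b + 2 > 0\<close>.\<close>

lemma wronskian_zero:
  assumes z: "Im z > \<bar>x\<bar> + \<bar>y\<bar>"
  shows "mlap x y z * phis (- x) y z = mlap (- x) y z * phis x y z"
proof -
  let ?W = "\<lambda>z. mlap x y z * phis (- x) y z - mlap (- x) y z * phis x y z"
  obtain K1 where K1: "K1 \<ge> 0" "\<And>\<eta>. \<eta> \<ge> 1 \<Longrightarrow> cmod (mlap x y (\<i> * of_real \<eta>) - \<i> * of_real (Gamma (2 * b + 1) * \<eta> powr (- 2 * b))) \<le> K1 * \<eta> powr (- 2 * b - 2)"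
    using mlap_asymp by blast
  obtain K2 where K2: "K2 \<ge> 0" "\<And>\<eta>. \<eta> \<ge> 1 \<Longrightarrow> cmod (mlap (- x) y (\<i> * of_real \<eta>) - \<i> * of_real (Gamma (2 * b + 1) * \<eta> powr (- 2 * b))) \<le> K2 * \<eta> powr (- 2 * b - 2)"
    using mlap_asymp by blast
  obtain K3 \<eta>0 where K3: "\<eta>0 \<ge> 1" "K3 \<ge> 0" "\<And>\<eta>. \<eta> \<ge> \<eta>0 \<Longrightarrow> cmod (phis x y (\<i> * of_real \<eta>)) \<le> K3 * \<eta> powr (- 2 * b)"
       "\<And>\<eta>. \<eta> \<ge> \<eta>0 \<Longrightarrow> cmod (phis (- x) y (\<i> * of_real \<eta>) - phis x y (\<i> * of_real \<eta>)) \<le> K3 * \<eta> powr (- 2 * b - 2)"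
    using phis_bounds by blast
  have G: "Gamma (2 * b + 1) > 0" using b_gt by (intro Gamma_real_pos) simp
  define K where "K = (K1 + Gamma (2 * b + 1)) * K3 + (K1 + K2) * K3"
  have "?W z = 0"
  proof (rule zero_on_upper_halfplane[where f = ?W and R = "\<bar>x\<bar> + \<bar>y\<bar>"])
    fix z :: complex assume z: "\<bar>x\<bar> + \<bar>y\<bar> < Im z"
    then have z0: "Im z > 0" by linarith
    have "\<bar>- x\<bar> + \<bar>y\<bar> < Im z" using z by simp
    note D = DERIV_diff[OF DERIV_mult[OF mlap_DERIV'[OF z0, of x y] phis_DERIV[OF this]] DERIV_mult[OF mlap_DERIV'[OF z0, of "- x" y] phis_DERIV[OF z]]]
    show "(?W has_field_derivative 0) (at z)"
      by (rule DERIV_cong[OF D]) (simp add: algebra_simps)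
  next
    fix \<eta> :: real assume \<eta>: "\<eta> \<ge> \<eta>0"
    then have \<eta>1: "\<eta> \<ge> 1" using K3(1) by simp
    let ?z = "\<i> * of_real \<eta> :: complex"
    let ?m = "\<i> * of_real (Gamma (2 * b + 1) * \<eta> powr (- 2 * b)) :: complex"
    let ?p = "\<eta> powr (- 2 * b)" and ?q = "\<eta> powr (- 2 * b - 2)"
    have qp: "?q \<le> ?p" using \<eta>1 by (intro powr_mono) auto
    have m: "cmod (mlap x y ?z) \<le> (K1 + Gamma (2 * b + 1)) * ?p"
    proof -
      have "cmod (mlap x y ?z) \<le> cmod (mlap x y ?z - ?m) + cmod ?m"
        using norm_triangle_ineq[of "mlap x y ?z - ?m" ?m] by simp
      also have "\<dots> \<le> K1 * ?p + Gamma (2 * b + 1) * ?p"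
        using order_trans[OF K1(2)[OF \<eta>1] mult_left_mono[OF qp K1(1)]] G by (simp add: norm_mult)
      finally show ?thesis by (simp add: algebra_simps)
    qed
    have d: "cmod (mlap x y ?z - mlap (- x) y ?z) \<le> (K1 + K2) * ?q"
      using norm_triangle_ineq4[of "mlap x y ?z - ?m" "mlap (- x) y ?z - ?m"] K1(2)[OF \<eta>1] K2(2)[OF \<eta>1]
      by (simp add: algebra_simps)
    have "?W ?z = mlap x y ?z * (phis (- x) y ?z - phis x y ?z) + (mlap x y ?z - mlap (- x) y ?z) * phis x y ?z"
      by (simp add: algebra_simps)
    also have "cmod \<dots> \<le> ((K1 + Gamma (2 * b + 1)) * ?p) * (K3 * ?q) + ((K1 + K2) * ?q) * (K3 * ?p)"
    proof (rule order_trans[OF norm_triangle_ineq], unfold norm_mult, intro add_mono mult_mono)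
      show "cmod (phis (- x) y ?z - phis x y ?z) \<le> K3 * ?q" by (rule K3(4)[OF \<eta>])
      show "cmod (phis x y ?z) \<le> K3 * ?p" by (rule K3(3)[OF \<eta>])
    qed (use m d G K1(1) K2(1) in auto)
    also have "\<dots> = K * (?p * ?q)" by (simp add: K_def algebra_simps)
    also have "?p * ?q = \<eta> powr (- (4 * b + 2))" by (simp flip: powr_add)
    finally show "cmod (?W ?z) \<le> K * \<eta> powr (- (4 * b + 2))" .
  next
    show "4 * b + 2 > 0" using b_gt by simp
  qed (rule z)
  then show ?thesis by simp
qed

text \<open>The quotient of the leading coefficients of \<open>mlap\<close> and \<open>phis\<close> at \<open>z = i \<infinity>\<close>.\<close>

definition clap :: complex where "clap = \<i> * of_real (Gamma (2 * b + 1) / 2 powr b)"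

lemma mlap_phis_limit: "((\<lambda>\<eta>. mlap x y (\<i> * of_real \<eta>) / phis x y (\<i> * of_real \<eta>)) \<longlongrightarrow> clap) at_top"
proof -
  obtain K where K: "K \<ge> 0" "\<And>\<eta>. \<eta> \<ge> 1 \<Longrightarrow> cmod (mlap x y (\<i> * of_real \<eta>) - \<i> * of_real (Gamma (2 * b + 1) * \<eta> powr (- 2 * b))) \<le> K * \<eta> powr (- 2 * b - 2)"
    using mlap_asymp by blast
  define c where "c = x\<^sup>2 + y\<^sup>2"
  have c: "c \<ge> 0" by (simp add: c_def)
  have inv: "((\<lambda>\<eta>::real. 1 / \<eta>\<^sup>2) \<longlongrightarrow> 0) at_top" by real_asymp
  have 1: "((\<lambda>\<eta>. of_real (\<eta> powr (2 * b)) * mlap x y (\<i> * of_real \<eta>)) \<longlongrightarrow> \<i> * of_real (Gamma (2 * b + 1))) at_top"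
  proof (rule Lim_transform2[OF tendsto_const], rule Lim_null_comparison)
    show "((\<lambda>\<eta>. K * (1 / \<eta>\<^sup>2)) \<longlongrightarrow> 0) at_top" using tendsto_mult_right_zero[OF inv] .
    show "\<forall>\<^sub>F \<eta> in at_top. norm (\<i> * of_real (Gamma (2 * b + 1)) - of_real (\<eta> powr (2 * b)) * mlap x y (\<i> * of_real \<eta>)) \<le> K * (1 / \<eta>\<^sup>2)"
      using eventually_ge_at_top[of 1]
    proof eventually_elim
      fix \<eta> :: real assume \<eta>: "1 \<le> \<eta>"
      have p: "\<eta> powr (2 * b) * \<eta> powr (- 2 * b) = 1" using \<eta> by (simp flip: powr_add)
      have "\<i> * of_real (Gamma (2 * b + 1)) - of_real (\<eta> powr (2 * b)) * mlap x y (\<i> * of_real \<eta>)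
         = - (of_real (\<eta> powr (2 * b)) * (mlap x y (\<i> * of_real \<eta>) - \<i> * of_real (Gamma (2 * b + 1) * \<eta> powr (- 2 * b))))"
      proof -
        have "of_real (\<eta> powr (2 * b)) * (\<i> * of_real (Gamma (2 * b + 1) * \<eta> powr (- 2 * b)))
           = \<i> * of_real (Gamma (2 * b + 1)) * of_real (\<eta> powr (2 * b) * \<eta> powr (- 2 * b))"
          by simp
        then show ?thesis unfolding p by (simp add: algebra_simps)
      qed
      also have "norm \<dots> \<le> \<eta> powr (2 * b) * (K * \<eta> powr (- 2 * b - 2))"
        unfolding norm_minus_cancel norm_mult norm_of_real using K(2)[OF \<eta>] by (intro mult_mono) auto
      also have "\<dots> = K * (\<eta> powr (2 * b) * \<eta> powr (- 2 * b)) * (1 / \<eta>\<^sup>2)" using \<eta> by (simp add: powr_diff)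
      finally show "norm (\<i> * of_real (Gamma (2 * b + 1)) - of_real (\<eta> powr (2 * b)) * mlap x y (\<i> * of_real \<eta>)) \<le> K * (1 / \<eta>\<^sup>2)"
        unfolding p by simp
    qed
  qed
  have 2: "((\<lambda>\<eta>. of_real (\<eta> powr (2 * b)) * phis x y (\<i> * of_real \<eta>)) \<longlongrightarrow> of_real (2 powr b)) at_top"
  proof -
    have t: "((\<lambda>\<eta>. (c + \<eta>\<^sup>2) / 2 / \<eta>\<^sup>2) \<longlongrightarrow> 1/2) at_top" by real_asymp
    have "((\<lambda>\<eta>. ((c + \<eta>\<^sup>2) / 2 / \<eta>\<^sup>2) powr (- b)) \<longlongrightarrow> (1/2) powr (- b)) at_top"
      by (intro tendsto_powr t tendsto_const) simp
    moreover have "(1/2) powr (- b) = 2 powr b" by (simp add: powr_divide powr_minus)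
    ultimately have t2: "((\<lambda>\<eta>. ((c + \<eta>\<^sup>2) / 2 / \<eta>\<^sup>2) powr (- b)) \<longlongrightarrow> 2 powr b) at_top" by simp
    have "((\<lambda>\<eta>. x * y / ((c + \<eta>\<^sup>2) / 2)) \<longlongrightarrow> 0) at_top" by real_asymp
    then have u: "((\<lambda>\<eta>. - of_real (x * y / ((c + \<eta>\<^sup>2) / 2)) :: complex) \<longlongrightarrow> - of_real 0) at_top"
      by (intro tendsto_minus tendsto_of_real)
    have "isCont legs 0" using DERIV_isCont[OF legs_DERIV[of 0]] by simp
    then have "((\<lambda>\<eta>. legs (- of_real (x * y / ((c + \<eta>\<^sup>2) / 2)))) \<longlongrightarrow> legs 0) at_top"
      by (rule isCont_tendsto_compose) (use u in simp)
    from tendsto_mult[OF tendsto_of_real[OF t2] this]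
    have lim: "((\<lambda>\<eta>. of_real (((c + \<eta>\<^sup>2) / 2 / \<eta>\<^sup>2) powr (- b)) * legs (- of_real (x * y / ((c + \<eta>\<^sup>2) / 2)))) \<longlongrightarrow> of_real (2 powr b)) at_top"
      by simp
    show ?thesis
    proof (rule Lim_transform_eventually[OF lim])
      show "\<forall>\<^sub>F \<eta> in at_top. of_real (((c + \<eta>\<^sup>2) / 2 / \<eta>\<^sup>2) powr (- b)) * legs (- of_real (x * y / ((c + \<eta>\<^sup>2) / 2)))
          = of_real (\<eta> powr (2 * b)) * phis x y (\<i> * of_real \<eta>)"
        using eventually_gt_at_top[of 0]
      proof eventually_elim
        fix \<eta> :: real assume \<eta>: "0 < \<eta>"
        have p: "\<eta> powr (2 * b) * \<eta> powr (- 2 * b) = 1" using \<eta> by (simp flip: powr_add)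
        have "of_real (\<eta> powr (2 * b)) * phis x y (\<i> * of_real \<eta>)
           = of_real (((c + \<eta>\<^sup>2) / 2 / \<eta>\<^sup>2) powr (- b)) * legs (- of_real (x * y / ((c + \<eta>\<^sup>2) / 2))) * of_real (\<eta> powr (2 * b) * \<eta> powr (- 2 * b))"
          unfolding phis_imag[OF \<eta>] c_def by simp
        then show "of_real (((c + \<eta>\<^sup>2) / 2 / \<eta>\<^sup>2) powr (- b)) * legs (- of_real (x * y / ((c + \<eta>\<^sup>2) / 2)))
          = of_real (\<eta> powr (2 * b)) * phis x y (\<i> * of_real \<eta>)" unfolding p by simp
      qed
    qed
  qed
  have "((\<lambda>\<eta>. (of_real (\<eta> powr (2 * b)) * mlap x y (\<i> * of_real \<eta>)) / (of_real (\<eta> powr (2 * b)) * phis x y (\<i> * of_real \<eta>))) \<longlongrightarrow> clap) at_top"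
    using tendsto_divide[OF 1 2] by (simp add: clap_def)
  then show ?thesis
  proof (rule Lim_transform_eventually)
    show "\<forall>\<^sub>F \<eta> in at_top. (of_real (\<eta> powr (2 * b)) * mlap x y (\<i> * of_real \<eta>)) / (of_real (\<eta> powr (2 * b)) * phis x y (\<i> * of_real \<eta>))
       = mlap x y (\<i> * of_real \<eta>) / phis x y (\<i> * of_real \<eta>)"
      using eventually_gt_at_top[of 0] by eventually_elim simp
  qed
qed

text \<open>For \<open>Im z\<close> large the transform is identified by a Wronskian: both pairs solve the same linear
  system of two equations, whose trace is zero, and both behave like \<open>z\<^bsup>-2b\<^esup>\<close> at infinity.\<close>

lemma mlap_eq_phis: "\<exists>R\<ge>0. \<forall>z. Im z > R \<longrightarrow> mlap x y z = clap * phis x y z"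
proof -
  have "isCont legs 0" using DERIV_isCont[OF legs_DERIV[of 0]] by simp
  then obtain d where d: "d > 0" "\<And>u. dist u 0 < d \<Longrightarrow> dist (legs u) (legs 0) < 1"
    unfolding continuous_at_eps_delta using zero_less_one by blast
  have nz: "legs u \<noteq> 0" if "cmod u < d" for u using d(2)[of u] that by auto
  \<comment> \<open>above \<open>R\<close> the argument of \<open>legs\<close> is so small that \<open>phis\<close> has no zeros\<close>
  define R where "R = 1 + x\<^sup>2 + y\<^sup>2 + 2 * (\<bar>x * y\<bar> / d) + \<bar>x\<bar> + \<bar>y\<bar>"
  have R: "R \<ge> \<bar>x\<bar> + \<bar>y\<bar>" "R \<ge> 1 + x\<^sup>2 + y\<^sup>2 + 2 * (\<bar>x * y\<bar> / d)" "R \<ge> 1" using d(1) by (auto simp: R_def)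
  have pn: "phis x y z \<noteq> 0" if z: "Im z > R" for z
  proof -
    have z0: "Im z > 0" using z R(3) by linarith
    have "Im z * 1 \<le> Im z * Im z" using z R(3) by (intro mult_left_mono) linarith+
    then have "2 * (\<bar>x * y\<bar> / d) < 2 * cmod (qq x y z)"
      using qq_lower[where x = x and y = y and z = z] z R(2) unfolding power2_eq_square[of "Im z"] by linarith
    then have "\<bar>x * y\<bar> < cmod (qq x y z) * d" using d(1) by (simp add: divide_less_eq)
    then have "cmod (- of_real (x * y) / qq x y z) < d"
      using qq_nonzero[OF z0, of x y] by (simp add: norm_divide norm_mult divide_less_eq abs_mult mult.commute)
    from nz[OF this] show ?thesis using qq_nonzero[OF z0, of x y] by (simp add: phis_def)
  qed
  obtain c where c: "\<And>z. Im z > R \<Longrightarrow> mlap x y z / phis x y z = c"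
  proof (rule constant_on_upper_halfplane[of R "\<lambda>z. mlap x y z / phis x y z"])
    fix z assume z: "Im z > R"
    then have z0: "Im z > 0" and z1: "Im z > \<bar>x\<bar> + \<bar>y\<bar>" using R by linarith+
    let ?A = "- 2 * of_real b * z * mlap (- x) y z / (z\<^sup>2 - (of_real (x + y))\<^sup>2)"
    let ?B = "- 2 * of_real b * z * phis (- x) y z / (z\<^sup>2 - (of_real (x + y))\<^sup>2)"
    have "?A * phis x y z = mlap x y z * ?B"
    proof -
      let ?k = "- 2 * of_real b * z / (z\<^sup>2 - (of_real (x + y))\<^sup>2)"
      have "?A * phis x y z = ?k * (mlap (- x) y z * phis x y z)" by simp
      also have "\<dots> = ?k * (mlap x y z * phis (- x) y z)" unfolding wronskian_zero[OF z1] ..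
      also have "\<dots> = mlap x y z * ?B" by simp
      finally show ?thesis .
    qed
    then have eq: "(?A * phis x y z - mlap x y z * ?B) / (phis x y z * phis x y z) = 0" by (simp only: diff_self div_0)
    show "((\<lambda>z. mlap x y z / phis x y z) has_field_derivative 0) (at z)"
      by (rule DERIV_cong[OF DERIV_divide[OF mlap_DERIV'[OF z0, of x y] phis_DERIV[OF z1] pn[OF z]] eq])
  qed blast
  have "((\<lambda>\<eta>. mlap x y (\<i> * of_real \<eta>) / phis x y (\<i> * of_real \<eta>)) \<longlongrightarrow> c) at_top"
  proof (rule tendsto_eventually)
    show "\<forall>\<^sub>F \<eta> in at_top. mlap x y (\<i> * of_real \<eta>) / phis x y (\<i> * of_real \<eta>) = c"
      using eventually_gt_at_top[of R] by eventually_elim (simp add: c)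
  qed
  from tendsto_unique[OF trivial_limit_at_top_linorder this mlap_phis_limit] have "c = clap" .
  then have "mlap x y z = clap * phis x y z" if "Im z > R" for z
    using c[OF that] pn[OF that] by (simp add: field_simps)
  then show ?thesis using R(3) by (intro exI[of _ R]) auto
qed

end

section \<open>Analytic continuation and the jump kernel\<close>

lemma Gamma_duplication_real:
  fixes x :: real
  assumes x: "x > 0" shows "Gamma x * Gamma (x + 1/2) = 2 powr (1 - 2 * x) * sqrt pi * Gamma (2 * x)"
proof -
  have 1: "complex_of_real x \<notin> \<int>\<^sub>\<le>\<^sub>0" "complex_of_real x + 1/2 \<notin> \<int>\<^sub>\<le>\<^sub>0"
    using x by (auto elim!: nonpos_Ints_cases simp: complex_eq_iff)
  have "exp ((1 - 2 * complex_of_real x) * of_real (ln 2)) = of_real (2 powr (1 - 2 * x))"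
    by (simp add: powr_def exp_of_real[symmetric])
  note e = this
  have h: "Gamma (complex_of_real x + 1/2) = of_real (Gamma (x + 1/2))"
    using Gamma_complex_of_real[of "x + 1/2"] by simp
  have d: "Gamma (2 * complex_of_real x) = of_real (Gamma (2 * x))"
    using Gamma_complex_of_real[of "2 * x"] by simp
  have "complex_of_real (Gamma x * Gamma (x + 1/2)) = of_real (2 powr (1 - 2 * x) * sqrt pi * Gamma (2 * x))"
    using Gamma_legendre_duplication[OF 1, unfolded e h d Gamma_complex_of_real] by (simp only: of_real_mult)
  then show ?thesis by (simp only: of_real_eq_iff)
qed

lemma sums_even_odd:
  fixes t :: "nat \<Rightarrow> complex"
  assumes "summable (\<lambda>n. norm (t n))"
  obtains E O' where "(\<lambda>m. t (2 * m)) sums E" "(\<lambda>m. t (Suc (2 * m))) sums O'" "suminf t = E + O'"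
proof -
  define fe where "fe n = (if even n then t n else 0)" for n
  define fo where "fo n = (if even n then 0 else t n)" for n
  have s: "summable fe" "summable fo"
    by (rule summable_comparison_test'[OF assms, of 0]; simp add: fe_def fo_def)+
  have z: "fe n = 0" if "n \<notin> range (\<lambda>m::nat. 2 * m)" for n using that by (auto simp: fe_def elim!: evenE)
  have z': "fo n = 0" if "n \<notin> range (\<lambda>m::nat. Suc (2 * m))" for n using that by (auto simp: fo_def elim!: oddE)
  have m: "strict_mono (\<lambda>m::nat. 2 * m)" "strict_mono (\<lambda>m::nat. Suc (2 * m))" by (auto simp: strict_mono_def)
  have "(\<lambda>m. fe (2 * m)) sums suminf fe"
    by (rule sums_mono_reindex[OF m(1) z, THEN iffD2, OF _ summable_sums[OF s(1)]])
  moreover have "(\<lambda>m. fo (Suc (2 * m))) sums suminf fo"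
    by (rule sums_mono_reindex[OF m(2) z', THEN iffD2, OF _ summable_sums[OF s(2)]])
  ultimately have "(\<lambda>m. t (2 * m)) sums suminf fe" "(\<lambda>m. t (Suc (2 * m))) sums suminf fo"
    by (simp_all add: fe_def fo_def)
  moreover have "suminf t = suminf fe + suminf fo"
    unfolding suminf_add[OF s] by (rule arg_cong[where f = suminf]) (auto simp: fe_def fo_def)
  ultimately show ?thesis using that by blast
qed

text \<open>Kernel and function have arbitrary values at \<open>y = 0\<close>.\<close>

lemma eq_off_zero:
  fixes F G :: "real \<Rightarrow> complex"
  assumes G: "integrable lborel G" and eq: "\<And>y. y \<noteq> 0 \<Longrightarrow> F y = G y"
  shows "integrable lborel F" "(\<integral>y. F y \<partial>lborel) = (\<integral>y. G y \<partial>lborel)"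
proof -
  have [measurable]: "G \<in> borel_measurable borel" using borel_measurable_integrable[OF G] by simp
  have "F = (\<lambda>y. if y = 0 then F 0 else G y)" using eq by auto
  moreover have "(\<lambda>y. if y = 0 then F 0 else G y) \<in> borel_measurable borel" by measurable
  ultimately have F: "F \<in> borel_measurable lborel" by simp
  have ae: "AE y in lborel. G y = F y"
    using AE_lborel_singleton[of 0] by eventually_elim (simp add: eq)
  show "integrable lborel F" by (rule integrable_cong_AE_imp[OF G F ae])
  show "(\<integral>y. F y \<partial>lborel) = (\<integral>y. G y \<partial>lborel)"
    by (rule integral_cong_AE[OF F]) (use ae in auto)
qed

text \<open>The set is the image of a half-strip under the exponential function.\<close>

lemma connected_outside_slit: "connected {w. cmod w > 1 \<and> w \<notin> \<real>\<^sub>\<le>\<^sub>0}"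
proof -
  define B where "B = {z. Re z > 0} \<inter> {z. Im z < pi} \<inter> {z. Im z > - pi}"
  have "convex B" unfolding B_def
    by (intro convex_Int convex_halfspace_Re_gt convex_halfspace_Im_lt convex_halfspace_Im_gt)
  then have "connected (exp ` B)"
    by (intro connected_continuous_image continuous_on_exp continuous_on_id convex_connected)
  also have "exp ` B = {w. cmod w > 1 \<and> w \<notin> \<real>\<^sub>\<le>\<^sub>0}"
  proof (intro equalityI subsetI)
    fix w assume "w \<in> exp ` B"
    then obtain z where z: "z \<in> B" "w = exp z" by blast
    have ln: "Ln w = z" unfolding z(2) using z(1) by (intro Ln_exp) (auto simp: B_def)
    have "w \<notin> \<real>\<^sub>\<le>\<^sub>0"
    proof
      assume "w \<in> \<real>\<^sub>\<le>\<^sub>0"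
      moreover have "w \<noteq> 0" by (simp add: z(2))
      ultimately have "Re w < 0 \<and> Im w = 0" by (auto simp: complex_nonpos_Reals_iff complex_eq_iff)
      then have "Im (Ln w) = pi" using Im_Ln_eq_pi[OF \<open>w \<noteq> 0\<close>] by simp
      then show False using z(1) ln by (simp add: B_def)
    qed
    then show "w \<in> {w. cmod w > 1 \<and> w \<notin> \<real>\<^sub>\<le>\<^sub>0}" using z by (simp add: B_def)
  next
    fix w assume "w \<in> {w. cmod w > 1 \<and> w \<notin> \<real>\<^sub>\<le>\<^sub>0}"
    then have w: "cmod w > 1" "w \<notin> \<real>\<^sub>\<le>\<^sub>0" by auto
    then have w0: "w \<noteq> 0" by auto
    have "Im (Ln w) \<noteq> pi" using Im_Ln_eq_pi[OF w0] w(2) by (auto simp: complex_nonpos_Reals_iff)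
    then have "Ln w \<in> B" using w(1) w0 mpi_less_Im_Ln[OF w0] Im_Ln_le_pi[OF w0]
      by (simp add: B_def)
    then show "w \<in> exp ` B" using exp_Ln[OF w0] by (metis image_eqI)
  qed
  finally show ?thesis .
qed

context dunkl
begin

text \<open>The value of \<open>\<Psi>\<^sub>b\<close> at infinity.\<close>

definition azero :: real where
  "azero = Gamma (b / 2 + 1) * Gamma ((b + 1) / 2) / Gamma (b + 1/2)"

lemma azero_pos: "azero > 0"
  using b_gt by (simp add: azero_def Gamma_real_pos)

lemma clap_nonzero: "clap \<noteq> 0"
proof -
  have "Gamma (2 * b + 1) > 0" by (rule Gamma_real_pos) (use b_gt in simp)
  then show ?thesis by (simp add: clap_def)
qed

text \<open>This is where the normalizations meet: the duplication formula at \<open>(b + 1)/2\<close> and at \<open>b + 1/2\<close>.\<close>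

lemma clap_azero: "clap = \<i> * of_real (azero * dconst\<^sup>2 / (2 * pi))"
proof -
  define G1 where "G1 = Gamma (b + 1/2)"
  define G2 where "G2 = Gamma (b + 1)"
  define G3 where "G3 = Gamma (2 * b + 1)"
  define p where "p = (2::real) powr b"
  have pos: "G1 > 0" "G2 > 0" "G3 > 0" "p > 0"
    using b_gt by (auto simp: G1_def G2_def G3_def p_def intro!: Gamma_real_pos)
  have a: "azero = inverse p * sqrt pi * G2 / G1"
  proof -
    have "Gamma ((b + 1) / 2) * Gamma ((b + 1) / 2 + 1/2) = 2 powr (1 - 2 * ((b + 1) / 2)) * sqrt pi * Gamma (2 * ((b + 1) / 2))"
      by (rule Gamma_duplication_real) (use b_gt in simp)
    moreover have "(b + 1) / 2 + 1/2 = b / 2 + 1" "1 - 2 * ((b + 1) / 2) = - b" "2 * ((b + 1) / 2) = b + 1"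
      by (simp_all add: field_simps)
    ultimately have "Gamma ((b + 1) / 2) * Gamma (b / 2 + 1) = 2 powr (- b) * sqrt pi * Gamma (b + 1)" by (simp only:)
    then show ?thesis by (simp add: azero_def p_def G1_def G2_def powr_minus mult.commute)
  qed
  have 3: "G1 * G2 = inverse (p * p) * sqrt pi * G3"
  proof -
    have "Gamma (b + 1/2) * Gamma (b + 1/2 + 1/2) = 2 powr (1 - 2 * (b + 1/2)) * sqrt pi * Gamma (2 * (b + 1/2))"
      by (rule Gamma_duplication_real) (use b_gt in simp)
    moreover have "b + 1/2 + 1/2 = b + 1" "1 - 2 * (b + 1/2) = - (b + b)" "2 * (b + 1/2) = 2 * b + 1" by simp_all
    ultimately have "Gamma (b + 1/2) * Gamma (b + 1) = 2 powr (- (b + b)) * sqrt pi * Gamma (2 * b + 1)" by (simp only:)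
    moreover have "2 powr (- (b + b)) = inverse (p * p)" unfolding powr_minus powr_add p_def ..
    ultimately show ?thesis by (simp only: G1_def G2_def G3_def)
  qed
  have d: "dconst\<^sup>2 = 2 * (p * p) * G1\<^sup>2"
  proof -
    have "(2 powr (b + 1/2))\<^sup>2 = 2 powr ((b + 1/2) + (b + 1/2) :: real)" unfolding power2_eq_square powr_add ..
    also have "(b + 1/2) + (b + 1/2) = 1 + (b + b)" by simp
    also have "2 powr (1 + (b + b)) = 2 powr 1 * (2 powr b * 2 powr b :: real)" unfolding powr_add ..
    also have "\<dots> = 2 * (p * p)" by (simp add: p_def)
    finally show ?thesis by (simp add: dconst_def G1_def power_mult_distrib)
  qed
  have "azero * dconst\<^sup>2 = 2 * p * sqrt pi * (G1 * G2)"
    unfolding a d using pos by (simp add: power2_eq_square field_simps)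
  also have "\<dots> = 2 * pi * (G3 / p)"
    unfolding 3 using pos by (simp add: field_simps)
  finally have "azero * dconst\<^sup>2 / (2 * pi) = G3 / p" by simp
  then show ?thesis by (simp only: clap_def G3_def p_def)
qed

text \<open>Even and odd coefficients satisfy the same two-term recursion as the Gamma quotients, and
  \<open>b/2 \<Gamma>(b/2) = \<Gamma>(b/2 + 1)\<close> matches the first ones.\<close>

lemma lcoef_legendre:
  assumes b0: "b \<noteq> 0"
  shows "azero * lcoef (2 * m) = b / 2 * (Gamma (b / 2 + real m) * Gamma ((b + 1) / 2 + real m) / (Gamma (b + 1/2 + real m) * fact m))"
    and "azero * lcoef (Suc (2 * m)) = b / 2 * (Gamma ((b + 1) / 2 + real m) * Gamma (b / 2 + real m + 1) / (Gamma (b + 1/2 + real m + 1) * fact m))"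
proof -
  define P where "P m = b / 2 * (Gamma (b / 2 + real m) * Gamma ((b + 1) / 2 + real m) / (Gamma (b + 1/2 + real m) * fact m))" for m :: nat
  define Q where "Q m = b / 2 * (Gamma ((b + 1) / 2 + real m) * Gamma (b / 2 + real m + 1) / (Gamma (b + 1/2 + real m + 1) * fact m))" for m :: nat
  have ni: "b / 2 + real m \<notin> \<int>\<^sub>\<le>\<^sub>0" "(b + 1) / 2 + real m \<notin> \<int>\<^sub>\<le>\<^sub>0" "b + 1/2 + real m \<notin> \<int>\<^sub>\<le>\<^sub>0" for m
  proof -
    show "b / 2 + real m \<notin> \<int>\<^sub>\<le>\<^sub>0"
    proof
      assume "b / 2 + real m \<in> \<int>\<^sub>\<le>\<^sub>0"
      then obtain k :: nat where k: "b / 2 + real m = - real k" by (auto elim!: nonpos_Ints_cases')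
      show False
      proof (cases "m + k = 0")
        case True
        then show ?thesis using k b0 by simp
      next
        case False
        then have "real m + real k \<ge> 1" by (metis One_nat_def Suc_leI neq0_conv of_nat_1 of_nat_add of_nat_le_iff)
        then show ?thesis using k b_gt by linarith
      qed
    qed
    show "(b + 1) / 2 + real m \<notin> \<int>\<^sub>\<le>\<^sub>0" "b + 1/2 + real m \<notin> \<int>\<^sub>\<le>\<^sub>0"
    proof -
      have "(b + 1) / 2 + real m > 0" by (intro add_pos_nonneg) (use b_gt in simp_all)
      moreover have "b + 1/2 + real m > 0" using b_gt by linarith
      ultimately      show "(b + 1) / 2 + real m \<notin> \<int>\<^sub>\<le>\<^sub>0" "b + 1/2 + real m \<notin> \<int>\<^sub>\<le>\<^sub>0" by (auto elim!: nonpos_Ints_cases')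
    qed
  qed
  have G: "Gamma (b / 2 + real m + 1) = (b / 2 + real m) * Gamma (b / 2 + real m)"
     "Gamma ((b + 1) / 2 + real m + 1) = ((b + 1) / 2 + real m) * Gamma ((b + 1) / 2 + real m)"
     "Gamma (b + 1/2 + real m + 1) = (b + 1/2 + real m) * Gamma (b + 1/2 + real m)" for m
    by (rule Gamma_plus1[OF ni(1)], rule Gamma_plus1[OF ni(2)], rule Gamma_plus1[OF ni(3)])
  have p1: "b + 1/2 + real m > 0" for m using b_gt by linarith
  have Gp: "Gamma (b + 1/2 + real m) > 0" for m by (rule Gamma_real_pos[OF p1])
  have gn: "Gamma (b + 1/2 + real m) \<noteq> 0" for m using Gp[of m] by (rule less_imp_neq[symmetric])
  have PQ: "(b + 1/2 + real m) * Q m = (b / 2 + real m) * P m" for m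
  proof -
    have gen: "k * (c * (g2 * (h * g1) / (k * g3 * F))) = h * (c * (g1 * g2 / (g3 * F)))"
      if "k \<noteq> 0" "g3 \<noteq> 0" "F \<noteq> 0" for k c g1 g2 g3 h F :: real
      using that by (simp add: field_simps)
    show ?thesis unfolding P_def Q_def G
      by (rule gen) (use p1[of m] gn[of m] in simp_all)
  qed
  have QP: "real (Suc m) * P (Suc m) = ((b + 1) / 2 + real m) * Q m" for m
  proof -
    have s: "c + real (Suc m) = c + real m + 1" for c by simp
    have gen: "N * (c * (X * (h * g2) / (Y * (N * F)))) = h * (c * (g2 * X / (Y * F)))"
      if "N \<noteq> 0" "Y \<noteq> 0" "F \<noteq> 0" for N c X h g2 Y F :: real
      using that by (simp add: field_simps)
    have "fact (Suc m) = real (Suc m) * fact m" by (rule fact_Suc)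
    then show ?thesis unfolding P_def Q_def s G(2)
      by (simp only:) (rule gen, use gn[of "Suc m", unfolded s] in simp_all)
  qed
  have step: "dnum (Suc (2 * m)) = 2 * (b + 1/2 + real m)" "dnum (Suc (Suc (2 * m))) = 2 * real (Suc m)" for m
    by (simp_all add: dnum_def)
  have odd: "azero * lcoef (Suc (2 * m)) = Q m" if "azero * lcoef (2 * m) = P m" for m
  proof -
    have "2 * (b + 1/2 + real m) * (azero * lcoef (Suc (2 * m))) = azero * (dnum (Suc (2 * m)) * lcoef (Suc (2 * m)))"
      unfolding step by (simp only: mult_ac)
    also have "\<dots> = (b + 2 * real m) * (azero * lcoef (2 * m))" unfolding lcoef_Suc by (simp add: mult_ac)
    also have "\<dots> = 2 * ((b / 2 + real m) * P m)" unfolding that by (simp add: algebra_simps)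
    also have "\<dots> = 2 * (b + 1/2 + real m) * Q m" unfolding PQ[symmetric] by (simp only: mult.assoc)
    finally show ?thesis using p1[of m] by (subst (asm) mult_cancel_left) auto
  qed
  have even: "azero * lcoef (2 * m) = P m" for m
  proof (induction m)
    case 0
    have g: "Gamma (b / 2 + 1) = b / 2 * Gamma (b / 2)" using G(1)[of 0] by simp
    show ?case unfolding azero_def P_def g by simp
  next
    case (Suc m)
    have "2 * real (Suc m) * (azero * lcoef (Suc (Suc (2 * m)))) = azero * (dnum (Suc (Suc (2 * m))) * lcoef (Suc (Suc (2 * m))))"
      unfolding step by (simp only: mult_ac)
    also have "\<dots> = (b + real (Suc (2 * m))) * (azero * lcoef (Suc (2 * m)))"
      unfolding lcoef_Suc[of "Suc (2 * m)"] by (simp only: mult_ac)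
    also have "\<dots> = 2 * (((b + 1) / 2 + real m) * Q m)" unfolding odd[OF Suc] by (simp add: algebra_simps add_divide_distrib)
    also have "\<dots> = 2 * real (Suc m) * P (Suc m)" unfolding QP[symmetric] by (simp only: mult.assoc)
    finally show ?case by (subst (asm) mult_cancel_left) auto
  qed
  show "azero * lcoef (2 * m) = b / 2 * (Gamma (b / 2 + real m) * Gamma ((b + 1) / 2 + real m) / (Gamma (b + 1/2 + real m) * fact m))"
    using even[of m] by (simp only: P_def)
  show "azero * lcoef (Suc (2 * m)) = b / 2 * (Gamma ((b + 1) / 2 + real m) * Gamma (b / 2 + real m + 1) / (Gamma (b + 1/2 + real m + 1) * fact m))"
    using odd[OF even[of m]] by (simp only: Q_def)
qed

lemma legs_legendre:
  assumes w: "cmod w > 1"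
  shows "(if b = 0 then 1 else of_real b * w powr of_real b * (legendre_Q (b - 1) w - legendre_Q b w)) = of_real azero * legs (- 1 / w)"
proof (cases "b = 0")
  case True
  have pz: "pochhammer b n = (if n = 0 then 1 else 0)" for n unfolding True by (rule pochhammer_0_left)
  have lc: "lcoef n = (if n = 0 then 1 else 0)" for n unfolding lcoef_def pz by simp
  have "legs (- 1 / w) = (\<Sum>n\<in>{0}. of_real (lcoef n) * (- 1 / w) ^ n)"
    unfolding legs_def by (intro suminf_finite) (auto simp: lc)
  then have L: "legs (- 1 / w) = 1" by simp
  have "azero = Gamma (b / 2 + 1) * Gamma ((b + 1) / 2) / Gamma (b + 1/2)" by (rule azero_def)
  also have "\<dots> = 1" unfolding True by (simp add: Gamma_one_half_real)
  finally have a: "azero = 1" .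
  show ?thesis unfolding L a using True by simp
next
  case False
  define u where "u = - 1 / w"
  define t where "t n = of_real (azero * lcoef n) * u ^ n" for n
  have w0: "w \<noteq> 0" using w by auto
  have u: "cmod u < 1" using w by (simp add: u_def norm_divide divide_less_eq)
  have "summable (\<lambda>n. norm (of_real (lcoef n) * u ^ n))"
  proof (rule powser_insidea)
    define x where "x = (of_real ((1 + cmod u) / 2) :: complex)"
    have x: "cmod x = (1 + cmod u) / 2" unfolding x_def norm_of_real by simp
    show "summable (\<lambda>n. of_real (lcoef n) * x ^ n)" by (rule legs_summable) (use x u in simp)
    show "norm u < norm x" using x u by simp
  qed
  then have "summable (\<lambda>n. \<bar>azero\<bar> * norm (of_real (lcoef n) * u ^ n))" by (rule summable_mult)
  then have "summable (\<lambda>n. norm (t n))" by (simp add: t_def norm_mult abs_mult mult.assoc)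
  then obtain E O' where EO: "(\<lambda>m. t (2 * m)) sums E" "(\<lambda>m. t (Suc (2 * m))) sums O'" "suminf t = E + O'"
    by (rule sums_even_odd)
  have "suminf t = of_real azero * legs u"
    unfolding legs_def suminf_mult[OF legs_summable[OF u], symmetric] t_def by (simp add: mult.assoc)
  then have sum: "of_real azero * legs u = E + O'" using EO(3) by simp
  define k where "k = of_real b / 2 * w powr of_real b"
  have k0: "k \<noteq> 0" using False w0 by (simp add: k_def)
  have pw: "w powr of_real b * w powr of_real (- real n - b) = inverse (w ^ n)" for n
  proof -
    have "w powr of_real b * w powr of_real (- real n - b) = w powr (- of_nat n)"
      by (simp flip: powr_add)
    then show ?thesis using w0 by (simp add: powr_minus powr_nat)
  qed
  have "legendre_Q (b - 1) w = 1/2 * (inverse k * E)"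
  proof -
    have "of_real (Gamma ((b - 1 + 1) / 2 + real m) * Gamma ((b - 1 + 2) / 2 + real m) / (Gamma (b - 1 + 3/2 + real m) * fact m))
            * w powr of_real (- 2 * real m - (b - 1) - 1) = inverse k * t (2 * m)" for m
    proof -
      define g where "g = Gamma (b / 2 + real m) * Gamma ((b + 1) / 2 + real m) / (Gamma (b + 1/2 + real m) * fact m)"
      have e: "- 2 * real m - (b - 1) - 1 = - real (2 * m) - b" by simp
      have g: "Gamma ((b - 1 + 1) / 2 + real m) * Gamma ((b - 1 + 2) / 2 + real m) / (Gamma (b - 1 + 3/2 + real m) * fact m) = g"
        by (simp add: g_def add.commute)
      have u2: "u ^ (2 * m) = inverse (w ^ (2 * m))" by (simp add: u_def power_divide power_mult divide_inverse power_inverse)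
      have "t (2 * m) = of_real (b / 2 * g) * inverse (w ^ (2 * m))"
        unfolding t_def lcoef_legendre(1)[OF False] u2 g_def ..
      also have "\<dots> = k * (of_real g * w powr of_real (- real (2 * m) - b))"
        unfolding pw[symmetric] k_def by simp
      finally show ?thesis unfolding e g using k0 by simp
    qed
    then show ?thesis unfolding legendre_Q_def using sums_unique[OF sums_mult[OF EO(1), of "inverse k"]] by simp
  qed
  moreover have "legendre_Q b w = - 1/2 * (inverse k * O')"
  proof -
    have "of_real (Gamma ((b + 1) / 2 + real m) * Gamma ((b + 2) / 2 + real m) / (Gamma (b + 3/2 + real m) * fact m))
            * w powr of_real (- 2 * real m - b - 1) = - inverse k * t (Suc (2 * m))" for m
    proof -
      define g where "g = Gamma ((b + 1) / 2 + real m) * Gamma (b / 2 + real m + 1) / (Gamma (b + 1/2 + real m + 1) * fact m)"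
      have e: "- 2 * real m - b - 1 = - real (Suc (2 * m)) - b" by simp
      have "(b + 2) / 2 + real m = b / 2 + real m + 1" "b + 3/2 + real m = b + 1/2 + real m + 1" by (simp_all add: field_simps)
      then have g: "Gamma ((b + 1) / 2 + real m) * Gamma ((b + 2) / 2 + real m) / (Gamma (b + 3/2 + real m) * fact m) = g"
        by (simp only: g_def)
      have u2: "u ^ (Suc (2 * m)) = - inverse (w ^ (Suc (2 * m)))" by (simp add: u_def power_divide power_mult divide_inverse power_inverse)
      have "t (Suc (2 * m)) = - (of_real (b / 2 * g) * inverse (w ^ (Suc (2 * m))))"
        unfolding t_def lcoef_legendre(2)[OF False] u2 g_def by simp
      also have "\<dots> = - (k * (of_real g * w powr of_real (- real (Suc (2 * m)) - b)))"
        unfolding pw[symmetric] k_def by simp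
      finally show ?thesis unfolding e g using k0 by simp
    qed
    then show ?thesis unfolding legendre_Q_def using sums_unique[OF sums_mult[OF EO(2), of "- inverse k"]] by simp
  qed
  ultimately have "of_real b * w powr of_real b * (legendre_Q (b - 1) w - legendre_Q b w) = 2 * k * (1/2 * (inverse k * E) + 1/2 * (inverse k * O'))"
    by (simp add: k_def)
  also have "\<dots> = E + O'" using k0 by (simp add: field_simps)
  finally show ?thesis using False sum by (simp add: u_def)
qed

lemma mlap_holomorphic: "mlap x y holomorphic_on {z. Im z > 0}"
  unfolding holomorphic_on_def field_differentiable_def
  using mlap_DERIV by (blast intro: has_field_derivative_at_within)

text \<open>The continuation into the disc: with \<open>x = y = 1\<close> the transform is defined for all
  \<open>z = i (2 (w - 1))\<^bsup>1/2\<^esup>\<close> in the upper half-plane, and \<open>(x\<^sup>2 + y\<^sup>2 - z\<^sup>2) / 2 = w\<close>.\<close>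

lemma Psi_exists:
  "\<exists>F. F holomorphic_on (- closed_segment (-1) 1) \<and> (\<forall>w. cmod w > 1 \<longrightarrow> F w = of_real azero * legs (- 1 / w))"
proof -
  define Z where "Z w = \<i> * csqrt (2 * (w - 1))" for w
  define D1 :: "complex set" where "D1 = {w. 2 * (w - 1) \<notin> \<real>\<^sub>\<le>\<^sub>0}"
  define D2 where "D2 = {w. cmod w > 1 \<and> w \<notin> \<real>\<^sub>\<le>\<^sub>0}"
  define G where "G w = of_real azero * w powr of_real b * mlap 1 1 (Z w) / clap" for w
  define H where "H w = of_real azero * legs (- 1 / w)" for w
  have o1: "open D1"
  proof -
    have "D1 = (\<lambda>w. 2 * (w - 1)) -` (- \<real>\<^sub>\<le>\<^sub>0)" by (auto simp: D1_def)
    moreover have "open ((\<lambda>w::complex. 2 * (w - 1)) -` (- \<real>\<^sub>\<le>\<^sub>0))"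
      by (intro open_vimage continuous_intros) (simp add: open_Compl)
    ultimately show ?thesis by simp
  qed
  have o0: "open {w. cmod w > 1}" by (intro open_Collect_less continuous_intros)
  have o2: "open D2"
  proof -
    have "D2 = {w. cmod w > 1} \<inter> - \<real>\<^sub>\<le>\<^sub>0" by (auto simp: D2_def)
    then show ?thesis using o0 by (simp add: open_Int open_Compl)
  qed
  have D1iff: "w \<in> D1 \<longleftrightarrow> \<not> (Im w = 0 \<and> Re w \<le> 1)" for w
    by (auto simp: D1_def complex_nonpos_Reals_iff)
  have D21: "D2 \<subseteq> D1"
  proof
    fix w assume w: "w \<in> D2"
    show "w \<in> D1" unfolding D1iff
    proof
      assume r: "Im w = 0 \<and> Re w \<le> 1"
      then have "cmod w = \<bar>Re w\<bar>" by (simp add: cmod_def)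
      then show False using w r by (auto simp: D2_def complex_nonpos_Reals_iff)
    qed
  qed
  have D1p: "w \<notin> \<real>\<^sub>\<le>\<^sub>0" if "w \<in> D1" for w
    using that unfolding D1iff complex_nonpos_Reals_iff by linarith
  have ImZ: "Im (Z w) > 0" if w: "w \<in> D1" for w
  proof (rule ccontr)
    let ?v = "2 * (w - 1)"
    assume "\<not> Im (Z w) > 0"
    define c where "c = csqrt ?v"
    have "Re c = 0" using csqrt_principal[of ?v] \<open>\<not> Im (Z w) > 0\<close> by (auto simp: Z_def c_def)
    then have "c\<^sup>2 \<in> \<real>\<^sub>\<le>\<^sub>0" by (simp add: complex_nonpos_Reals_iff power2_eq_square)
    then have "?v \<in> \<real>\<^sub>\<le>\<^sub>0" unfolding c_def power2_csqrt .
    then show False using w unfolding D1_def by blast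
  qed
  have holG: "G holomorphic_on D1"
  proof -
    have "Z holomorphic_on D1" unfolding Z_def[abs_def] by (intro holomorphic_intros) (auto simp: D1_def)
    then have "(\<lambda>w. mlap 1 1 (Z w)) holomorphic_on D1"
      using holomorphic_on_compose_gen[OF _ mlap_holomorphic[of 1 1], of Z D1] ImZ by (auto simp: o_def)
    then show ?thesis unfolding G_def[abs_def]
      by (intro holomorphic_intros) (use D1p clap_nonzero in auto)
  qed
  have holH: "H holomorphic_on {w. cmod w > 1}"
  proof -
    have "(\<lambda>w. - 1 / w) holomorphic_on {w. cmod w > 1}" by (intro holomorphic_intros) auto
    then have "(legs \<circ> (\<lambda>w. - 1 / w)) holomorphic_on {w. cmod w > 1}"
      by (rule holomorphic_on_compose_gen[OF _ legs_holomorphic]) (auto simp: norm_divide divide_less_eq)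
    then show ?thesis unfolding H_def[abs_def] by (intro holomorphic_intros) (simp add: o_def)
  qed
  have qZ: "qq 1 1 (Z w) = w" for w
  proof -
    have "(Z w)\<^sup>2 = - (2 * (w - 1))" by (simp add: Z_def power_mult_distrib)
    then show ?thesis by (simp add: qq_def)
  qed
  obtain R where R: "R \<ge> 0" "\<And>z. Im z > R \<Longrightarrow> mlap 1 1 z = clap * phis 1 1 z" using mlap_eq_phis by blast
  have GH: "G w = H w" if w: "w \<noteq> 0" "Im (Z w) > R" for w
  proof -
    have "w powr of_real b * w powr - of_real b = 1" using w(1) by (simp flip: powr_add)
    then have "w powr of_real b * phis 1 1 (Z w) = legs (- 1 / w)"
      unfolding phis_def qZ by (simp flip: mult.assoc)
    then show ?thesis using R(2)[OF w(2)] clap_nonzero by (simp add: G_def H_def)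
  qed
  define r0 where "r0 = 1 + R\<^sup>2"
  define U :: "complex set" where "U = {of_real r | r. r > r0}"
  have U1: "r > 1" if "r > r0" for r using that zero_le_power2[of R] unfolding r0_def by linarith
  have eq2: "G w - H w = 0" if w: "w \<in> D2" for w
  proof (rule analytic_continuation[where f = "\<lambda>w. G w - H w" and S = D2 and U = U and \<xi> = "of_real (r0 + 1)"])
    show "(\<lambda>w. G w - H w) holomorphic_on D2"
      by (intro holomorphic_on_diff holomorphic_on_subset[OF holG D21] holomorphic_on_subset[OF holH]) (auto simp: D2_def)
    show "open D2" by (rule o2)
    show "connected D2" unfolding D2_def by (rule connected_outside_slit)
    have rD2: "of_real r \<in> D2" if "r > r0" for r
      using U1[OF that] by (simp add: D2_def complex_nonpos_Reals_iff)
    then show "U \<subseteq> D2" by (auto simp: U_def)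
    show "of_real (r0 + 1) \<in> D2" by (rule rD2) simp
    show "of_real (r0 + 1) islimpt U"
      unfolding islimpt_approachable
    proof (intro allI impI)
      fix e :: real assume e: "e > 0"
      have "(of_real (r0 + 1 + e / 2) :: complex) \<in> U" using e by (auto simp: U_def simp del: of_real_add)
      moreover have "dist (of_real (r0 + 1 + e / 2) :: complex) (of_real (r0 + 1)) < e"
        unfolding dist_of_real using e by (simp add: dist_real_def)
      moreover have "(of_real (r0 + 1 + e / 2) :: complex) \<noteq> of_real (r0 + 1)" unfolding of_real_eq_iff using e by simp
      ultimately show "\<exists>x'\<in>U. x' \<noteq> of_real (r0 + 1) \<and> dist x' (of_real (r0 + 1)) < e" by blast
    qed
    show "G z - H z = 0" if zU: "z \<in> U" for z
    proof -
      obtain r where r: "z = of_real r" "r > r0" using zU by (auto simp: U_def)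
      have v: "2 * (z - 1) = of_real (2 * (r - 1))" by (simp add: r(1))
      have "Im (Z z) = sqrt (2 * (r - 1))"
        unfolding Z_def v using U1[OF r(2)] by (simp add: cmod_def)
      moreover have "R\<^sup>2 < 2 * (r - 1)"
      proof -
        have "R\<^sup>2 < r - 1" using r(2) by (simp add: r0_def)
        also have "r - 1 \<le> 2 * (r - 1)" using U1[OF r(2)] by simp
        finally show ?thesis .
      qed
      then have "R < sqrt (2 * (r - 1))" by (rule real_less_rsqrt)
      ultimately show ?thesis using GH[of z] r U1[OF r(2)] by auto
    qed
  qed (rule w)
  define F where "F w = (if cmod w > 1 then H w else G w)" for w
  have "F holomorphic_on {w. cmod w > 1} \<union> D1"
  proof (rule holomorphic_on_Un)
    show "F holomorphic_on {w. cmod w > 1}" by (rule holomorphic_transform[OF holH]) (simp add: F_def)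
    show "F holomorphic_on D1"
    proof (rule holomorphic_transform[OF holG])
      fix w assume w: "w \<in> D1"
      show "G w = F w" using eq2[of w] D1p[OF w] by (auto simp: F_def D2_def)
    qed
  qed (fact o0 o1)+
  moreover have "- closed_segment (-1) 1 \<subseteq> {w. cmod w > 1} \<union> D1"
  proof
    fix w :: complex assume w: "w \<in> - closed_segment (-1) 1"
    show "w \<in> {w. cmod w > 1} \<union> D1"
    proof (rule ccontr)
      assume "w \<notin> {w. cmod w > 1} \<union> D1"
      then have 1: "cmod w \<le> 1" "Im w = 0" by (auto simp: D1iff)
      then have "\<bar>Re w\<bar> \<le> 1" using abs_Re_le_cmod[of w] by linarith
      moreover have "w = of_real (Re w)" using 1(2) by (simp add: complex_eq_iff)
      moreover have "of_real (Re w) = (1 - (Re w + 1) / 2) *\<^sub>R (-1) + ((Re w + 1) / 2) *\<^sub>R (1 :: complex)"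
        by (simp add: scaleR_conv_of_real complex_eq_iff field_simps)
      ultimately have "0 \<le> (Re w + 1) / 2 \<and> (Re w + 1) / 2 \<le> 1 \<and> w = (1 - (Re w + 1) / 2) *\<^sub>R (-1) + ((Re w + 1) / 2) *\<^sub>R 1"
        by (auto simp: abs_le_iff)
      then have "w \<in> closed_segment (-1) 1" unfolding in_segment(1) by blast
      then show False using w by simp
    qed
  qed
  ultimately have "F holomorphic_on (- closed_segment (-1) 1)" by (rule holomorphic_on_subset)
  moreover have "\<forall>w. cmod w > 1 \<longrightarrow> F w = of_real azero * legs (- 1 / w)" by (simp add: F_def H_def)
  ultimately show ?thesis by blast
qed

lemma Psi_holomorphic: "Psi b holomorphic_on (- closed_segment (-1) 1)"
  and Psi_outside: "cmod w > 1 \<Longrightarrow> Psi b w = of_real azero * legs (- 1 / w)"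
proof -
  have "\<exists>F. F holomorphic_on (- closed_segment (-1) 1) \<and> (\<forall>w. cmod w > 1 \<longrightarrow>
        F w = (if b = 0 then 1 else of_real b * w powr of_real b * (legendre_Q (b - 1) w - legendre_Q b w)))"
    using Psi_exists legs_legendre by (metis (no_types, lifting))
  from someI_ex[OF this, folded Psi_def]
  have *: "Psi b holomorphic_on (- closed_segment (-1) 1) \<and> (\<forall>w. cmod w > 1 \<longrightarrow>
        Psi b w = (if b = 0 then 1 else of_real b * w powr of_real b * (legendre_Q (b - 1) w - legendre_Q b w)))" .
  then show "Psi b holomorphic_on (- closed_segment (-1) 1)" by blast
  show "Psi b w = of_real azero * legs (- 1 / w)" if "cmod w > 1"
    using * that legs_legendre[OF that] by metis
qed

lemma quotient_outside_segment:
  assumes z: "Im z > 0" and xy: "x \<noteq> 0" "y \<noteq> 0"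
  shows "qq x y z / of_real (x * y) \<notin> closed_segment (-1) 1"
proof
  assume "qq x y z / of_real (x * y) \<in> closed_segment (-1) 1"
  then obtain u where u: "0 \<le> u" "u \<le> 1" "qq x y z / of_real (x * y) = (1 - u) *\<^sub>R (-1) + u *\<^sub>R 1"
    unfolding in_segment(1) by (elim exE conjE)
  define s where "s = 2 * u - 1"
  have s: "\<bar>s\<bar> \<le> 1" using u by (simp add: s_def abs_le_iff)
  have "qq x y z / of_real (x * y) = of_real s" unfolding u(3) by (simp add: s_def scaleR_conv_of_real)
  then have "qq x y z = of_real (s * (x * y))" using xy by (simp add: field_simps)
  then have zz: "z\<^sup>2 = of_real (x\<^sup>2 + y\<^sup>2 - 2 * (s * (x * y)))" by (simp add: qq_def field_simps)
  then have "Im (z\<^sup>2) = 0" by simp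
  then have "Re z = 0" using z by (simp add: power2_eq_square)
  then have "Re (z\<^sup>2) < 0" using z by (simp add: power2_eq_square)
  then have "x\<^sup>2 + y\<^sup>2 < 2 * (s * (x * y))" unfolding zz by simp
  also have "\<dots> \<le> 2 * \<bar>x * y\<bar>"
  proof -
    have "s * (x * y) \<le> \<bar>s\<bar> * \<bar>x * y\<bar>" by (metis abs_ge_self abs_mult)
    also have "\<dots> \<le> 1 * \<bar>x * y\<bar>" using s by (intro mult_right_mono) auto
    finally show ?thesis by simp
  qed
  also have "\<dots> \<le> x\<^sup>2 + y\<^sup>2"
    using zero_le_power2[of "\<bar>x\<bar> - \<bar>y\<bar>"] by (simp add: power2_diff abs_mult)
  finally show False by simp
qed

lemma Phi_conv_Psi: "Phi b x y z = qq x y z powr (- of_real b) * Psi b (qq x y z / of_real (x * y))"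
  by (simp add: Phi_def qq_def mult.assoc)

text \<open>Both sides are holomorphic in the upper half-plane and agree for large imaginary part.\<close>

lemma mlap_eq_Phi:
  assumes xy: "x \<noteq> 0" "y \<noteq> 0" and z: "Im z > 0"
  shows "of_real azero * mlap x y z = clap * Phi b x y z"
proof -
  obtain R where R: "R \<ge> 0" "\<And>z. Im z > R \<Longrightarrow> mlap x y z = clap * phis x y z" using mlap_eq_phis by blast
  define R' where "R' = max R (\<bar>x\<bar> + \<bar>y\<bar>)"
  have R'0: "R' \<ge> 0" using R(1) by (simp add: R'_def)
  show ?thesis
  proof (rule analytic_continuation_open[where f = "\<lambda>z. of_real azero * mlap x y z" and g = "\<lambda>z. clap * Phi b x y z" and s = "{z. Im z > R'}" and s' = "{z. Im z > 0}"])
    show "open {z. Im z > R'}" "open {z. Im z > 0}" by (rule open_halfspace_Im_gt)+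
    show "{z. Im z > R'} \<noteq> {}" using complex.sel(2)[of 0 "R' + 1"] by (metis (mono_tags) empty_iff less_add_one mem_Collect_eq)
    show "connected {z. Im z > 0}" by (intro convex_connected convex_halfspace_Im_gt)
    show "{z. Im z > R'} \<subseteq> {z. Im z > 0}" using R'0 by auto
    show "(\<lambda>z. of_real azero * mlap x y z) holomorphic_on {z. Im z > 0}"
      by (intro holomorphic_intros mlap_holomorphic)
    show "(\<lambda>z. clap * Phi b x y z) holomorphic_on {z. Im z > 0}"
    proof -
      have q: "qq x y holomorphic_on {z. Im z > 0}" unfolding qq_def[abs_def] by (intro holomorphic_intros) auto
      then have "(\<lambda>z. qq x y z / of_real (x * y)) holomorphic_on {z. Im z > 0}"
        by (intro holomorphic_intros) (use xy in auto)
      then have "(Psi b \<circ> (\<lambda>z. qq x y z / of_real (x * y))) holomorphic_on {z. Im z > 0}"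
        by (rule holomorphic_on_compose_gen[OF _ Psi_holomorphic]) (use quotient_outside_segment[OF _ xy] in blast)
      then show ?thesis unfolding Phi_conv_Psi o_def
        by (intro holomorphic_intros q) (use qq_nonpos in auto)
    qed
    show "of_real azero * mlap x y z = clap * Phi b x y z" if "z \<in> {z. Im z > R'}" for z
    proof -
      have z: "Im z > R" "Im z > \<bar>x\<bar> + \<bar>y\<bar>" using that by (auto simp: R'_def)
      then have z0: "Im z > 0" using R(1) by linarith
      have q0: "qq x y z \<noteq> 0" by (rule qq_nonzero[OF z0])
      have "cmod (qq x y z / of_real (x * y)) > 1"
        using qq_large(1)[OF z(2)] xy by (simp add: norm_divide norm_mult abs_mult less_divide_eq)
      from Psi_outside[OF this]
      have "Psi b (qq x y z / of_real (x * y)) = of_real azero * legs (- of_real (x * y) / qq x y z)" by simp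
      then show ?thesis unfolding Phi_conv_Psi R(2)[OF z(1)] phis_def by (simp only: mult_ac)
    qed
  qed (use z in simp)
qed

lemma lap_eq_Phi:
  assumes xy: "x \<noteq> 0" "y \<noteq> 0" and z: "Im z > 0"
  shows "lap x y z = \<i> * of_real (dconst\<^sup>2 / (2 * pi)) * (Phi b x y z / (of_real x + z - of_real y))"
proof -
  have nz: "of_real x + z - of_real y \<noteq> 0" using z by (auto simp: complex_eq_iff)
  have "of_real azero * mlap x y z = of_real azero * (\<i> * of_real (dconst\<^sup>2 / (2 * pi)) * Phi b x y z)"
    unfolding mlap_eq_Phi[OF assms] clap_azero by simp
  then have "mlap x y z = \<i> * of_real (dconst\<^sup>2 / (2 * pi)) * Phi b x y z"
    using azero_pos by (subst (asm) mult_cancel_left) auto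
  moreover have "mlap x y z = (of_real x + z - of_real y) * lap x y z" by (simp add: mlap_def algebra_simps)
  ultimately have "(of_real x + z - of_real y) * lap x y z = \<i> * of_real (dconst\<^sup>2 / (2 * pi)) * Phi b x y z" by simp
  then have "lap x y z = \<i> * of_real (dconst\<^sup>2 / (2 * pi)) * Phi b x y z / (of_real x + z - of_real y)"
    using nz by (metis nonzero_mult_div_cancel_left)
  then show ?thesis by (simp only: times_divide_eq_right)
qed

text \<open>The spectral factor of the evolution, damped by \<open>e\<^bsup>-\<epsilon>\<bar>s\<bar>\<^esup>\<close>.\<close>

definition damp :: "real \<Rightarrow> real \<Rightarrow> real \<Rightarrow> complex" where
  "damp t \<epsilon> s = of_real (exp (- \<epsilon> * \<bar>s\<bar>)) * exp (\<i> * of_real (t * s))"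

lemma damp_continuous: "continuous_on A (damp t \<epsilon>)"
  unfolding damp_def by (intro continuous_intros)

text \<open>Positive frequencies belong to the upper boundary value \<open>t + i \<epsilon>\<close>, negative ones to \<open>t - i \<epsilon>\<close>.\<close>

lemma damp_split:
  assumes "s \<noteq> 0"
  shows "damp t \<epsilon> s = hexp (of_real t + \<i> * of_real \<epsilon>) s + hexp (- (of_real t - \<i> * of_real \<epsilon>)) (- s)"
proof -
  have e: "\<i> * (of_real t + \<i> * of_real \<epsilon>) * of_real s = of_real (- \<epsilon> * s) + \<i> * of_real (t * s)" for \<epsilon>
    by (simp add: algebra_simps)
  have d: "exp (of_real (- \<epsilon> * s) + \<i> * of_real (t * s)) = of_real (exp (- \<epsilon> * s)) * exp (\<i> * of_real (t * s))" for \<epsilon>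
    by (simp only: exp_add exp_of_real)
  show ?thesis
  proof (cases "s > 0")
    case True
    then show ?thesis unfolding hexp_def e d damp_def by simp
  next
    case False
    then have s: "s < 0" using assms by simp
    have m: "\<i> * (- (of_real t - \<i> * of_real \<epsilon>)) * of_real (- s) = \<i> * (of_real t + \<i> * of_real (- \<epsilon>)) * of_real s"
      by (simp add: algebra_simps)
    show ?thesis using s unfolding hexp_def m e d damp_def by simp
  qed
qed

text \<open>The part over \<open>s < 0\<close>, reflected, is the Laplace transform at \<open>- x\<close>, \<open>- y\<close> and \<open>- t + i \<epsilon>\<close>.  The
  Legendre functions only see \<open>x\<^sup>2\<close>, \<open>y\<^sup>2\<close>, \<open>x y\<close> and \<open>z\<^sup>2\<close>, so it is the term with \<open>t - i \<epsilon>\<close>.\<close>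

lemma jump_kernel_eq:
  assumes xy: "x \<noteq> 0" "y \<noteq> 0" and \<epsilon>: "\<epsilon> > 0"
  shows "jump_kernel b t \<epsilon> x y = inverse (of_real (dconst\<^sup>2)) * (\<integral>s. damp t \<epsilon> s * dprod x y s \<partial>wmeas)"
proof -
  define z where "z = of_real t + \<i> * of_real \<epsilon>"
  define z' where "z' = of_real t - \<i> * of_real \<epsilon>"
  have z: "Im z > 0" "Im (- z') > 0" using \<epsilon> by (simp_all add: z_def z'_def)
  let ?k = "\<i> * of_real (dconst\<^sup>2 / (2 * pi)) :: complex"
  have P: "Phi b (- x) (- y) (- z') = Phi b x y z'" by (simp add: Phi_def)
  have n: "of_real (- x) + - z' - of_real (- y) = - (of_real x + z' - of_real y)" by simp
  have i2: "integrable wmeas (\<lambda>s. hexp (- z') s * dprod (- x) (- y) s)" by (rule lap_integrable(1)[OF z(2)])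
  have m2: "(\<lambda>s. hexp (- z') s * dprod (- x) (- y) s) \<in> borel_measurable borel" by measurable
  have i3: "integrable wmeas (\<lambda>s. hexp (- z') (- s) * dprod (- x) (- y) (- s))"
  proof -
    have "integrable (distr wmeas borel uminus) (\<lambda>s. hexp (- z') s * dprod (- x) (- y) s)"
      unfolding wmeas_reflect by (rule i2)
    then show ?thesis by (subst (asm) integrable_distr_eq) auto
  qed
  have "(\<integral>s. damp t \<epsilon> s * dprod x y s \<partial>wmeas)
      = (\<integral>s. hexp z s * dprod x y s + hexp (- z') (- s) * dprod (- x) (- y) (- s) \<partial>wmeas)"
  proof (rule integral_cong_AE)
    have "AE s in wmeas. s \<noteq> 0" by (rule AE_wmeas[OF AE_lborel_singleton])
    then show "AE s in wmeas. damp t \<epsilon> s * dprod x y s = hexp z s * dprod x y s + hexp (- z') (- s) * dprod (- x) (- y) (- s)"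
    proof eventually_elim
      fix s :: real assume s: "s \<noteq> 0"
      have "dprod (- x) (- y) (- s) = dprod x y s" by (simp add: dprod_def dline_reflect)
      then show "damp t \<epsilon> s * dprod x y s = hexp z s * dprod x y s + hexp (- z') (- s) * dprod (- x) (- y) (- s)"
        unfolding damp_split[OF s] z_def z'_def by (simp add: algebra_simps)
    qed
    have "(\<lambda>s. damp t \<epsilon> s * dprod x y s) \<in> borel_measurable borel"
      by (intro borel_measurable_continuous_onI continuous_intros damp_continuous dprod_continuous)
    then show "(\<lambda>s. damp t \<epsilon> s * dprod x y s) \<in> borel_measurable wmeas" by simp
    show "(\<lambda>s. hexp z s * dprod x y s + hexp (- z') (- s) * dprod (- x) (- y) (- s)) \<in> borel_measurable wmeas"
      by (intro borel_measurable_integrable Bochner_Integration.integrable_add lap_integrable(1)[OF z(1)] i3)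
  qed
  also have "\<dots> = lap x y z + (\<integral>s. hexp (- z') (- s) * dprod (- x) (- y) (- s) \<partial>wmeas)"
    unfolding lap_def by (intro Bochner_Integration.integral_add lap_integrable(1)[OF z(1)] i3)
  also have "(\<integral>s. hexp (- z') (- s) * dprod (- x) (- y) (- s) \<partial>wmeas) = lap (- x) (- y) (- z')"
    unfolding lap_def by (rule integral_wmeas_reflect[OF m2])
  also have "lap x y z + lap (- x) (- y) (- z') = ?k * (Phi b x y z / (of_real x + z - of_real y) - Phi b x y z' / (of_real x + z' - of_real y))"
  proof -
    have "lap (- x) (- y) (- z') = - (?k * (Phi b x y z' / (of_real x + z' - of_real y)))"
    proof -
      have "lap (- x) (- y) (- z') = ?k * (Phi b (- x) (- y) (- z') / (of_real (- x) + - z' - of_real (- y)))"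
        by (rule lap_eq_Phi) (use xy z(2) in simp_all)
      then show ?thesis unfolding n P by (simp only: divide_minus_right mult_minus_right)
    qed
    then show ?thesis unfolding lap_eq_Phi[OF xy z(1)] by (simp add: right_diff_distrib)
  qed
  finally have I: "(\<integral>s. damp t \<epsilon> s * dprod x y s \<partial>wmeas) = ?k * (Phi b x y z / (of_real x + z - of_real y) - Phi b x y z' / (of_real x + z' - of_real y))" .
  have c: "inverse (of_real (dconst\<^sup>2)) * ?k = - 1 / (2 * of_real pi * \<i>)"
    using dconst_pos by (simp add: field_simps)
  show ?thesis unfolding I jump_kernel_def z_def z'_def c[symmetric] by (rule mult.assoc)
qed

lemma damp_rapid:
  assumes \<epsilon>: "\<epsilon> > 0" shows "rapid (damp t \<epsilon>)"
proof -
  have h: "rapid (hexp (\<i> * of_real \<epsilon>))" by (rule hexp_rapid) (use \<epsilon> in simp)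
  have "rapid (\<lambda>s. of_real (cmod (hexp (\<i> * of_real \<epsilon>) s)) + of_real (cmod (hexp (\<i> * of_real \<epsilon>) (- s))))"
  proof (rule rapid_add)
    show "rapid (\<lambda>s. of_real (cmod (hexp (\<i> * of_real \<epsilon>) s)))" using h by (simp add: rapid_def)
    show "rapid (\<lambda>s. of_real (cmod (hexp (\<i> * of_real \<epsilon>) (- s))))" using rapid_reflect[OF h] by (simp add: rapid_def)
  qed
  then have r: "rapid (\<lambda>s. of_real (cmod (hexp (\<i> * of_real \<epsilon>) s) + cmod (hexp (\<i> * of_real \<epsilon>) (- s))))" by simp
  show ?thesis unfolding rapid_def
  proof
    fix k
    obtain C where C: "\<And>s. \<bar>s\<bar> ^ k * cmod (of_real (cmod (hexp (\<i> * of_real \<epsilon>) s) + cmod (hexp (\<i> * of_real \<epsilon>) (- s)))) \<le> C"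
      using r unfolding rapid_def by meson
    have "\<bar>s\<bar> ^ k * cmod (damp t \<epsilon> s) \<le> max C 1" for s
    proof (cases "s = 0")
      case True
      then show ?thesis by (cases k) (simp_all add: damp_def)
    next
      case False
      then have "cmod (damp t \<epsilon> s) = cmod (of_real (cmod (hexp (\<i> * of_real \<epsilon>) s) + cmod (hexp (\<i> * of_real \<epsilon>) (- s))))"
        unfolding norm_of_real by (cases "s > 0") (auto simp: damp_def norm_mult hexp_norm)
      then show ?thesis using C[of s] by simp
    qed
    then show "\<exists>C. \<forall>s. \<bar>s\<bar> ^ k * cmod (damp t \<epsilon> s) \<le> C" by blast
  qed
qed

text \<open>Fubini's theorem, for which the damping makes the double integral converge absolutely.\<close>

lemma kernel_integral:
  assumes g: "g \<in> schwartz" and \<epsilon>: "\<epsilon> > 0"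
  shows "integrable wmeas (\<lambda>y. (\<integral>s. damp t \<epsilon> s * dprod x y s \<partial>wmeas) * g y)"
    and "(\<integral>y. (\<integral>s. damp t \<epsilon> s * dprod x y s \<partial>wmeas) * g y \<partial>wmeas) = (\<integral>s. damp t \<epsilon> s * dline 0 x s * dtr 0 g (- s) \<partial>wmeas)"
proof -
  interpret pair_sigma_finite wmeas wmeas by (simp add: pair_sigma_finite_def sigma_finite_wmeas)
  obtain C where C: "C \<ge> 0" "\<And>x y. cmod (dline 0 x y) \<le> C * (1 + \<bar>x\<bar>) * (1 + \<bar>y\<bar>)"
    using dline_bound by blast
  define h where "h s y = damp t \<epsilon> s * dprod x y s * g y" for s y
  have h: "integrable (wmeas \<Otimes>\<^sub>M wmeas) (\<lambda>(s, y). h s y)"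
  proof (rule integrable_product_bound[OF sigma_finite_wmeas sigma_finite_wmeas])
    have "continuous_on UNIV (\<lambda>p::real \<times> real. h (fst p) (snd p))"
      unfolding h_def dprod_def
      by (intro continuous_intros continuous_on_compose2[OF schwartz_continuous[OF g, of UNIV]]
          continuous_on_compose2[OF damp_continuous[of UNIV]]) auto
    then have "(\<lambda>p::real \<times> real. h (fst p) (snd p)) \<in> borel_measurable (borel \<Otimes>\<^sub>M borel)"
      unfolding borel_prod by (rule borel_measurable_continuous_onI)
    moreover have "borel_measurable (wmeas \<Otimes>\<^sub>M wmeas) = (borel_measurable (borel \<Otimes>\<^sub>M borel) :: (real \<times> real \<Rightarrow> complex) set)"
      by (intro measurable_cong_sets sets_pair_measure_cong) auto
    ultimately show "(\<lambda>(s, y). h s y) \<in> borel_measurable (wmeas \<Otimes>\<^sub>M wmeas)" by (simp add: case_prod_beta)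
    define a where "a s = of_real ((1 + \<bar>s\<bar>) ^ 2) * damp t \<epsilon> s" for s :: real
    have an: "cmod (a s) = (1 + \<bar>s\<bar>) ^ 2 * cmod (damp t \<epsilon> s)" for s
      unfolding a_def norm_mult norm_of_real by simp
    have "rapid a" by (rule rapid_growth[OF damp_rapid[OF \<epsilon>, of t], of _ 1 2]) (simp add: an)
    moreover have "a \<in> borel_measurable borel" unfolding a_def[abs_def]
      by (intro borel_measurable_continuous_onI continuous_intros damp_continuous)
    ultimately have "integrable wmeas a" by (intro rapid_integrable)
    then show "integrable wmeas (\<lambda>s. C * (1 + \<bar>x\<bar>) * C * cmod (a s))" by (intro integrable_mult_right integrable_norm)
    have "integrable wmeas (\<lambda>s. cmod (g s) + cmod (of_real s * g s))"
      by (intro Bochner_Integration.integrable_add integrable_norm rapid_integrable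
        schwartz_measurable schwartz_rapid schwartz_times_x g)
    then show "integrable wmeas (\<lambda>y. (1 + \<bar>y\<bar>) * cmod (g y))" by (simp add: norm_mult distrib_right)
    show "cmod (case (s, y) of (s, y) \<Rightarrow> h s y) \<le> C * (1 + \<bar>x\<bar>) * C * cmod (a s) * ((1 + \<bar>y\<bar>) * cmod (g y))" for s y
    proof -
      have "cmod (h s y) = cmod (damp t \<epsilon> s) * (cmod (dline 0 x s) * cmod (dline 0 (- y) s)) * cmod (g y)"
        by (simp add: h_def dprod_def norm_mult)
      also have "\<dots> \<le> cmod (damp t \<epsilon> s) * ((C * (1 + \<bar>x\<bar>) * (1 + \<bar>s\<bar>)) * (C * (1 + \<bar>- y\<bar>) * (1 + \<bar>s\<bar>))) * cmod (g y)"
        using C(1) by (intro mult_right_mono mult_left_mono mult_mono C(2)) auto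
      finally show ?thesis by (simp add: an power2_eq_square mult_ac)
    qed
  qed
  have e: "(\<integral>s. h s y \<partial>wmeas) = (\<integral>s. damp t \<epsilon> s * dprod x y s \<partial>wmeas) * g y" for y
    unfolding h_def by simp
  show "integrable wmeas (\<lambda>y. (\<integral>s. damp t \<epsilon> s * dprod x y s \<partial>wmeas) * g y)"
    using integrable_snd[OF h] unfolding e .
  have "(\<integral>y. (\<integral>s. damp t \<epsilon> s * dprod x y s \<partial>wmeas) * g y \<partial>wmeas) = (\<integral>s. (\<integral>y. h s y \<partial>wmeas) \<partial>wmeas)"
    unfolding e[symmetric] by (rule Fubini_integral[OF h])
  also have "\<dots> = (\<integral>s. damp t \<epsilon> s * dline 0 x s * dtr 0 g (- s) \<partial>wmeas)"
  proof (rule Bochner_Integration.integral_cong[OF refl])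
    fix s
    have "h s y = damp t \<epsilon> s * dline 0 x s * (dline 0 (- s) y * g y)" for y
    proof -
      have "dline 0 (- y) s = dline 0 (- s) y" by (simp add: dline_def mult.commute)
      then show ?thesis by (simp add: h_def dprod_def mult_ac)
    qed
    then show "(\<integral>y. h s y \<partial>wmeas) = damp t \<epsilon> s * dline 0 x s * dtr 0 g (- s)"
      by (simp add: dtr_def)
  qed
  finally show "(\<integral>y. (\<integral>s. damp t \<epsilon> s * dprod x y s \<partial>wmeas) * g y \<partial>wmeas) = (\<integral>s. damp t \<epsilon> s * dline 0 x s * dtr 0 g (- s) \<partial>wmeas)" .
qed

text \<open>The damping changes the integrand by at most \<open>\<epsilon> \<bar>s\<bar>\<close> times its size, and \<open>s\<close> times the spectral function is
  still integrable.\<close>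

lemma damped_limit:
  assumes g: "g \<in> schwartz"
  shows "((\<lambda>\<epsilon>. inverse (of_real (dconst\<^sup>2)) * (\<integral>s. damp t \<epsilon> s * dline 0 x s * dtr 0 g (- s) \<partial>wmeas)) \<longlongrightarrow> evol t g x) (at_right 0)"
proof -
  let ?c = "inverse (of_real (dconst\<^sup>2)) :: complex"
  define k where "k s = dline 0 x s * (of_real s * spec g t s)" for s
  have k: "integrable wmeas k" unfolding k_def[abs_def]
    by (intro dline_integrable schwartz_times_x spec_schwartz g)
  define I where "I = (\<integral>s. cmod (k s) \<partial>wmeas)"
  have s: "integrable wmeas (\<lambda>s. dline 0 x s * spec g t s)" by (intro dline_integrable spec_schwartz g)
  have "cmod ((\<integral>s. damp t \<epsilon> s * dline 0 x s * dtr 0 g (- s) \<partial>wmeas) - dtr 0 (spec g t) x) \<le> \<epsilon> * I" if \<epsilon>: "\<epsilon> > 0" for \<epsilon>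
  proof -
    have eq: "damp t \<epsilon> s * dline 0 x s * dtr 0 g (- s) = of_real (exp (- \<epsilon> * \<bar>s\<bar>)) * (dline 0 x s * spec g t s)" for s
      by (simp add: damp_def spec_def mult_ac)
    have i: "integrable wmeas (\<lambda>s. of_real (exp (- \<epsilon> * \<bar>s\<bar>)) * (dline 0 x s * spec g t s))"
    proof (rule Bochner_Integration.integrable_bound[OF s])
      have [measurable]: "(\<lambda>s. dline 0 x s * spec g t s) \<in> borel_measurable borel"
        using borel_measurable_integrable[OF s] by simp
      show "(\<lambda>s. of_real (exp (- \<epsilon> * \<bar>s\<bar>)) * (dline 0 x s * spec g t s)) \<in> borel_measurable wmeas"
        by measurable
      show "AE s in wmeas. cmod (of_real (exp (- \<epsilon> * \<bar>s\<bar>)) * (dline 0 x s * spec g t s)) \<le> cmod (dline 0 x s * spec g t s)"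
        using \<epsilon> by (intro AE_I2) (simp add: norm_mult mult_left_le_one_le)
    qed
    have diff: "(\<integral>s. damp t \<epsilon> s * dline 0 x s * dtr 0 g (- s) \<partial>wmeas) - dtr 0 (spec g t) x
       = (\<integral>s. of_real (exp (- \<epsilon> * \<bar>s\<bar>)) * (dline 0 x s * spec g t s) - dline 0 x s * spec g t s \<partial>wmeas)"
      unfolding eq dtr_def[of 0 "spec g t"] using Bochner_Integration.integral_diff[OF i s] by simp
    have "cmod ((\<integral>s. damp t \<epsilon> s * dline 0 x s * dtr 0 g (- s) \<partial>wmeas) - dtr 0 (spec g t) x)
        \<le> (\<integral>s. cmod (of_real (exp (- \<epsilon> * \<bar>s\<bar>)) * (dline 0 x s * spec g t s) - dline 0 x s * spec g t s) \<partial>wmeas)"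
      unfolding diff by (rule integral_norm_bound)
    also have "\<dots> \<le> (\<integral>s. \<epsilon> * cmod (k s) \<partial>wmeas)"
    proof (rule integral_mono)
      show "integrable wmeas (\<lambda>s. cmod (of_real (exp (- \<epsilon> * \<bar>s\<bar>)) * (dline 0 x s * spec g t s) - dline 0 x s * spec g t s))"
        by (intro integrable_norm Bochner_Integration.integrable_diff i s)
      show "integrable wmeas (\<lambda>s. \<epsilon> * cmod (k s))" by (intro integrable_mult_right integrable_norm k)
      fix s
      have "\<bar>exp (- \<epsilon> * \<bar>s\<bar>) - 1\<bar> \<le> \<epsilon> * \<bar>s\<bar>"
      proof -
        have "exp (- \<epsilon> * \<bar>s\<bar>) \<le> 1" using \<epsilon> by simp
        moreover have "1 + (- \<epsilon> * \<bar>s\<bar>) \<le> exp (- \<epsilon> * \<bar>s\<bar>)" by (rule exp_ge_add_one_self)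
        ultimately show ?thesis by simp
      qed
      then have "\<bar>exp (- \<epsilon> * \<bar>s\<bar>) - 1\<bar> * cmod (dline 0 x s * spec g t s) \<le> \<epsilon> * \<bar>s\<bar> * cmod (dline 0 x s * spec g t s)"
        by (rule mult_right_mono) simp
      moreover have "of_real (exp (- \<epsilon> * \<bar>s\<bar>)) * (dline 0 x s * spec g t s) - dline 0 x s * spec g t s
          = of_real (exp (- \<epsilon> * \<bar>s\<bar>) - 1) * (dline 0 x s * spec g t s)"
        by (simp add: left_diff_distrib)
      moreover have "\<epsilon> * \<bar>s\<bar> * cmod (dline 0 x s * spec g t s) = \<epsilon> * cmod (k s)"
        by (simp add: k_def norm_mult)
      ultimately show "cmod (of_real (exp (- \<epsilon> * \<bar>s\<bar>)) * (dline 0 x s * spec g t s) - dline 0 x s * spec g t s) \<le> \<epsilon> * cmod (k s)"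
        by (simp only: norm_mult[of "of_real _"] norm_of_real)
    qed
    finally show ?thesis by (simp add: I_def)
  qed
  then have ev: "\<forall>\<^sub>F \<epsilon> in at_right 0. norm ((\<integral>s. damp t \<epsilon> s * dline 0 x s * dtr 0 g (- s) \<partial>wmeas) - dtr 0 (spec g t) x) \<le> \<epsilon> * I"
    unfolding eventually_at_filter by (intro always_eventually) auto
  have "((\<lambda>\<epsilon>. \<epsilon> * I) \<longlongrightarrow> 0 * I) (at_right 0)" by (intro tendsto_intros)
  then have "((\<lambda>\<epsilon>. \<epsilon> * I) \<longlongrightarrow> 0) (at_right 0)" by simp
  from Lim_null_comparison[OF ev this]
  have "((\<lambda>\<epsilon>. \<integral>s. damp t \<epsilon> s * dline 0 x s * dtr 0 g (- s) \<partial>wmeas) \<longlongrightarrow> dtr 0 (spec g t) x) (at_right 0)"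
    by (rule LIM_zero_cancel)
  then show ?thesis unfolding evol_def by (intro tendsto_mult tendsto_const)
qed

end

theorem theoremA:
  fixes b t x :: real
    and f :: "real \<Rightarrow> complex"
    and U :: "real \<Rightarrow> (real \<Rightarrow> complex) \<Rightarrow> (real \<Rightarrow> complex)"
  assumes "b > - 1/2"
    and "is_exp_D b U"
    and "f \<in> weighted_schwartz b"
    and "x \<noteq> 0"
  shows "\<exists>F \<in> weighted_schwartz b. L2_eq (U t f) F \<and>
           (\<forall>\<epsilon>>0. integrable lborel (\<lambda>y. jump_kernel b t \<epsilon> x y * f y * of_real (\<bar>y\<bar> powr b))) \<and>
           (\<exists>L. ((\<lambda>\<epsilon>. \<integral>y. jump_kernel b t \<epsilon> x y * f y * of_real (\<bar>y\<bar> powr b) \<partial>lborel) \<longlongrightarrow> L) (at_right 0)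
                \<and> F x = of_real (\<bar>x\<bar> powr b) * L)"
proof -
  interpret dunkl b by standard (rule assms(1))
  obtain g where g: "g \<in> schwartz" and f: "\<And>x. x \<noteq> 0 \<Longrightarrow> f x = of_real (\<bar>x\<bar> powr b) * g x"
    using assms(3) unfolding weighted_schwartz_def by blast
  let ?c = "inverse (of_real (dconst\<^sup>2)) :: complex"
  let ?K = "\<lambda>\<epsilon> y. (\<integral>s. damp t \<epsilon> s * dprod x y s \<partial>wmeas) * g y"
  let ?F = "\<lambda>\<epsilon> y. jump_kernel b t \<epsilon> x y * f y * of_real (\<bar>y\<bar> powr b)"
  let ?G = "\<lambda>\<epsilon> y. ?c * ((\<bar>y\<bar> powr (2 * b)) *\<^sub>R ?K \<epsilon> y)"
  have K: "integrable lborel (?G \<epsilon>)"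
      "(\<integral>y. ?G \<epsilon> y \<partial>lborel) = ?c * (\<integral>s. damp t \<epsilon> s * dline 0 x s * dtr 0 g (- s) \<partial>wmeas)" if "\<epsilon> > 0" for \<epsilon>
  proof -
    note i = kernel_integral[OF g that, of t x]
    have m: "?K \<epsilon> \<in> borel_measurable borel" using borel_measurable_integrable[OF i(1)] by simp
    show "integrable lborel (?G \<epsilon>)"
      by (intro integrable_mult_right) (use i(1) integrable_wmeas[OF m] in simp)
    show "(\<integral>y. ?G \<epsilon> y \<partial>lborel) = ?c * (\<integral>s. damp t \<epsilon> s * dline 0 x s * dtr 0 g (- s) \<partial>wmeas)"
      unfolding integral_mult_right_zero integral_wmeas[OF m, symmetric] i(2) ..
  qed
  have FG: "?F \<epsilon> y = ?G \<epsilon> y" if "\<epsilon> > 0" "y \<noteq> 0" for \<epsilon> y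
  proof -
    have p: "\<bar>y\<bar> powr (2 * b) = \<bar>y\<bar> powr b * \<bar>y\<bar> powr b" by (simp flip: powr_add)
    show ?thesis
      unfolding jump_kernel_eq[OF assms(4) that(2,1)] f[OF that(2)] p scaleR_conv_of_real of_real_mult by (simp only: mult_ac)
  qed
  have int: "integrable lborel (?F \<epsilon>)" if "\<epsilon> > 0" for \<epsilon>
    by (rule eq_off_zero(1)[OF K(1)[OF that] FG[OF that]])
  have lim: "((\<lambda>\<epsilon>. \<integral>y. ?F \<epsilon> y \<partial>lborel) \<longlongrightarrow> evol t g x) (at_right 0)"
  proof (rule Lim_transform_eventually[OF damped_limit[OF g]])
    show "\<forall>\<^sub>F \<epsilon> in at_right 0. ?c * (\<integral>s. damp t \<epsilon> s * dline 0 x s * dtr 0 g (- s) \<partial>wmeas) = (\<integral>y. ?F \<epsilon> y \<partial>lborel)"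
      unfolding eventually_at_filter
    proof (intro always_eventually allI impI)
      fix \<epsilon> :: real assume "\<epsilon> \<in> {0<..}"
      then have \<epsilon>: "\<epsilon> > 0" by simp
      show "?c * (\<integral>s. damp t \<epsilon> s * dline 0 x s * dtr 0 g (- s) \<partial>wmeas) = (\<integral>y. ?F \<epsilon> y \<partial>lborel)"
        using eq_off_zero(2)[OF K(1)[OF \<epsilon>] FG[OF \<epsilon>]] K(2)[OF \<epsilon>] by simp
    qed
  qed
  show ?thesis
  proof (rule bexI[of _ "wlift (evol t g)"], intro conjI)
    show "wlift (evol t g) \<in> weighted_schwartz b" by (intro wlift_weighted_schwartz evol_schwartz g)
    show "L2_eq (U t f) (wlift (evol t g))" by (rule exp_D_eq_evol[OF assms(2) g f])
    show "\<forall>\<epsilon>>0. integrable lborel (?F \<epsilon>)" using int by blast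
    show "\<exists>L. ((\<lambda>\<epsilon>. \<integral>y. ?F \<epsilon> y \<partial>lborel) \<longlongrightarrow> L) (at_right 0) \<and> wlift (evol t g) x = of_real (\<bar>x\<bar> powr b) * L"
      using lim by (intro exI[of _ "evol t g x"]) (simp add: wlift_def)
  qed
qed

end
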